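(* Let $(\Xi,\mathcal G,K,Q)$ be a projection valued measure space, $(\Sigma,\mathcal H,\rho)$ a finite measure space, and $\varphi:\Xi\times\Sigma\to\mathbb C$ a bounded $\mathcal G\otimes\mathcal H$-measurable function. If $A:\Sigma\to B(K)$ is pointwise weakly measurable and $\sup_{\sigma\in\Sigma}\|A(\sigma)\|_{\mathcal S_1}<\infty$, then the pointwise Pettis integrals satisfy $$\int_\Sigma A(\sigma)\,Q(\varphi(\cdot,\sigma))\,\rho(d\sigma),\ \int_\Sigma Q(\varphi(\cdot,\sigma))\,A(\sigma)\,\rho(d\sigma)\in\mathcal S_1(K)$$ and $$\operatorname{Tr}\Big(\int_\Sigma A(\sigma)\,Q(\varphi(\cdot,\sigma))\,\rho(d\sigma)\Big)=\operatorname{Tr}\Big(\int_\Sigma Q(\varphi(\cdot,\sigma))\,A(\sigma)\,\rho(d\sigma)\Big).$$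
   Context: Hilbert spaces are complex (not assumed separable), inner products linear in the first argument. A projection valued measure space $(\Xi,\mathcal G,K,Q)$: $(\Xi,\mathcal G)$ is a measurable space, $K$ a complex Hilbert space, $Q:\mathcal G\to B(K)$ with $Q(\Xi)=\mathrm{id}_K$, $Q(G)^2=Q(G)=Q(G)^*$, countably additive in the weak operator topology. For bounded measurable $f:\Xi\to\mathbb C$, $Q(f)\in B(K)$ is the unique operator with $\langle Q(f)h,k\rangle=\int_\Xi f\,dQ_{h,k}$, where $Q_{h,k}(G)=\langle Q(G)h,k\rangle$. $\mathcal S_1(K)$ is the space of trace class operators on $K$ with trace norm $\|\cdot\|_{\mathcal S_1}$ ($=\infty$ for operators that are not trace class), and $\operatorname{Tr}$ is the usual trace. $F:\Sigma\to B(K)$ is pointwise weakly measurable if $\sigma\mapsto\langle F(\sigma)h,k\rangle$ is measurable for all $h,k\in K$; it is pointwise Pettis integrable if moreover $\int_\Sigma|\langle F(\sigma)h,k\rangle|\,\rho(d\sigma)<\infty$ for all $h,k\in K$, and then its pointwise Pettis integral $\int_\Sigma F\,d\rho\in B(K)$ is the unique bounded operator with $\langle(\int_\Sigma F\,d\rho)h,k\rangle=\int_\Sigma\langle F(\sigma)h,k\rangle\,\rho(d\sigma)$ for all $h,k$. *)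

theory Defs
  imports "HOL-Analysis.Analysis"
begin

section \<open>Complex Hilbert spaces\<close>

text \<open>
  The inner product is linear in its first argument. A complex Hilbert space is regarded as a real
  one via the real part of its inner product, so that norm and topology are those of the class
  \<^class>\<open>real_inner\<close>. No separability is assumed.
\<close>

class complex_hilbert_space = banach + real_inner +
  fixes scaleC :: "complex \<Rightarrow> 'a \<Rightarrow> 'a"
    and cinner :: "'a \<Rightarrow> 'a \<Rightarrow> complex"
  assumes scaleC_add_right: "scaleC c (x + y) = scaleC c x + scaleC c y"
    and scaleC_add_left: "scaleC (c + d) x = scaleC c x + scaleC d x"
    and scaleC_scaleC: "scaleC c (scaleC d x) = scaleC (c * d) x"
    and scaleC_of_real: "scaleC (complex_of_real r) x = r *\<^sub>R x"
    and cinner_commute: "cinner x y = cnj (cinner y x)"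
    and cinner_add_left: "cinner (x + y) z = cinner x z + cinner y z"
    and cinner_scaleC_left: "cinner (scaleC c x) y = c * cinner x y"
    and inner_eq_Re_cinner: "x \<bullet> y = Re (cinner x y)"

section \<open>Bounded operators, trace norm and trace\<close>

definition bounded_clinear :: "('k::complex_hilbert_space \<Rightarrow> 'k) \<Rightarrow> bool" where
  "bounded_clinear T \<longleftrightarrow> bounded_linear T \<and> (\<forall>c x. T (scaleC c x) = scaleC c (T x))"

definition cadjoint :: "('k::complex_hilbert_space \<Rightarrow> 'k) \<Rightarrow> 'k \<Rightarrow> 'k" where
  "cadjoint T = (THE S. bounded_clinear S \<and> (\<forall>h k. cinner (T h) k = cinner h (S k)))"

definition positive_op :: "('k::complex_hilbert_space \<Rightarrow> 'k) \<Rightarrow> bool" where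
  "positive_op P \<longleftrightarrow> bounded_clinear P \<and>
     (\<forall>h. Im (cinner (P h) h) = 0 \<and> Re (cinner (P h) h) \<ge> 0)"

text \<open>The operator absolute value, i.e. the positive square root of \<open>T\<^sup>* T\<close>.\<close>

definition abs_op :: "('k::complex_hilbert_space \<Rightarrow> 'k) \<Rightarrow> 'k \<Rightarrow> 'k" where
  "abs_op T = (THE P. positive_op P \<and> P \<circ> P = cadjoint T \<circ> T)"

definition orthonormal :: "'k::complex_hilbert_space set \<Rightarrow> bool" where
  "orthonormal E \<longleftrightarrow> (\<forall>e\<in>E. \<forall>f\<in>E. cinner e f = (if e = f then 1 else 0))"

definition orthonormal_basis :: "'k::complex_hilbert_space set \<Rightarrow> bool" where
  "orthonormal_basis E \<longleftrightarrow> orthonormal E \<and> (\<forall>F. orthonormal F \<and> E \<subseteq> F \<longrightarrow> F = E)"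

text \<open>
  The trace norm of a bounded operator, and the trace of a trace class operator, do not depend on
  the orthonormal basis used to compute them, so an arbitrary one is fixed.
\<close>

definition some_onb :: "'k::complex_hilbert_space set" where
  "some_onb = (SOME E. orthonormal_basis E)"

definition trace_norm :: "('k::complex_hilbert_space \<Rightarrow> 'k) \<Rightarrow> ennreal" where
  "trace_norm T = (\<Sum>\<^sub>\<infinity>e\<in>some_onb. ennreal (Re (cinner (abs_op T e) e)))"

definition trace_class :: "('k::complex_hilbert_space \<Rightarrow> 'k) \<Rightarrow> bool" where
  "trace_class T \<longleftrightarrow> bounded_clinear T \<and> trace_norm T < \<infinity>"

definition op_trace :: "('k::complex_hilbert_space \<Rightarrow> 'k) \<Rightarrow> complex" where
  "op_trace T = (\<Sum>\<^sub>\<infinity>e\<in>some_onb. cinner (T e) e)"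

section \<open>Projection valued measures\<close>

text \<open>
  Of \<open>X\<close> only the underlying measurable space \<open>(space X, sets X)\<close> is used.
\<close>

locale projection_valued_measure =
  fixes X :: "'x measure" and Q :: "'x set \<Rightarrow> 'k::complex_hilbert_space \<Rightarrow> 'k"
  assumes bounded: "G \<in> sets X \<Longrightarrow> bounded_clinear (Q G)"
    and space: "Q (space X) = id"
    and idempotent: "G \<in> sets X \<Longrightarrow> Q G \<circ> Q G = Q G"
    and self_adjoint: "G \<in> sets X \<Longrightarrow> cadjoint (Q G) = Q G"
    and weakly_countably_additive:
      "range B \<subseteq> sets X \<Longrightarrow> disjoint_family B \<Longrightarrow>
        (\<lambda>n::nat. cinner (Q (B n) h) k) sums cinner (Q (\<Union>n. B n) h) k"

text \<open>
  The integral of \<open>f\<close> against a complex measure \<open>\<nu>\<close> on \<open>(space X, sets X)\<close>: write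
  \<open>\<nu> = \<mu>\<^sub>0 + \<i> \<mu>\<^sub>1 - \<mu>\<^sub>2 - \<i> \<mu>\<^sub>3\<close> with finite positive measures and integrate termwise. The value does not
  depend on the decomposition.
\<close>

definition complex_measure_integral ::
  "'x measure \<Rightarrow> ('x set \<Rightarrow> complex) \<Rightarrow> ('x \<Rightarrow> complex) \<Rightarrow> complex" where
  "complex_measure_integral X \<nu> f = (THE c. \<exists>\<mu> :: nat \<Rightarrow> 'x measure.
     (\<forall>n<4. finite_measure (\<mu> n) \<and> sets (\<mu> n) = sets X \<and> integrable (\<mu> n) f) \<and>
     (\<forall>G\<in>sets X. \<nu> G = (\<Sum>n<4. \<i> ^ n * complex_of_real (measure (\<mu> n) G))) \<and>
     c = (\<Sum>n<4. \<i> ^ n * (\<integral>x. f x \<partial>\<mu> n)))"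

definition pvm_integral ::
  "'x measure \<Rightarrow> ('x set \<Rightarrow> 'k::complex_hilbert_space \<Rightarrow> 'k) \<Rightarrow> ('x \<Rightarrow> complex) \<Rightarrow> 'k \<Rightarrow> 'k" where
  "pvm_integral X Q f = (THE T. bounded_clinear T \<and>
     (\<forall>h k. cinner (T h) k = complex_measure_integral X (\<lambda>G. cinner (Q G h) k) f))"

section \<open>Pointwise Pettis integrals of operator valued functions\<close>

definition pointwise_weakly_measurable ::
  "'s measure \<Rightarrow> ('s \<Rightarrow> 'k::complex_hilbert_space \<Rightarrow> 'k) \<Rightarrow> bool" where
  "pointwise_weakly_measurable S F \<longleftrightarrow> (\<forall>\<sigma>\<in>space S. bounded_clinear (F \<sigma>)) \<and>
     (\<forall>h k. (\<lambda>\<sigma>. cinner (F \<sigma> h) k) \<in> borel_measurable S)"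

definition pointwise_Pettis_integrable ::
  "'s measure \<Rightarrow> ('s \<Rightarrow> 'k::complex_hilbert_space \<Rightarrow> 'k) \<Rightarrow> bool" where
  "pointwise_Pettis_integrable S F \<longleftrightarrow> pointwise_weakly_measurable S F \<and>
     (\<forall>h k. (\<integral>\<^sup>+\<sigma>. ennreal (cmod (cinner (F \<sigma> h) k)) \<partial>S) < \<infinity>)"

definition pointwise_Pettis_integral ::
  "'s measure \<Rightarrow> ('s \<Rightarrow> 'k::complex_hilbert_space \<Rightarrow> 'k) \<Rightarrow> 'k \<Rightarrow> 'k" where
  "pointwise_Pettis_integral S F = (THE T. bounded_clinear T \<and>
     (\<forall>h k. cinner (T h) k = (\<integral>\<sigma>. cinner (F \<sigma> h) k \<partial>S)))"

end

theory Submission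
  imports Defs
begin

text \<open>
  For separable \<open>K\<close> one would interchange trace and integral and use that \<open>A \<sigma>\<close> and \<open>Q(\<phi>(\<cdot>,\<sigma>))\<close> commute
  under the trace. For general \<open>K\<close> the interchange is false: on \<open>K = \<ell>\<^sup>2([0,1])\<close> the operators
  \<open>F \<sigma> = \<langle>\<cdot>, e\<^sub>\<sigma>\<rangle> e\<^sub>\<sigma>\<close> have trace 1, while their Pettis integral with respect to Lebesgue measure is 0.
  The identity of the two traces holds nevertheless, because \<open>\<phi>\<close> is built from rectangles by
  linear combinations and limits of sequences, so that only countably many operators have to be
  considered at a time. The proof is accordingly a functional monotone class argument in \<open>\<phi>\<close>
  (\<open>bounded_measurable_induct\<close>), which also supplies the weak measurability of the two integrands.

  Rectangles. For \<open>\<phi> = 1\<^sub>G\<^sub>\<times>\<^sub>H\<close> the integrals are \<open>T Q(G)\<close> and \<open>Q(G) T\<close>, where \<open>T\<close> is the Pettis integral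
  of \<open>A\<close> over \<open>H\<close>. So the claim is the commutation of a trace class and a bounded operator under the
  trace (\<open>trace_commute\<close>), and no interchange of trace and integral is involved
  (\<open>commutes_rectangle\<close>).

  Limits. Let \<open>\<phi>\<^sub>n \<rightarrow> \<phi>\<close> boundedly and pointwise, and let \<open>T\<^sub>n\<close> and \<open>T\<close> be the corresponding integrals. Each
  of them is trace class, so at most countably many elements of the orthonormal basis contribute to
  any of the traces. On this countable set \<open>E\<close> trace and integral may be interchanged, and it remains
  to see that, for fixed \<open>\<sigma>\<close>, the partial traces \<open>\<Sum>\<^sub>e\<^sub>\<in>\<^sub>E \<langle>A \<sigma> Q(\<phi>\<^sub>n(\<cdot>,\<sigma>)) e, e\<rangle>\<close> converge. Writing \<open>A \<sigma> = B D\<close> with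
  Hilbert-Schmidt operators, the tails of these sums are small uniformly in \<open>n\<close>, and each term
  converges since \<open>Q(\<phi>\<^sub>n(\<cdot>,\<sigma>))\<close> converges weakly (\<open>hs_pairing_tendsto\<close>, \<open>op_trace_Pettis_limit\<close>).

  That the integrals are trace class at all follows from a description of the trace norm that passes
  through weak integrals: \<open>trace_norm T \<le> c\<close> holds iff \<open>\<bar>\<Sum>\<^sub>e\<^sub>\<in>\<^sub>F \<langle>T e, U e\<rangle>\<bar> \<le> c\<close> for all finite orthonormal \<open>F\<close>
  and all contractions \<open>U\<close> (\<open>trace_norm_le_iff\<close>). This rests on the operator absolute value, hence on
  square roots of positive operators, and on the factorization of an operator through any operator
  that dominates it in norm (\<open>douglas_factorization\<close>), which plays the role of the polar decomposition.
\<close>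

section \<open>Complex inner products and bounded operators\<close>

lemma cinner_add_right: "cinner x (y + z) = cinner x y + cinner x z"
  by (metis cinner_add_left cinner_commute complex_cnj_add)

lemma cinner_scaleC_right: "cinner x (scaleC c y) = cnj c * cinner x y"
  by (metis cinner_commute cinner_scaleC_left complex_cnj_mult)

lemma scaleC_one [simp]: "scaleC 1 x = x"
  using scaleC_of_real[of 1 x] by simp

lemma scaleC_zero_left [simp]: "scaleC 0 x = 0"
  using scaleC_of_real[of 0 x] by simp

lemma scaleC_minus_one: "scaleC (- 1) x = - x"
  using scaleC_of_real[of "-1" x] by simp

lemma scaleC_zero_right [simp]: "scaleC c 0 = 0"
  using scaleC_add_right[of c 0 0] by simp

lemma cinner_zero_left [simp]: "cinner 0 x = 0"
  using cinner_scaleC_left[of 0 0 x] by simp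

lemma cinner_zero_right [simp]: "cinner x 0 = 0"
  using cinner_scaleC_right[of x 0 0] by simp

lemma cinner_minus_left [simp]: "cinner (- x) y = - cinner x y"
  using cinner_scaleC_left[of "-1" x y] by (simp add: scaleC_minus_one)

lemma cinner_minus_right [simp]: "cinner x (- y) = - cinner x y"
  using cinner_scaleC_right[of x "-1" y] by (simp add: scaleC_minus_one)

lemma cinner_diff_left: "cinner (x - y) z = cinner x z - cinner y z"
  using cinner_add_left[of x "-y" z] by simp

lemma cinner_diff_right: "cinner x (y - z) = cinner x y - cinner x z"
  using cinner_add_right[of x y "-z"] by simp

lemma cinner_self: "cinner x x = complex_of_real ((norm x)\<^sup>2)"
proof -
  have "Im (cinner x x) = 0"
    using cinner_commute[of x x] by (metis Reals_cnj_iff complex_is_Real_iff)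
  moreover have "Re (cinner x x) = (norm x)\<^sup>2"
    by (metis inner_eq_Re_cinner power2_norm_eq_inner)
  ultimately show ?thesis by (simp add: complex_eq_iff)
qed

lemma norm_scaleC: "norm (scaleC c x) = cmod c * norm x"
proof -
  have "complex_of_real ((norm (scaleC c x))\<^sup>2) = cinner (scaleC c x) (scaleC c x)"
    by (simp only: cinner_self)
  also have "\<dots> = (c * cnj c) * cinner x x"
    by (simp add: cinner_scaleC_left cinner_scaleC_right)
  also have "\<dots> = complex_of_real ((cmod c * norm x)\<^sup>2)"
    by (simp only: cinner_self complex_norm_square[symmetric] power_mult_distrib of_real_mult)
  finally show ?thesis
    by (metis mult_nonneg_nonneg norm_ge_zero of_real_eq_iff power2_eq_imp_eq)
qed

lemma bounded_linear_scaleC: "bounded_linear (scaleC c :: 'k \<Rightarrow> 'k::complex_hilbert_space)"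
  by (rule bounded_linear_intro[of _ "cmod c"])
    (simp_all add: scaleC_add_right norm_scaleC scaleC_of_real[symmetric] scaleC_scaleC mult.commute)

lemma norm_cinner_le: "cmod (cinner x y) \<le> norm x * norm y"
proof (cases "cinner x y = 0")
  case False
  define c where "c = cnj (cinner x y) / cmod (cinner x y)"
  have c: "cmod c = 1" using False by (simp add: c_def norm_divide)
  have "c * cinner x y = cmod (cinner x y)"
    using False by (simp add: c_def complex_norm_square[symmetric] mult.commute power2_eq_square)
  then have "cmod (cinner x y) = Re (cinner (scaleC c x) y)"
    by (simp add: cinner_scaleC_left)
  also have "\<dots> = scaleC c x \<bullet> y" by (simp add: inner_eq_Re_cinner)
  also have "\<dots> \<le> norm (scaleC c x) * norm y" by (rule norm_cauchy_schwarz)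
  finally show ?thesis using c by (simp add: norm_scaleC)
qed simp

lemma bounded_bilinear_cinner: "bounded_bilinear cinner"
proof
  show "\<exists>K. \<forall>a b. norm (cinner a b) \<le> norm a * norm b * K"
    using norm_cinner_le by (metis mult.right_neutral)
qed (simp_all add: cinner_add_left cinner_add_right cinner_scaleC_left cinner_scaleC_right
      scaleC_of_real[symmetric] scaleR_conv_of_real)

lemmas tendsto_cinner = bounded_bilinear.tendsto[OF bounded_bilinear_cinner]

lemma cinner_ext_left: "(\<And>k. cinner x k = cinner y k) \<Longrightarrow> x = y"
  by (metis cinner_diff_left cinner_self diff_self eq_iff_diff_eq_0 norm_eq_zero of_real_eq_0_iff
      power_eq_0_iff)

lemma cinner_ext_right: "(\<And>h. cinner h x = cinner h y) \<Longrightarrow> x = y"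
  by (rule cinner_ext_left) (simp add: cinner_commute[of x] cinner_commute[of y])

lemma norm_le_by_cinner:
  assumes "\<And>k. cmod (cinner x k) \<le> c * norm k" "c \<ge> 0"
  shows "norm x \<le> c"
proof (cases "x = 0")
  case False
  have "norm x * norm x \<le> c * norm x"
    using assms(1)[of x] by (simp add: cinner_self power2_eq_square norm_mult)
  then show ?thesis using False by simp
qed (use assms in auto)

lemma bounded_clinear_linear: "bounded_clinear T \<Longrightarrow> bounded_linear T"
  by (simp add: bounded_clinear_def)

lemma bounded_clinear_add: "bounded_clinear T \<Longrightarrow> T (x + y) = T x + T y"
  by (simp add: bounded_clinear_def linear_simps)

lemma bounded_clinear_diff: "bounded_clinear T \<Longrightarrow> T (x - y) = T x - T y"
  by (simp add: bounded_clinear_def linear_simps)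

lemma bounded_clinear_zero: "bounded_clinear T \<Longrightarrow> T 0 = 0"
  by (simp add: bounded_clinear_def linear_simps)

lemma bounded_clinear_scaleC: "bounded_clinear T \<Longrightarrow> T (scaleC c x) = scaleC c (T x)"
  by (simp add: bounded_clinear_def)

lemma bounded_clinear_scaleR: "bounded_clinear T \<Longrightarrow> T (r *\<^sub>R x) = r *\<^sub>R T x"
  by (simp add: bounded_clinear_linear bounded_linear.linear linear_scale)

lemmas bounded_clinear_simps =
  bounded_clinear_add bounded_clinear_diff bounded_clinear_zero bounded_clinear_scaleC

lemma bounded_clinear_bound:
  assumes "bounded_clinear T"
  obtains c where "c \<ge> 0" "\<And>x. norm (T x) \<le> c * norm x"
  using bounded_linear.nonneg_bounded[OF bounded_clinear_linear[OF assms]]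
  by (metis mult.commute)

lemma bounded_clinearI:
  assumes "\<And>x y. T (x + y) = T x + T y" "\<And>c x. T (scaleC c x) = scaleC c (T x)"
    "\<And>x. norm (T x) \<le> c * norm x"
  shows "bounded_clinear T"
proof -
  have "T (r *\<^sub>R x) = r *\<^sub>R T x" for r x
    by (metis assms(2) scaleC_of_real)
  then show ?thesis
    unfolding bounded_clinear_def using assms
    by (auto intro!: bounded_linear_intro[of _ c] simp: mult.commute)
qed

lemma bounded_clinear_compose:
  "bounded_clinear T \<Longrightarrow> bounded_clinear U \<Longrightarrow> bounded_clinear (T \<circ> U)"
  by (auto simp: bounded_clinear_def o_def intro: bounded_linear_compose)

lemma bounded_clinear_id: "bounded_clinear (id :: 'a::complex_hilbert_space \<Rightarrow> 'a)"
  by (auto simp: bounded_clinear_def id_def intro: bounded_linear_ident)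

lemma bounded_clinear_lincomb:
  "bounded_clinear T \<Longrightarrow> bounded_clinear U \<Longrightarrow> bounded_clinear (\<lambda>x. scaleC c (T x) + U x)"
proof -
  assume T: "bounded_clinear T" and U: "bounded_clinear U"
  obtain t where t: "\<And>x. norm (T x) \<le> t * norm x" using bounded_clinear_bound[OF T] by blast
  obtain u where u: "\<And>x. norm (U x) \<le> u * norm x" using bounded_clinear_bound[OF U] by blast
  show ?thesis
  proof (rule bounded_clinearI)
    fix x
    have "norm (scaleC c (T x) + U x) \<le> cmod c * norm (T x) + norm (U x)"
      by (metis norm_scaleC norm_triangle_ineq)
    also have "\<dots> \<le> cmod c * (t * norm x) + u * norm x"
      by (intro add_mono mult_left_mono t u) auto
    finally show "norm (scaleC c (T x) + U x) \<le> (cmod c * t + u) * norm x"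
      by (simp add: algebra_simps)
  qed (use T U in \<open>simp_all add: bounded_clinear_simps scaleC_add_right scaleC_scaleC mult.commute\<close>)
qed

section \<open>Riesz representation, adjoints and factorization\<close>

text \<open>
  Riesz representation for functionals that are controlled by a linear map \<open>C\<close>, hence factor through
  its range. The representing vector is the limit of \<open>C x\<^sub>n\<close> along a minimizing sequence \<open>x\<^sub>n\<close> of
  \<open>J x = \<parallel>C x\<parallel>\<^sup>2 - 2 f x\<close>, which is Cauchy by the parallelogram identity. The case \<open>C = id\<close> is the usual
  theorem, and general \<open>C\<close> gives the factorization of operators below.
\<close>

lemma riesz_along:
  fixes C :: "'a::real_vector \<Rightarrow> 'b::{real_inner, banach}" and f :: "'a \<Rightarrow> real"
  assumes C: "linear C" and f: "linear f" and le: "\<And>x. \<bar>f x\<bar> \<le> c * norm (C x)"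
  obtains z where "z \<in> closure (range C)" "\<And>x. f x = C x \<bullet> z"
proof -
  define J where "J = (\<lambda>x. (norm (C x))\<^sup>2 - 2 * f x)"
  have JD: "J x = (norm (C x))\<^sup>2 - 2 * f x" for x by (simp add: J_def)
  have J_lower: "- c\<^sup>2 \<le> J x" for x
  proof -
    have "2 * f x \<le> 2 * (c * norm (C x))" using le[of x] by linarith
    also have "\<dots> \<le> c\<^sup>2 + (norm (C x))\<^sup>2"
      using sum_squares_bound[of c "norm (C x)"] by simp
    finally show ?thesis by (simp add: J_def)
  qed
  define m where "m = Inf (range J)"
  have bdd: "bdd_below (range J)" using J_lower by (auto intro!: bdd_belowI)
  have m: "m \<le> J x" for x unfolding m_def by (rule cInf_lower[OF _ bdd]) simp
  have "\<exists>x. J x < m + 1 / (Suc n)" for n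
  proof -
    have "\<exists>y\<in>range J. y < m + 1 / (Suc n)"
      unfolding m_def by (rule cInf_lessD) auto
    then show ?thesis by auto
  qed
  then obtain x where x: "\<And>n. J (x n) < m + 1 / (Suc n)"
    using choice[of "\<lambda>n x. J x < m + 1 / (Suc n)"] by blast
  have expand: "J (u + t *\<^sub>R v) = J u + 2 * t * (C u \<bullet> C v - f v) + t\<^sup>2 * (norm (C v))\<^sup>2" for u v t
  proof -
    have "(norm (C u + t *\<^sub>R C v))\<^sup>2 = (norm (C u))\<^sup>2 + 2 * t * (C u \<bullet> C v) + t\<^sup>2 * (norm (C v))\<^sup>2"
      by (simp only: power2_norm_eq_inner inner_add_left inner_add_right inner_scaleR_left inner_scaleR_right)
        (simp add: inner_commute[of "C v" "C u"] power2_eq_square algebra_simps)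
    then show ?thesis
      by (simp add: J_def linear_add[OF C] linear_add[OF f] linear_scale[OF C] linear_scale[OF f])
        (simp add: algebra_simps)
  qed
  have mid: "(norm (C u - C v))\<^sup>2 \<le> 2 * J u + 2 * J v - 4 * m" for u v
  proof -
    have "4 * J ((1/2) *\<^sub>R (u + v)) = 2 * J u + 2 * J v - (norm (C u - C v))\<^sup>2"
    proof -
      have "(norm (C u - C v))\<^sup>2 = 2 * (norm (C u))\<^sup>2 + 2 * (norm (C v))\<^sup>2 - (norm (C u + C v))\<^sup>2"
        by (simp only: power2_norm_eq_inner inner_add_left inner_add_right inner_diff_left inner_diff_right)
      moreover have "4 * J ((1/2) *\<^sub>R (u + v)) = (norm (C u + C v))\<^sup>2 - 4 * (f u + f v)"
      proof -
        have "C ((1/2) *\<^sub>R (u + v)) = (1/2) *\<^sub>R (C u + C v)" "f ((1/2) *\<^sub>R (u + v)) = (1/2) * (f u + f v)"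
          by (simp_all only: linear_add[OF C] linear_add[OF f] linear_scale[OF C] linear_scale[OF f] real_scaleR_def)
        then show ?thesis by (simp add: JD power_divide power2_eq_square)
      qed
      ultimately show ?thesis using JD[of u] JD[of v] by (simp add: algebra_simps)
    qed
    then show ?thesis using m[of "(1/2) *\<^sub>R (u + v)"] by linarith
  qed
  have "Cauchy (\<lambda>n. C (x n))"
  proof (rule metric_CauchyI)
    fix e :: real assume e: "e > 0"
    obtain N where N: "1 / (Suc N) < e\<^sup>2 / 4"
      using nat_approx_posE[of "e\<^sup>2 / 4"] e by auto
    have "dist (C (x p)) (C (x q)) < e" if "p \<ge> N" "q \<ge> N" for p q
    proof -
      have "J (x p) < m + 1 / (Suc N)" "J (x q) < m + 1 / (Suc N)"
        using x[of p] x[of q] that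
        by (intro order.strict_trans2[OF x]; simp add: frac_le)+
      then have "(norm (C (x p) - C (x q)))\<^sup>2 < e\<^sup>2"
        using mid[of "x p" "x q"] N by linarith
      then show ?thesis using e by (simp add: dist_norm power_less_imp_less_base)
    qed
    then show "\<exists>N. \<forall>p\<ge>N. \<forall>q\<ge>N. dist (C (x p)) (C (x q)) < e" by blast
  qed
  then obtain z where z: "(\<lambda>n. C (x n)) \<longlonglongrightarrow> z"
    using Cauchy_convergent convergent_def by blast
  have Jm: "(\<lambda>n. J (x n)) \<longlonglongrightarrow> m"
  proof (rule tendsto_sandwich[OF always_eventually always_eventually])
    show "\<forall>n. m \<le> J (x n)" using m by blast
    show "\<forall>n. J (x n) \<le> m + 1 / (Suc n)" using x less_imp_le by blast
    show "(\<lambda>n. m + 1 / real (Suc n)) \<longlonglongrightarrow> m"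
      using tendsto_add[OF tendsto_const LIMSEQ_inverse_real_of_nat, of m] by (simp add: inverse_eq_divide)
  qed simp
  have var: "0 \<le> 2 * t * (z \<bullet> C v - f v) + t\<^sup>2 * (norm (C v))\<^sup>2" for t v
  proof -
    have "(\<lambda>n. J (x n) + 2 * t * (C (x n) \<bullet> C v - f v) + t\<^sup>2 * (norm (C v))\<^sup>2)
        \<longlonglongrightarrow> m + 2 * t * (z \<bullet> C v - f v) + t\<^sup>2 * (norm (C v))\<^sup>2"
      by (intro tendsto_intros Jm z)
    moreover have "\<forall>n. m \<le> J (x n) + 2 * t * (C (x n) \<bullet> C v - f v) + t\<^sup>2 * (norm (C v))\<^sup>2"
      unfolding expand[symmetric] using m by blast
    ultimately have "m \<le> m + 2 * t * (z \<bullet> C v - f v) + t\<^sup>2 * (norm (C v))\<^sup>2"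
      by (intro LIMSEQ_le_const) auto
    then show ?thesis by simp
  qed
  have "f v = C v \<bullet> z" for v
  proof -
    define d where "d = z \<bullet> C v - f v"
    define s where "s = (norm (C v))\<^sup>2"
    have s: "s \<ge> 0" by (simp add: s_def)
    \<comment> \<open>The polynomial \<open>2 t d + t\<^sup>2 s\<close> in \<open>t\<close> is nonnegative, so \<open>d = 0\<close>: put \<open>t = - d / (s + 1)\<close>, where the
      summand 1 covers the case \<open>s = 0\<close>.\<close>
    define r where "r = d / (s + 1)"
    have d: "d = r * (s + 1)" using s by (simp add: r_def)
    have "0 \<le> 2 * (- r) * d + (- r)\<^sup>2 * s"
      using var[of "- r" v] unfolding d_def s_def .
    also have "\<dots> = - (r\<^sup>2 * (s + 2))"
      unfolding d by (simp add: power2_eq_square algebra_simps)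
    finally have "r\<^sup>2 * (s + 2) \<le> 0" by simp
    then have "r = 0" using s by (simp add: mult_le_0_iff)
    then have "d = 0" by (simp add: d)
    then show ?thesis by (simp add: d_def inner_commute)
  qed
  moreover have "z \<in> closure (range C)"
    unfolding closure_sequential using z by (intro exI[of _ "\<lambda>n. C (x n)"]) simp
  ultimately show thesis by (intro that)
qed

lemma riesz_along_complex:
  fixes C :: "'k::complex_hilbert_space \<Rightarrow> 'k" and f :: "'k \<Rightarrow> complex"
  assumes C: "bounded_clinear C"
    and add: "\<And>x y. f (x + y) = f x + f y" and scale: "\<And>c x. f (scaleC c x) = c * f x"
    and le: "\<And>x. cmod (f x) \<le> c * norm (C x)"
  obtains z where "z \<in> closure (range C)" "\<And>x. f x = cinner (C x) z"
proof -
  have "linear (\<lambda>x. Re (f x))"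
    by (rule linearI) (simp_all add: add scale scaleC_of_real[symmetric])
  then obtain z where z: "z \<in> closure (range C)" "\<And>x. Re (f x) = C x \<bullet> z"
    using riesz_along[of C "\<lambda>x. Re (f x)" c] C le abs_Re_le_cmod
    by (metis bounded_clinear_linear bounded_linear.linear order_trans)
  have "f x = cinner (C x) z" for x
  proof (rule complex_eqI)
    show "Re (f x) = Re (cinner (C x) z)" by (simp add: z inner_eq_Re_cinner)
    have "Im (f x) = - Re (f (scaleC \<i> x))" by (simp add: scale)
    also have "\<dots> = Im (cinner (C x) z)"
      using C by (simp add: z inner_eq_Re_cinner bounded_clinear_simps cinner_scaleC_left)
    finally show "Im (f x) = Im (cinner (C x) z)" .
  qed
  with z that show thesis by blast
qed

text \<open>
  All operators defined below by matrix elements (adjoints, expansions in a basis, integrals with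
  respect to a projection valued measure, Pettis integrals) are obtained from this lemma. The bound
  is required on unit balls only, where it can be checked without regard to homogeneity.
\<close>

lemma sesquilinear_form_operator:
  fixes I :: "'k::complex_hilbert_space \<Rightarrow> 'k \<Rightarrow> complex"
  assumes add_left: "\<And>x y k. I (x + y) k = I x k + I y k"
    and scale_left: "\<And>c x k. I (scaleC c x) k = c * I x k"
    and add_right: "\<And>h x y. I h (x + y) = I h x + I h y"
    and scale_right: "\<And>c h x. I h (scaleC c x) = cnj c * I h x"
    and bound: "\<And>h k. norm h \<le> 1 \<Longrightarrow> norm k \<le> 1 \<Longrightarrow> cmod (I h k) \<le> c"
  obtains T where "bounded_clinear T" "\<And>h k. cinner (T h) k = I h k" "\<And>h. norm (T h) \<le> c * norm h"
proof -
  have c: "c \<ge> 0" using order_trans[OF norm_ge_zero bound[of 0 0]] by simp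
  have I0: "I 0 k = 0" "I k 0 = 0" for k
    using scale_left[of 0 0 k] scale_right[of k 0 0] by simp_all
  have le: "cmod (I h k) \<le> c * norm h * norm k" for h k
  proof (cases "h = 0 \<or> k = 0")
    case False
    define h' where "h' = scaleC (1 / norm h) h"
    define k' where "k' = scaleC (1 / norm k) k"
    have hk: "h = scaleC (norm h) h'" "k = scaleC (norm k) k'"
      using False by (simp_all add: h'_def k'_def scaleC_scaleC)
    have "I h k = norm h * norm k * I h' k'"
      by (subst hk(1), subst hk(2)) (simp add: scale_left scale_right)
    moreover have "cmod (I h' k') \<le> c"
      using False by (intro bound) (simp_all add: h'_def k'_def norm_scaleC norm_divide)
    ultimately show ?thesis using False by (simp add: norm_mult mult.commute mult_left_mono)
  qed (auto simp: I0)
  have "\<exists>z. \<forall>k. I h k = cinner z k" for h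
  proof -
    obtain z where "\<And>k. cnj (I h k) = cinner (id k) z"
      using riesz_along_complex[OF bounded_clinear_id, of "\<lambda>k. cnj (I h k)" "c * norm h"] le
      by (auto simp: add_right scale_right)
    then show ?thesis by (metis cinner_commute complex_cnj_cnj id_apply)
  qed
  then obtain T where T: "\<And>h k. cinner (T h) k = I h k" by metis
  have nT: "norm (T h) \<le> c * norm h" for h
    by (rule norm_le_by_cinner) (use le c in \<open>simp_all add: T\<close>)
  have "bounded_clinear T"
  proof (rule bounded_clinearI[OF _ _ nT])
    show "T (x + y) = T x + T y" for x y
      by (rule cinner_ext_left) (simp only: T add_left cinner_add_left)
    show "T (scaleC a x) = scaleC a (T x)" for a x
      by (rule cinner_ext_left) (simp only: T scale_left cinner_scaleC_left)
  qed
  with T nT that show thesis by blast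
qed

lemma cadjoint_props:
  assumes T: "bounded_clinear T"
  shows bounded_clinear_cadjoint: "bounded_clinear (cadjoint T)"
    and cinner_cadjoint: "cinner (T h) k = cinner h (cadjoint T k)"
proof -
  obtain c where c: "\<And>x. norm (T x) \<le> c * norm x" "c \<ge> 0" using bounded_clinear_bound[OF T] by blast
  have "cmod (cinner h (T k)) \<le> c" if "norm h \<le> 1" "norm k \<le> 1" for h k
  proof -
    have "cmod (cinner h (T k)) \<le> norm h * norm (T k)" by (rule norm_cinner_le)
    also have "\<dots> \<le> 1 * (c * 1)"
      using that c by (intro mult_mono order_trans[OF c(1)]) (auto intro: mult_left_mono)
    finally show ?thesis by simp
  qed
  then obtain R where R: "bounded_clinear R" "\<And>h k. cinner (R h) k = cinner h (T k)"
    by (rule sesquilinear_form_operator[of "\<lambda>h k. cinner h (T k)" c, rotated 4])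
      (simp_all add: cinner_add_left cinner_add_right cinner_scaleC_left cinner_scaleC_right
        bounded_clinear_simps[OF T])
  have "\<exists>!S. bounded_clinear S \<and> (\<forall>h k. cinner (T h) k = cinner h (S k))"
  proof (rule ex1I[of _ R])
    show "bounded_clinear R \<and> (\<forall>h k. cinner (T h) k = cinner h (R k))"
    proof (intro conjI allI R(1))
      show "cinner (T h) k = cinner h (R k)" for h k
        using cinner_commute[of "T h" k] cinner_commute[of h "R k"] R(2)[of k h] by simp
    qed
    then show "S = R" if "bounded_clinear S \<and> (\<forall>h k. cinner (T h) k = cinner h (S k))" for S
      using that by (intro ext cinner_ext_right) simp
  qed
  from theI'[OF this] show "bounded_clinear (cadjoint T)" "cinner (T h) k = cinner h (cadjoint T k)"
    unfolding cadjoint_def by blast+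
qed

lemma cinner_cadjoint_right:
  "bounded_clinear T \<Longrightarrow> cinner h (T k) = cinner (cadjoint T h) k"
  using cinner_cadjoint[of T k h] cinner_commute[of h "T k"] cinner_commute[of "cadjoint T h" k]
  by simp

lemma cadjoint_unique:
  assumes "bounded_clinear T" "\<And>h k. cinner (T h) k = cinner h (S k)"
  shows "cadjoint T = S"
  by (rule ext, rule cinner_ext_right) (simp only: assms(2)[symmetric] cinner_cadjoint[OF assms(1)])

lemma cadjoint_cadjoint: "bounded_clinear T \<Longrightarrow> cadjoint (cadjoint T) = T"
  by (rule cadjoint_unique[OF bounded_clinear_cadjoint]) (auto simp: cinner_cadjoint_right[of T])

lemma cadjoint_compose:
  assumes T: "bounded_clinear T" and U: "bounded_clinear U"
  shows "cadjoint (T \<circ> U) = cadjoint U \<circ> cadjoint T"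
  by (rule cadjoint_unique[OF bounded_clinear_compose[OF T U]])
    (simp only: comp_apply cinner_cadjoint[OF T] cinner_cadjoint[OF U])

lemma norm_cadjoint_le:
  assumes "bounded_clinear T" "\<And>x. norm (T x) \<le> c * norm x" "c \<ge> 0"
  shows "norm (cadjoint T x) \<le> c * norm x"
proof (rule norm_le_by_cinner)
  fix k
  have "cmod (cinner (cadjoint T x) k) = cmod (cinner x (T k))"
    by (simp only: cinner_cadjoint_right[OF assms(1)])
  also have "\<dots> \<le> norm x * norm (T k)" by (rule norm_cinner_le)
  also have "\<dots> \<le> norm x * (c * norm k)" by (intro mult_left_mono assms) auto
  finally show "cmod (cinner (cadjoint T x) k) \<le> c * norm x * norm k" by (simp add: mult_ac)
qed (use assms in auto)

text \<open>
  Since \<open>T x\<close> is determined by \<open>C x\<close>, each functional \<open>\<langle>T \<cdot>, k\<rangle>\<close> is represented along \<open>C\<close> by a unique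
  vector in the closure of the range of \<open>C\<close>. This vector depends linearly on \<open>k\<close>, and the adjoint of
  that dependence is the factor. Applied to an operator and its absolute value, in either order, the
  lemma replaces the polar decomposition.
\<close>

lemma douglas_factorization:
  fixes T C :: "'k::complex_hilbert_space \<Rightarrow> 'k"
  assumes T: "bounded_clinear T" and C: "bounded_clinear C"
    and le: "\<And>x. norm (T x) \<le> norm (C x)"
  obtains W where "bounded_clinear W" "\<And>x. norm (W x) \<le> norm x" "T = W \<circ> C"
proof -
  have le': "cmod (cinner (T x) k) \<le> norm k * norm (C x)" for x k
    using norm_cinner_le[of "T x" k] mult_right_mono[OF le[of x] norm_ge_zero[of k]]
    by (simp add: mult.commute)
  have "\<exists>z. z \<in> closure (range C) \<and> (\<forall>x. cinner (T x) k = cinner (C x) z)" for k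
  proof -
    obtain z where "z \<in> closure (range C)" "\<And>x. cinner (T x) k = cinner (C x) z"
    proof (rule riesz_along_complex[OF C, of "\<lambda>x. cinner (T x) k" "norm k"])
      show "cmod (cinner (T x) k) \<le> norm k * norm (C x)" for x by (rule le')
    qed (simp_all add: bounded_clinear_simps[OF T] cinner_add_left cinner_scaleC_left)
    then show ?thesis by blast
  qed
  then obtain V where "\<forall>k. V k \<in> closure (range C) \<and> (\<forall>x. cinner (T x) k = cinner (C x) (V k))"
    by (rule choice[OF allI, THEN exE])
  then have Vc: "\<And>k. V k \<in> closure (range C)" and V: "\<And>x k. cinner (T x) k = cinner (C x) (V k)"
    by simp_all
  have perp: "cinner y z = 0" if "\<And>x. cinner (C x) z = 0" "y \<in> closure (range C)" for y z
  proof -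
    obtain u where u: "\<And>n. u n \<in> range C" "u \<longlonglongrightarrow> y" using \<open>y \<in> _\<close> unfolding closure_sequential by blast
    have "(\<lambda>n. cinner (u n) z) \<longlonglongrightarrow> cinner y z" by (intro tendsto_cinner u tendsto_const)
    moreover have "cinner (u n) z = 0" for n using u(1)[of n] that(1) by auto
    ultimately show ?thesis by (simp add: LIMSEQ_const_iff)
  qed
  have clos: "scaleC a y + y' \<in> closure (range C)"
    if y: "y \<in> closure (range C)" and y': "y' \<in> closure (range C)" for a y y'
  proof -
    obtain u where u: "\<And>n. u n \<in> range C" "u \<longlonglongrightarrow> y" using y unfolding closure_sequential by blast
    obtain u' where u': "\<And>n. u' n \<in> range C" "u' \<longlonglongrightarrow> y'" using y' unfolding closure_sequential by blast
    have "(\<lambda>n. scaleC a (u n) + u' n) \<longlonglongrightarrow> scaleC a y + y'"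
      by (intro tendsto_add bounded_linear.tendsto[OF bounded_linear_scaleC] u u')
    moreover have "scaleC a (u n) + u' n \<in> range C" for n
      using u(1)[of n] u'(1)[of n]
      by (auto simp: bounded_clinear_scaleC[OF C, symmetric] bounded_clinear_add[OF C, symmetric])
    ultimately show ?thesis
      unfolding closure_sequential by (intro exI[of _ "\<lambda>n. scaleC a (u n) + u' n"]) simp
  qed
  have zero: "0 \<in> closure (range C)"
    by (rule closure_subset[THEN subsetD], rule image_eqI[of _ _ 0])
      (simp_all add: bounded_clinear_zero[OF C])
  have uniq: "y = z" if "\<And>x. cinner (C x) y = cinner (C x) z" "y \<in> closure (range C)" "z \<in> closure (range C)" for y z
  proof -
    have "cinner (y - z) (y - z) = 0"
      using clos[OF that(3) that(2), of "- 1"]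
      by - (rule perp, simp_all add: cinner_diff_right that(1) scaleC_minus_one)
    then show ?thesis by (simp add: cinner_self)
  qed
  have "norm (V k) \<le> norm k" for k
  proof -
    obtain u where u: "\<And>n. u n \<in> range C" "u \<longlonglongrightarrow> V k" using Vc unfolding closure_sequential by blast
    have "(\<lambda>n. cmod (cinner (u n) (V k))) \<longlonglongrightarrow> cmod (cinner (V k) (V k))"
      by (intro tendsto_norm tendsto_cinner u tendsto_const)
    moreover have "(\<lambda>n. norm k * norm (u n)) \<longlonglongrightarrow> norm k * norm (V k)"
      by (intro tendsto_intros u)
    moreover have "cmod (cinner (u n) (V k)) \<le> norm k * norm (u n)" for n
      using u(1)[of n] le' by (auto simp: V[symmetric])
    ultimately have "cmod (cinner (V k) (V k)) \<le> norm k * norm (V k)"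
      by (intro LIMSEQ_le) auto
    then show ?thesis by (cases "V k = 0") (auto simp: cinner_self norm_mult power2_eq_square)
  qed
  moreover have "V (x + y) = V x + V y" for x y
    using clos[OF Vc Vc, of 1 x y]
    by (intro uniq Vc) (simp_all add: cinner_add_right V[symmetric])
  moreover have "V (scaleC c x) = scaleC c (V x)" for c x
    using clos[OF Vc zero, of c x]
    by (intro uniq Vc) (simp_all add: cinner_scaleC_right V[symmetric])
  ultimately have nV: "\<And>k. norm (V k) \<le> 1 * norm k"
    and Vadd: "\<And>x y. V (x + y) = V x + V y" and Vscale: "\<And>c x. V (scaleC c x) = scaleC c (V x)"
    by simp_all
  have Vb: "bounded_clinear V" by (rule bounded_clinearI[OF Vadd Vscale nV])
  show thesis
  proof (rule that)
    show "bounded_clinear (cadjoint V)" using Vb by (rule bounded_clinear_cadjoint)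
    show "norm (cadjoint V x) \<le> norm x" for x using norm_cadjoint_le[OF Vb nV] by simp
    show "T = cadjoint V \<circ> C"
      by (rule ext, rule cinner_ext_left) (simp add: V cinner_cadjoint_right[OF Vb, symmetric])
  qed
qed

section \<open>Square roots of positive operators\<close>

text \<open>The coefficients of the binomial series \<open>sqrt (1 - t) = \<Sum>\<^sub>n a\<^sub>n t\<^sup>n\<close>.\<close>

definition sqrt_coeff :: "nat \<Rightarrow> real" where
  "sqrt_coeff n = (1/2 gchoose n) * (-1) ^ n"

lemma sqrt_coeff_0 [simp]: "sqrt_coeff 0 = 1"
  by (simp add: sqrt_coeff_def)

lemma sqrt_coeff_nonpos: "n > 0 \<Longrightarrow> sqrt_coeff n \<le> 0"
proof -
  assume "n > 0"
  then obtain m where n: "n = Suc m" by (cases n) auto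
  have "sqrt_coeff n = pochhammer (- (1/2)) n / fact n"
    by (simp add: sqrt_coeff_def gbinomial_pochhammer mult.assoc[symmetric] power_mult_distrib[symmetric])
  also have "\<dots> = - (1/2) * pochhammer (1/2) m / fact n"
    by (simp add: n pochhammer_rec)
  also have "\<dots> \<le> 0" by (simp add: pochhammer_nonneg)
  finally show ?thesis .
qed

lemma sum_sqrt_coeff_nonneg: "0 \<le> (\<Sum>k\<le>m. sqrt_coeff k)"
proof -
  have "(\<Sum>k\<le>m. sqrt_coeff k) = pochhammer (1/2) m / fact m"
    by (simp add: sqrt_coeff_def gbinomial_sum_lower_neg)
      (simp add: gbinomial_pochhammer mult.assoc[symmetric] power_mult_distrib[symmetric])
  then show ?thesis by (simp add: pochhammer_nonneg)
qed

lemma sqrt_coeff_convolution: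
  "(\<Sum>i\<le>n. sqrt_coeff i * sqrt_coeff (n - i)) = (if n = 0 then 1 else if n = 1 then - 1 else 0)"
proof -
  have "(\<Sum>i\<le>n. sqrt_coeff i * sqrt_coeff (n - i))
      = (\<Sum>i\<le>n. (1/2 gchoose i) * (1/2 gchoose (n - i)) * (-1) ^ n)"
    by (intro sum.cong) (auto simp: sqrt_coeff_def power_add[symmetric])
  also have "\<dots> = (1 gchoose n) * (-1) ^ n"
    using gbinomial_Vandermonde[of "1/2" "1/2::real" n]
    by (simp add: sum_distrib_right[symmetric] atLeast0AtMost)
  also have "\<dots> = (if n = 0 then 1 else if n = 1 then - 1 else 0)"
    using binomial_gbinomial[of 1 n, where 'a = real] by (cases "n \<le> 1") (auto simp: le_Suc_eq binomial_eq_0)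
  finally show ?thesis .
qed

text \<open>
  All coefficients except \<open>a\<^sub>0 = 1\<close> are nonpositive while the partial sums stay nonnegative, so the
  series converges absolutely up to the boundary \<open>t = 1\<close>. The bound by 1 is what makes the square root
  of an operator positive.
\<close>

lemma summable_abs_sqrt_coeff: "(\<lambda>n. \<bar>sqrt_coeff n\<bar>) summable_on UNIV"
  and infsum_abs_sqrt_coeff_le: "(\<Sum>\<^sub>\<infinity>n\<in>{0<..}. \<bar>sqrt_coeff n\<bar>) \<le> 1"
proof -
  have le: "(\<Sum>n\<in>F. \<bar>sqrt_coeff n\<bar>) \<le> 1" if F: "finite F" "F \<subseteq> {0<..}" for F
  proof -
    obtain m where m: "F \<subseteq> {..m}" using F finite_nat_iff_bounded_le by blast
    have "(\<Sum>n\<in>F. \<bar>sqrt_coeff n\<bar>) \<le> (\<Sum>n\<in>{0<..m}. \<bar>sqrt_coeff n\<bar>)"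
      using m F by (intro sum_mono2) auto
    also have "\<dots> = - (\<Sum>n\<in>{0<..m}. sqrt_coeff n)"
      unfolding sum_negf[symmetric] by (intro sum.cong) (auto simp: sqrt_coeff_nonpos)
    also have "\<dots> = 1 - (\<Sum>n\<le>m. sqrt_coeff n)"
      by (simp add: sum.atMost_shift[of _ m] atMost_atLeast0 sum.head[of 0 m])
    also have "\<dots> \<le> 1" using sum_sqrt_coeff_nonneg[of m] by simp
    finally show ?thesis .
  qed
  have s: "(\<lambda>n. \<bar>sqrt_coeff n\<bar>) summable_on {0<..}"
    by (rule nonneg_bdd_above_summable_on) (auto intro!: bdd_aboveI2[where M = 1] le)
  then have "(\<lambda>n. \<bar>sqrt_coeff n\<bar>) summable_on insert 0 {0<..}"
    by (simp add: summable_on_insert_iff)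
  moreover have "insert 0 {0<..} = (UNIV :: nat set)" by auto
  ultimately show "(\<lambda>n. \<bar>sqrt_coeff n\<bar>) summable_on UNIV" by simp
  show "(\<Sum>\<^sub>\<infinity>n\<in>{0<..}. \<bar>sqrt_coeff n\<bar>) \<le> 1"
    by (rule infsum_le_finite_sums[OF s]) (use le in auto)
qed

lemma positive_op_bounded: "positive_op P \<Longrightarrow> bounded_clinear P"
  by (simp add: positive_op_def)

lemma positive_op_self_adjoint:
  assumes P: "positive_op P"
  shows "cinner (P h) k = cinner h (P k)"
proof -
  have b: "bounded_clinear P" using P by (simp add: positive_op_def)
  have im: "Im (cinner (P h) h) = 0" for h using P by (simp add: positive_op_def)
  have 1: "Im (cinner (P h) k) + Im (cinner (P k) h) = 0" for h k
    using im[of "h + k"] im[of h] im[of k]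
    by (simp add: bounded_clinear_simps[OF b] cinner_add_left cinner_add_right)
  have 2: "Re (cinner (P h) k) = Re (cinner (P k) h)" for h k
    using 1[of "scaleC \<i> h" k]
    by (simp add: bounded_clinear_simps[OF b] cinner_scaleC_left cinner_scaleC_right)
  have "cinner (P h) k = cnj (cinner (P k) h)"
    using 1[of h k] 2[of h k] by (simp add: complex_eq_iff)
  then show ?thesis by (metis cinner_commute)
qed

lemma positive_op_cadjoint: "positive_op P \<Longrightarrow> cadjoint P = P"
  by (rule cadjoint_unique) (auto simp: positive_op_self_adjoint positive_op_bounded)

lemma positive_op_cauchy_schwarz:
  assumes P: "positive_op P"
  shows "(cmod (cinner (P h) k))\<^sup>2 \<le> Re (cinner (P h) h) * Re (cinner (P k) k)"
proof -
  have b: "bounded_clinear P" using P by (simp add: positive_op_def)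
  have pos: "Re (cinner (P h) h) \<ge> 0" for h using P by (simp add: positive_op_def)
  have re: "cinner (P h) h = complex_of_real (Re (cinner (P h) h))" for h
    using P by (simp add: positive_op_def complex_eq_iff)
  define z where "z = cinner (P h) k"
  define a where "a = Re (cinner (P h) h)"
  define d where "d = Re (cinner (P k) k)"
  have quad: "0 \<le> a * t\<^sup>2 * (cmod z)\<^sup>2 - 2 * t * (cmod z)\<^sup>2 + d" for t :: real
  proof -
    define w where "w = - (complex_of_real t * cnj z)"
    have kh: "cinner (P k) h = cnj z"
      using cinner_commute[of "P k" h] positive_op_self_adjoint[OF P, of h k] by (simp add: z_def)
    have "cinner (P (scaleC w h + k)) (scaleC w h + k)
       = w * cnj w * cinner (P h) h + w * z + cnj (w * z) + cinner (P k) k"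
      by (simp add: bounded_clinear_add[OF b] bounded_clinear_scaleC[OF b] cinner_add_left cinner_add_right
          cinner_scaleC_left cinner_scaleC_right kh z_def[symmetric] distrib_left mult.assoc)
    also have "w * cnj w = complex_of_real ((cmod w)\<^sup>2)" by (simp only: complex_norm_square)
    finally have "Re (cinner (P (scaleC w h + k)) (scaleC w h + k)) = (cmod w)\<^sup>2 * a + 2 * Re (w * z) + d"
      by (simp add: a_def d_def)
    moreover have "(cmod w)\<^sup>2 = t\<^sup>2 * (cmod z)\<^sup>2"
      by (simp add: w_def norm_mult power_mult_distrib)
    moreover have "w * z = - complex_of_real (t * (cmod z)\<^sup>2)"
      by (simp add: w_def complex_norm_square mult.commute del: of_real_power)
    then have "Re (w * z) = - (t * (cmod z)\<^sup>2)" by (metis Re_complex_of_real uminus_complex.sel(1))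
    ultimately have "Re (cinner (P (scaleC w h + k)) (scaleC w h + k))
        = t\<^sup>2 * (cmod z)\<^sup>2 * a + 2 * (- (t * (cmod z)\<^sup>2)) + d" by (simp only:)
    with pos[of "scaleC w h + k"] show ?thesis by (simp add: algebra_simps)
  qed
  have a0: "a \<ge> 0" by (simp add: a_def pos)
  have "(cmod z)\<^sup>2 \<le> a * d"
  proof (cases "a = 0 \<or> z = 0")
    case True
    show ?thesis
    proof (cases "z = 0")
      case False
      then have "a = 0" using True by simp
      then show ?thesis using quad[of "(d + 1) / (2 * (cmod z)\<^sup>2)"] False by simp
    qed (use a0 pos[of k] in \<open>simp add: d_def\<close>)
  next
    case False
    then have "0 \<le> a * (1 / a)\<^sup>2 * (cmod z)\<^sup>2 - 2 * (1 / a) * (cmod z)\<^sup>2 + d" using quad[of "1 / a"] by simp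
    also have "\<dots> = d - (cmod z)\<^sup>2 / a" using False by (simp add: power2_eq_square)
    finally show ?thesis using a0 False by (simp add: field_simps)
  qed
  then show ?thesis by (simp add: z_def a_def d_def)
qed

lemma positive_op_norm_le:
  assumes P: "positive_op P" and le: "\<And>h. Re (cinner (P h) h) \<le> (norm h)\<^sup>2"
  shows "norm (P h) \<le> norm h"
proof (rule norm_le_by_cinner)
  fix k
  have "(cmod (cinner (P h) k))\<^sup>2 \<le> Re (cinner (P h) h) * Re (cinner (P k) k)"
    by (rule positive_op_cauchy_schwarz[OF P])
  also have "\<dots> \<le> (norm h)\<^sup>2 * (norm k)\<^sup>2"
    using P by (intro mult_mono[OF le le]) (auto simp: positive_op_def)
  also have "\<dots> = (norm h * norm k)\<^sup>2" by (rule power_mult_distrib[symmetric])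
  finally show "cmod (cinner (P h) k) \<le> norm h * norm k"
    by (rule power2_le_imp_le) simp
qed simp

lemma bounded_clinear_funpow: "bounded_clinear A \<Longrightarrow> bounded_clinear (A ^^ n)"
  by (induction n) (simp_all add: bounded_clinear_id[unfolded id_def] bounded_clinear_compose id_def)

text \<open>The square root of \<open>1 - A\<close> for a contraction \<open>A\<close>, as a strongly convergent series.\<close>

definition sqrt_one_minus :: "('k::complex_hilbert_space \<Rightarrow> 'k) \<Rightarrow> 'k \<Rightarrow> 'k" where
  "sqrt_one_minus A x = (\<Sum>\<^sub>\<infinity>n. sqrt_coeff n *\<^sub>R (A ^^ n) x)"

lemma sqrt_one_minus:
  fixes A :: "'k::complex_hilbert_space \<Rightarrow> 'k"
  assumes A: "bounded_clinear A" and nA: "\<And>x. norm (A x) \<le> norm x"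
  shows has_sum_sqrt_one_minus:
      "((\<lambda>n. sqrt_coeff n *\<^sub>R (A ^^ n) x) has_sum sqrt_one_minus A x) UNIV" (is ?sum)
    and bounded_clinear_sqrt_one_minus: "bounded_clinear (sqrt_one_minus A)" (is ?bdd)
    and sqrt_one_minus_near_id: "norm (x - sqrt_one_minus A x) \<le> norm x" (is ?norm)
    and sqrt_one_minus_square: "sqrt_one_minus A (sqrt_one_minus A x) = x - A x" (is ?square)
proof -
  define R where "R = sqrt_one_minus A"
  have R_eq: "R x = (\<Sum>\<^sub>\<infinity>n. sqrt_coeff n *\<^sub>R (A ^^ n) x)" for x
    by (simp add: R_def sqrt_one_minus_def)
  have pow: "bounded_clinear (A ^^ n)" for n by (rule bounded_clinear_funpow[OF A])
  have npow: "norm ((A ^^ n) x) \<le> norm x" for n x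
    by (induction n) (auto intro: order_trans[OF nA])
  have abs: "(\<lambda>n. norm (sqrt_coeff n *\<^sub>R (A ^^ n) x)) summable_on UNIV" for x
    by (rule Infinite_Sum.abs_summable_on_comparison_test'[of "\<lambda>n. \<bar>sqrt_coeff n\<bar> * norm x"])
      (auto intro!: summable_on_cmult_left summable_abs_sqrt_coeff mult_left_mono npow)
  have sum: "((\<lambda>n. sqrt_coeff n *\<^sub>R (A ^^ n) x) has_sum R x) UNIV" for x
    unfolding R_eq by (rule has_sum_infsum, rule abs_summable_summable, rule abs)
  show ?sum using sum by (simp only: R_def)
  have add: "R (x + y) = R x + R y" for x y
    using has_sum_add[OF sum sum, of x y] sum[of "x + y"]
    by (simp add: bounded_clinear_simps[OF pow] scaleR_add_right has_sum_unique)
  have scale: "R (scaleC c x) = scaleC c (R x)" for c x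
  proof -
    have "bounded_linear (scaleC c :: 'k \<Rightarrow> 'k)"
      by (rule bounded_linear_intro[of _ "cmod c"])
        (simp_all add: scaleC_add_right norm_scaleC scaleC_of_real[symmetric] scaleC_scaleC mult.commute)
    from has_sum_bounded_linear[OF this sum[of x]] show ?thesis
      using sum[of "scaleC c x"]
      by (simp add: bounded_clinear_simps[OF pow] scaleC_of_real[symmetric] scaleC_scaleC mult.commute
          has_sum_unique)
  qed
  have near: "norm (x - R x) \<le> norm x" for x
  proof -
    have "((\<lambda>n. sqrt_coeff n *\<^sub>R (A ^^ n) x) has_sum (R x - x)) (UNIV - {0})"
    proof (rule has_sum_Diff[OF sum])
      show "((\<lambda>n. sqrt_coeff n *\<^sub>R (A ^^ n) x) has_sum x) {0}" by (simp add: has_sum_finite_iff)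
    qed simp
    moreover have "UNIV - {0} = {0::nat<..}" by auto
    ultimately have diff: "((\<lambda>n. sqrt_coeff n *\<^sub>R (A ^^ n) x) has_sum (R x - x)) {0<..}" by simp
    have "norm (R x - x) \<le> (\<Sum>\<^sub>\<infinity>n\<in>{0<..}. \<bar>sqrt_coeff n\<bar> * norm x)"
    proof (rule norm_infsum_le[OF diff has_sum_infsum])
      show "(\<lambda>n. \<bar>sqrt_coeff n\<bar> * norm x) summable_on {0<..}"
        by (rule summable_on_cmult_left, rule summable_on_subset_banach[OF summable_abs_sqrt_coeff]) simp
      show "norm (sqrt_coeff n *\<^sub>R (A ^^ n) x) \<le> \<bar>sqrt_coeff n\<bar> * norm x" for n
        using mult_left_mono[OF npow abs_ge_zero] by simp
    qed
    also have "\<dots> = (\<Sum>\<^sub>\<infinity>n\<in>{0<..}. \<bar>sqrt_coeff n\<bar>) * norm x"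
      by (rule infsum_cmult_left')
    also have "\<dots> \<le> 1 * norm x"
      by (rule mult_right_mono[OF infsum_abs_sqrt_coeff_le norm_ge_zero])
    finally show ?thesis by (simp add: norm_minus_commute)
  qed
  then show ?norm by (simp only: R_def)
  have "bounded_clinear R"
  proof (rule bounded_clinearI[OF add scale])
    show "norm (R x) \<le> 2 * norm x" for x
      using near[of x] norm_triangle_ineq4[of x "x - R x"] by simp
  qed
  then show ?bdd by (simp only: R_def)
  have "R (R x) = x - A x"
  proof -
    \<comment> \<open>The Cauchy product: the double series of \<open>R (R x)\<close> is summed along the diagonals \<open>n + m = k\<close>.\<close>
    let ?g = "\<lambda>(n, m). (sqrt_coeff n * sqrt_coeff m) *\<^sub>R (A ^^ (n + m)) x"
    have "(\<lambda>(n, m). \<bar>sqrt_coeff n\<bar> * \<bar>sqrt_coeff m\<bar>) summable_on UNIV \<times> UNIV"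
      by (rule summable_on_SigmaI[where g = "\<lambda>n. \<bar>sqrt_coeff n\<bar> * (\<Sum>\<^sub>\<infinity>m. \<bar>sqrt_coeff m\<bar>)"])
        (auto intro!: has_sum_cmult_right has_sum_infsum summable_on_cmult_left summable_abs_sqrt_coeff)
    then have "(\<lambda>p. (case p of (n, m) \<Rightarrow> \<bar>sqrt_coeff n\<bar> * \<bar>sqrt_coeff m\<bar>) * norm x) summable_on UNIV \<times> UNIV"
      by (rule summable_on_cmult_left)
    then have "(\<lambda>p. norm (?g p)) summable_on UNIV \<times> UNIV"
      by (rule Infinite_Sum.abs_summable_on_comparison_test') (auto simp: abs_mult intro!: mult_left_mono npow)
    then obtain s where s: "(?g has_sum s) (UNIV \<times> UNIV)"
      using abs_summable_summable summable_on_def by blast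
    have "((\<lambda>n. sqrt_coeff n *\<^sub>R (A ^^ n) (R x)) has_sum s) UNIV"
    proof (rule has_sum_Sigma[OF isUCont_plus s])
      fix n
      have "bounded_linear (\<lambda>y. sqrt_coeff n *\<^sub>R (A ^^ n) y)"
        by (intro bounded_linear_scaleR_right[THEN bounded_linear_compose] bounded_clinear_linear pow)
      from has_sum_bounded_linear[OF this sum]
      show "((\<lambda>m. ?g (n, m)) has_sum sqrt_coeff n *\<^sub>R (A ^^ n) (R x)) UNIV"
        by (simp add: bounded_clinear_scaleR[OF pow] funpow_add)
    qed
    from has_sum_unique[OF sum this] have "R (R x) = s" .
    have "((\<lambda>(k, i). ?g (i, k - i)) has_sum s) (SIGMA k:UNIV. {..k})"
      by (rule has_sum_reindex_bij_witness[THEN iffD1, OF _ _ _ _ _ refl s,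
            of "\<lambda>(k, i). (i, k - i)" "\<lambda>(n, m). (n + m, n)"]) auto
    then have S: "((\<lambda>k. \<Sum>i\<le>k. ?g (i, k - i)) has_sum s) UNIV"
      by (rule has_sum_Sigma[OF isUCont_plus]) (auto simp: has_sum_finite_iff)
    have conv: "(\<Sum>i\<le>k. ?g (i, k - i)) = (if k = 0 then x else if k = 1 then - A x else 0)" for k
    proof -
      have "(\<Sum>i\<le>k. ?g (i, k - i)) = (\<Sum>i\<le>k. sqrt_coeff i * sqrt_coeff (k - i)) *\<^sub>R (A ^^ k) x"
        by (simp add: scaleR_sum_left)
      then show ?thesis by (simp add: sqrt_coeff_convolution)
    qed
    from S have "((\<lambda>k::nat. if k = 0 then x else if k = 1 then - A x else 0) has_sum s) UNIV"
      unfolding conv .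
    moreover have "((\<lambda>k::nat. if k = 0 then x else if k = 1 then - A x else 0) has_sum (x - A x)) UNIV"
      by (rule has_sum_finite_neutralI[of "{0, 1}"]) auto
    ultimately have "s = x - A x" by (rule has_sum_unique)
    with \<open>R (R x) = s\<close> show ?thesis by simp
  qed
  then show ?square by (simp only: R_def)
qed

lemma positive_sqrt_unique_commuting:
  assumes R: "positive_op R" and S: "positive_op S"
    and RR: "R \<circ> R = P" and SS: "S \<circ> S = P" and comm: "R \<circ> S = S \<circ> R"
  shows "R = S"
proof -
  have bR: "bounded_clinear R" and bS: "bounded_clinear S" using R S positive_op_bounded by auto
  have c: "R (S x) = S (R x)" "R (R x) = S (S x)" for x
    using fun_cong[OF comm, of x] fun_cong[OF RR, of x] fun_cong[OF SS, of x] by auto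
  define D where "D = (\<lambda>x. R x - S x)"
  have Dsa: "cinner (D x) y = cinner x (D y)" for x y
    by (simp add: D_def cinner_diff_left cinner_diff_right positive_op_self_adjoint[OF R] positive_op_self_adjoint[OF S])
  have RSD: "R (D x) + S (D x) = 0" for x
    by (simp add: D_def bounded_clinear_simps[OF bR] bounded_clinear_simps[OF bS] c)
  \<comment> \<open>\<open>D R D + D S D = (R\<^sup>2 - S\<^sup>2) D = 0\<close> with positive summands, so both vanish. Then \<open>R D = S D = 0\<close> by
    Cauchy-Schwarz, hence \<open>D\<^sup>2 = 0\<close>, and \<open>D = 0\<close> because \<open>D\<close> is self-adjoint.\<close>
  have zero: "Re (cinner (R (D x)) (D x)) = 0 \<and> Re (cinner (S (D x)) (D x)) = 0" for x
  proof -
    have "Re (cinner (R (D x)) (D x)) + Re (cinner (S (D x)) (D x)) = 0"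
      using RSD[of x] by (metis cinner_add_left cinner_zero_left plus_complex.sel(1) zero_complex.sel(1))
    moreover have "Re (cinner (R (D x)) (D x)) \<ge> 0" "Re (cinner (S (D x)) (D x)) \<ge> 0"
      using R S by (auto simp: positive_op_def)
    ultimately show ?thesis by linarith
  qed
  have RD: "R (D x) = 0" and SD: "S (D x) = 0" for x
  proof -
    have "cinner (R (D x)) k = 0" for k
      using positive_op_cauchy_schwarz[OF R, of "D x" k] zero[of x] by simp
    then show "R (D x) = 0" by (intro cinner_ext_left) simp
    then show "S (D x) = 0" using RSD[of x] by simp
  qed
  have "D (D x) = 0" for x using RD[of x] SD[of x] by (simp add: D_def)
  then have "cinner (D x) (D x) = 0" for x by (simp add: Dsa)
  then have "D x = 0" for x by (simp add: cinner_self)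
  then show ?thesis by (auto simp: D_def)
qed

text \<open>
  After rescaling, \<open>P = c (1 - A)\<close> with a positive contraction \<open>A\<close>, and the binomial series gives a
  root. It commutes with everything that commutes with \<open>P\<close>, in particular with any other positive
  root, and commuting positive roots coincide.
\<close>

theorem positive_sqrt_ex1:
  fixes P :: "'k::complex_hilbert_space \<Rightarrow> 'k"
  assumes P: "positive_op P"
  shows "\<exists>!R. positive_op R \<and> R \<circ> R = P"
proof -
  have bP: "bounded_clinear P" using P by (rule positive_op_bounded)
  obtain c0 where c0: "c0 \<ge> 0" "\<And>x. norm (P x) \<le> c0 * norm x" using bounded_clinear_bound[OF bP] by blast
  define c where "c = c0 + 1"
  have c: "c > 0" using c0(1) by (simp add: c_def)
  have nP: "norm (P x) \<le> c * norm x" for x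
    using c0(2)[of x] by (simp add: c_def distrib_right add_increasing2)
  define A where "A = (\<lambda>x. x - (1 / c) *\<^sub>R P x)"
  have bA: "bounded_clinear A"
  proof -
    have "A = (\<lambda>x. scaleC (complex_of_real (- 1 / c)) (P x) + id x)"
      unfolding scaleC_of_real by (auto simp: A_def)
    then show ?thesis using bounded_clinear_lincomb[OF bP bounded_clinear_id] by simp
  qed
  have A_form: "cinner (A h) h = complex_of_real ((norm h)\<^sup>2 - Re (cinner (P h) h) / c)" for h
    using P by (simp add: A_def scaleC_of_real[symmetric] cinner_diff_left cinner_scaleC_left cinner_self
        positive_op_def complex_eq_iff)
  have P_le: "Re (cinner (P h) h) \<le> c * (norm h)\<^sup>2" for h
  proof -
    have "Re (cinner (P h) h) \<le> norm (P h) * norm h"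
      by (meson complex_Re_le_cmod norm_cinner_le order_trans)
    also have "\<dots> \<le> (c * norm h) * norm h" by (rule mult_right_mono[OF nP norm_ge_zero])
    finally show ?thesis by (simp add: power2_eq_square)
  qed
  have A: "positive_op A"
    unfolding positive_op_def A_form using bA P_le c by (auto simp: field_simps)
  have nA: "norm (A x) \<le> norm x" for x
  proof (rule positive_op_norm_le[OF A])
    show "Re (cinner (A h) h) \<le> (norm h)\<^sup>2" for h
      using P c by (simp add: A_form positive_op_def)
  qed
  define R0 where "R0 = sqrt_one_minus A"
  note R0 = sqrt_one_minus[OF bA nA, folded R0_def]
  have pow_sa: "cinner ((A ^^ n) x) y = cinner x ((A ^^ n) y)" for n x y
    by (induction n arbitrary: x y) (simp_all add: funpow_swap1 positive_op_self_adjoint[OF A])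
  have R0_sa: "cinner (R0 x) y = cinner x (R0 y)" for x y
  proof -
    have "((\<lambda>n. cinner (sqrt_coeff n *\<^sub>R (A ^^ n) x) y) has_sum cinner (R0 x) y) UNIV"
      using has_sum_bounded_linear[OF bounded_bilinear.bounded_linear_left[OF bounded_bilinear_cinner] R0(1)] .
    moreover have "((\<lambda>n. cinner x (sqrt_coeff n *\<^sub>R (A ^^ n) y)) has_sum cinner x (R0 y)) UNIV"
      using has_sum_bounded_linear[OF bounded_bilinear.bounded_linear_right[OF bounded_bilinear_cinner] R0(1)] .
    ultimately show ?thesis
      by (simp add: scaleC_of_real[symmetric] cinner_scaleC_left cinner_scaleC_right pow_sa has_sum_unique)
  qed
  have R0_real: "Im (cinner (R0 h) h) = 0" for h
    using R0_sa[of h h] cinner_commute[of h "R0 h"]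
    by (metis Reals_cnj_iff complex_is_Real_iff)
  have R0_pos: "0 \<le> Re (cinner (R0 h) h)" for h
  proof -
    have "Re (cinner (h - R0 h) h) \<le> norm (h - R0 h) * norm h"
      by (meson complex_Re_le_cmod norm_cinner_le order_trans)
    also have "\<dots> \<le> norm h * norm h" by (intro mult_right_mono R0(3)) auto
    finally show ?thesis by (simp add: cinner_diff_left cinner_self power2_eq_square)
  qed
  define R where "R = (\<lambda>x. sqrt c *\<^sub>R R0 x)"
  have bR: "bounded_clinear R"
    using bounded_clinear_lincomb[OF R0(2), of "\<lambda>x. 0" "sqrt c"]
    by (simp add: R_def scaleC_of_real bounded_clinear_def)
  have R: "positive_op R"
    unfolding positive_op_def R_def using bR R0_real R0_pos c
    by (simp add: scaleC_of_real[symmetric] cinner_scaleC_left R_def)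
  have RR: "R \<circ> R = P"
  proof
    fix x
    have "(R \<circ> R) x = c *\<^sub>R R0 (R0 x)"
      using c by (simp add: R_def bounded_clinear_scaleR[OF R0(2)])
    then show "(R \<circ> R) x = P x" using c by (simp add: R0(4) A_def)
  qed
  have comm: "R \<circ> S = S \<circ> R" if S: "positive_op S" "S \<circ> S = P" for S
  proof
    fix x
    have bS: "bounded_linear S" using S by (simp add: positive_op_def bounded_clinear_def)
    have "S (P y) = P (S y)" for y using S(2) by (metis comp_apply)
    then have SA: "S (A y) = A (S y)" for y
      by (simp add: A_def linear_diff[OF bounded_linear.linear[OF bS]] linear_scale[OF bounded_linear.linear[OF bS]])
    have Spow: "S ((A ^^ n) y) = (A ^^ n) (S y)" for n y
      by (induction n) (simp_all add: SA)
    have "((\<lambda>n. S (sqrt_coeff n *\<^sub>R (A ^^ n) x)) has_sum S (R0 x)) UNIV"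
      by (rule has_sum_bounded_linear[OF bS R0(1)])
    then have "S (R0 x) = R0 (S x)"
      using R0(1)[of "S x"] by (simp add: linear_scale[OF bounded_linear.linear[OF bS]] Spow has_sum_unique)
    then show "(R \<circ> S) x = (S \<circ> R) x" by (simp add: R_def linear_scale[OF bounded_linear.linear[OF bS]])
  qed
  show ?thesis
    using R RR positive_sqrt_unique_commuting[OF R _ RR _ comm] by blast
qed

lemma positive_op_cadjoint_compose:
  assumes T: "bounded_clinear T"
  shows "positive_op (cadjoint T \<circ> T)"
  unfolding positive_op_def
  by (simp add: T bounded_clinear_compose bounded_clinear_cadjoint cinner_self
      cinner_cadjoint_right[OF T, symmetric])

lemma abs_op:
  assumes T: "bounded_clinear T"
  shows positive_abs_op: "positive_op (abs_op T)"
    and norm_abs_op: "norm (abs_op T x) = norm (T x)"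
proof -
  note root = theI'[OF positive_sqrt_ex1[OF positive_op_cadjoint_compose[OF T]], folded abs_op_def]
  show pos: "positive_op (abs_op T)" using root by (rule conjunct1)
  have sq: "abs_op T \<circ> abs_op T = cadjoint T \<circ> T" using root by (rule conjunct2)
  have "complex_of_real ((norm (abs_op T x))\<^sup>2) = cinner (abs_op T (abs_op T x)) x"
    by (simp only: cinner_self[symmetric] positive_op_self_adjoint[OF pos])
  also have "\<dots> = cinner x (cadjoint T (T x))"
    using fun_cong[OF sq, of x] by (metis comp_apply positive_op_self_adjoint[OF pos])
  also have "\<dots> = complex_of_real ((norm (T x))\<^sup>2)"
    by (simp only: cinner_self[symmetric] cinner_cadjoint[OF T])
  finally show "norm (abs_op T x) = norm (T x)"
    by (metis norm_ge_zero of_real_eq_iff power2_eq_imp_eq)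
qed

section \<open>Orthonormal bases\<close>

lemmas cinner_sum_left = bounded_bilinear.sum_left[OF bounded_bilinear_cinner]
lemmas cinner_sum_right = bounded_bilinear.sum_right[OF bounded_bilinear_cinner]

lemma orthonormal_subset: "orthonormal E \<Longrightarrow> F \<subseteq> E \<Longrightarrow> orthonormal F"
  unfolding orthonormal_def by (meson subsetD)

lemma cmod_cinner_commute: "cmod (cinner x y) = cmod (cinner y x)"
  by (subst cinner_commute) simp

lemma bessel:
  assumes F: "orthonormal F" "finite F"
  shows "(\<Sum>e\<in>F. (cmod (cinner x e))\<^sup>2) \<le> (norm x)\<^sup>2"
proof -
  define y where "y = (\<Sum>e\<in>F. scaleC (cinner x e) e)"
  define s where "s = (\<Sum>e\<in>F. (cmod (cinner x e))\<^sup>2)"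
  have ye: "cinner y e = cinner x e" if "e \<in> F" for e
  proof -
    have "cinner y e = (\<Sum>f\<in>F. if f = e then cinner x e else 0)"
      unfolding y_def cinner_sum_left
      using F that by (intro sum.cong) (auto simp: cinner_scaleC_left orthonormal_def)
    then show ?thesis using F that by simp
  qed
  have xy: "cinner x y = complex_of_real s"
    by (simp add: y_def s_def cinner_sum_right cinner_scaleC_right complex_norm_square mult.commute
        del: of_real_power)
  have yy: "cinner y y = complex_of_real s"
  proof -
    have "cinner y y = (\<Sum>e\<in>F. cnj (cinner x e) * cinner y e)"
      by (subst (2) y_def) (simp add: cinner_sum_right cinner_scaleC_right)
    also have "\<dots> = (\<Sum>e\<in>F. cnj (cinner x e) * cinner x e)"
      by (rule sum.cong) (simp_all add: ye)
    also have "\<dots> = complex_of_real s"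
      by (simp add: s_def complex_norm_square mult.commute del: of_real_power)
    finally show ?thesis .
  qed
  have "cinner y x = complex_of_real s" using xy by (metis cinner_commute complex_cnj_complex_of_real)
  then have "cinner (x - y) (x - y) = complex_of_real ((norm x)\<^sup>2 - s)"
    by (simp only: cinner_diff_left cinner_diff_right xy yy) (simp add: cinner_self)
  then have "(norm (x - y))\<^sup>2 = (norm x)\<^sup>2 - s"
    by (simp only: cinner_self of_real_eq_iff)
  then show ?thesis unfolding s_def[symmetric] using zero_le_power2[of "norm (x - y)"] by linarith
qed

lemma orthonormal_basis_some_onb: "orthonormal_basis (some_onb :: 'k::complex_hilbert_space set)"
proof -
  have "\<exists>M\<in>{E :: 'k set. orthonormal E}. \<forall>F\<in>{E. orthonormal E}. M \<subseteq> F \<longrightarrow> F = M"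
  proof (rule subset_Zorn')
    fix C :: "'k set set" assume C: "subset.chain {E. orthonormal E} C"
    have "cinner e f = (if e = f then 1 else 0)" if ef: "e \<in> \<Union>C" "f \<in> \<Union>C" for e f
    proof -
      obtain G H where "G \<in> C" "H \<in> C" "e \<in> G" "f \<in> H" using ef by blast
      moreover have "G \<subseteq> H \<or> H \<subseteq> G" using C \<open>G \<in> C\<close> \<open>H \<in> C\<close> by (auto simp: subset_chain_def)
      ultimately obtain K where "K \<in> C" "e \<in> K" "f \<in> K" by blast
      moreover have "orthonormal K" using C \<open>K \<in> C\<close> by (auto simp: subset_chain_def)
      ultimately show ?thesis by (auto simp: orthonormal_def)
    qed
    then show "\<Union>C \<in> {E. orthonormal E}" by (auto simp: orthonormal_def)
  qed
  then have "\<exists>E :: 'k set. orthonormal_basis E" by (auto simp: orthonormal_basis_def)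
  then show ?thesis unfolding some_onb_def by (rule someI_ex)
qed

lemma orthonormal_some_onb: "orthonormal some_onb"
  using orthonormal_basis_some_onb unfolding orthonormal_basis_def by blast

lemma cmod_mult_le: "cmod (a * b) \<le> ((cmod a)\<^sup>2 + (cmod b)\<^sup>2) / 2"
  using sum_squares_bound[of "cmod a" "cmod b"] by (simp add: norm_mult)

text \<open>
  Let \<open>T\<close> be the operator with the form \<open>\<Sum>\<^sub>e \<langle>h, e\<rangle> \<langle>e, k\<rangle>\<close>, which is bounded by Bessel's inequality.
  Then \<open>h - T h\<close> is orthogonal to \<open>E\<close>, so it vanishes: otherwise it could be normalized and added to \<open>E\<close>.
\<close>

lemma parseval:
  fixes E :: "'k::complex_hilbert_space set"
  assumes E: "orthonormal_basis E"
  shows "((\<lambda>e. cinner h e * cinner e k) has_sum cinner h k) E"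
proof -
  have on: "orthonormal E" using E by (simp add: orthonormal_basis_def)
  have fin: "(\<Sum>e\<in>F. cmod (cinner h e * cinner e k)) \<le> ((norm h)\<^sup>2 + (norm k)\<^sup>2) / 2"
    if F: "finite F" "F \<subseteq> E" for F h k
  proof -
    have "(\<Sum>e\<in>F. cmod (cinner h e * cinner e k))
        \<le> (\<Sum>e\<in>F. ((cmod (cinner h e))\<^sup>2 + (cmod (cinner k e))\<^sup>2) / 2)"
      by (intro sum_mono) (metis cmod_mult_le cmod_cinner_commute)
    also have "\<dots> = ((\<Sum>e\<in>F. (cmod (cinner h e))\<^sup>2) + (\<Sum>e\<in>F. (cmod (cinner k e))\<^sup>2)) / 2"
      by (simp add: sum.distrib sum_divide_distrib[symmetric])
    also have "\<dots> \<le> ((norm h)\<^sup>2 + (norm k)\<^sup>2) / 2"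
      using bessel[OF orthonormal_subset[OF on F(2)] F(1)] by (intro divide_right_mono add_mono) auto
    finally show ?thesis .
  qed
  have abs: "(\<lambda>e. cmod (cinner h e * cinner e k)) summable_on E" for h k
    by (rule nonneg_bdd_above_summable_on) (auto intro!: bdd_aboveI2 fin)
  have sm: "(\<lambda>e. cinner h e * cinner e k) summable_on E" for h k
    by (rule abs_summable_summable[OF abs])
  define I where "I = (\<lambda>h k. \<Sum>\<^sub>\<infinity>e\<in>E. cinner h e * cinner e k)"
  have I_le: "cmod (I h k) \<le> 1" if "norm h \<le> 1" "norm k \<le> 1" for h k
  proof -
    have "cmod (I h k) \<le> (\<Sum>\<^sub>\<infinity>e\<in>E. cmod (cinner h e * cinner e k))"
      unfolding I_def by (rule norm_infsum_bound[OF abs])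
    also have "\<dots> \<le> ((norm h)\<^sup>2 + (norm k)\<^sup>2) / 2"
      by (rule infsum_le_finite_sums[OF abs fin])
    also have "\<dots> \<le> 1" using that power_le_one[of "norm h" 2] power_le_one[of "norm k" 2] by simp
    finally show ?thesis .
  qed
  obtain T where T: "bounded_clinear T" "\<And>h k. cinner (T h) k = I h k"
  proof (rule sesquilinear_form_operator[of I 1])
    show "I (x + y) k = I x k + I y k" for x y k
      unfolding I_def infsum_add[OF sm sm, symmetric] by (simp add: cinner_add_left algebra_simps)
    show "I h (x + y) = I h x + I h y" for h x y
      unfolding I_def infsum_add[OF sm sm, symmetric] by (simp add: cinner_add_right algebra_simps)
    show "I (scaleC c x) k = c * I x k" for c x k
      unfolding I_def infsum_cmult_right'[symmetric] by (simp add: cinner_scaleC_left mult.assoc)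
    show "I h (scaleC c x) = cnj c * I h x" for c h x
      unfolding I_def infsum_cmult_right'[symmetric] by (simp add: cinner_scaleC_right mult.left_commute)
  qed (use I_le in auto)
  have Te: "cinner (T h) e = cinner h e" if e: "e \<in> E" for h e
  proof -
    have "((\<lambda>f. cinner h f * cinner f e) has_sum cinner h e) E"
      using on e by (intro has_sum_finite_neutralI[of "{e}"]) (auto simp: orthonormal_def)
    then show ?thesis by (simp add: T I_def infsumI)
  qed
  have "T h = h" for h
  proof (rule ccontr)
    assume "T h \<noteq> h"
    define y where "y = h - T h"
    have y: "y \<noteq> 0" using \<open>T h \<noteq> h\<close> by (simp add: y_def)
    have ye: "cinner y e = 0" if "e \<in> E" for e by (simp add: y_def cinner_diff_left Te that)
    have ey: "cinner e y = 0" if "e \<in> E" for e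
      using ye[OF that] by (metis cinner_commute complex_cnj_zero)
    define u where "u = scaleC (1 / norm y) y"
    have u: "cinner u u = 1"
      unfolding u_def cinner_scaleC_left cinner_scaleC_right
      using y by (simp add: cinner_self power2_eq_square)
    have ue: "cinner u e = 0" "cinner e u = 0" if "e \<in> E" for e
      using ye[OF that] ey[OF that] by (simp_all add: u_def cinner_scaleC_left cinner_scaleC_right)
    have "orthonormal (insert u E)"
      using on u ue unfolding orthonormal_def by auto
    then have "insert u E = E" using E by (auto simp: orthonormal_basis_def)
    then have "cinner u u = 0" using ue[of u] by blast
    then show False using u by simp
  qed
  then have "I h k = cinner h k" using T by metis
  then show ?thesis using has_sum_infsum[OF sm, of h k] by (simp add: I_def)
qed

lemma parseval_norm:
  assumes "orthonormal_basis E"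
  shows "((\<lambda>e. (cmod (cinner h e))\<^sup>2) has_sum (norm h)\<^sup>2) E"
proof -
  have "((\<lambda>e. complex_of_real ((cmod (cinner h e))\<^sup>2)) has_sum complex_of_real ((norm h)\<^sup>2)) E"
    using parseval[OF assms, of h h] unfolding cinner_self complex_norm_square
    by (simp add: cinner_commute[of _ h])
  then show ?thesis by (simp only: has_sum_of_real_iff)
qed

section \<open>Hilbert-Schmidt operators\<close>

text \<open>
  A bound of the squared Hilbert-Schmidt norm. Quantifying over all finite orthonormal sets, not only
  over the subsets of one basis, makes it visibly independent of a basis.
\<close>

definition hs_bound :: "('k::complex_hilbert_space \<Rightarrow> 'k) \<Rightarrow> real \<Rightarrow> bool" where
  "hs_bound T c \<longleftrightarrow> bounded_clinear T \<and>
     (\<forall>F. finite F \<and> orthonormal F \<longrightarrow> (\<Sum>e\<in>F. (norm (T e))\<^sup>2) \<le> c)"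

lemma hs_boundI:
  fixes T :: "'k::complex_hilbert_space \<Rightarrow> 'k"
  assumes "bounded_clinear T"
    "\<And>F. finite F \<Longrightarrow> orthonormal F \<Longrightarrow> (\<Sum>e\<in>F. (norm (T e))\<^sup>2) \<le> c"
  shows "hs_bound T c"
  using assms unfolding hs_bound_def by blast

lemma hs_bound_bounded: "hs_bound T c \<Longrightarrow> bounded_clinear T"
  by (simp add: hs_bound_def)

lemma hs_boundD: "hs_bound T c \<Longrightarrow> finite F \<Longrightarrow> orthonormal F \<Longrightarrow> (\<Sum>e\<in>F. (norm (T e))\<^sup>2) \<le> c"
  by (simp add: hs_bound_def)

lemma hs_bound_nonneg: "hs_bound T c \<Longrightarrow> 0 \<le> c"
  using hs_boundD[of T c "{}"] by (simp add: orthonormal_def)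

lemma has_sum_sum_finite:
  fixes f :: "'i \<Rightarrow> 'j \<Rightarrow> real"
  assumes "finite F" "\<And>e. e \<in> F \<Longrightarrow> (f e has_sum s e) A"
  shows "((\<lambda>x. \<Sum>e\<in>F. f e x) has_sum (\<Sum>e\<in>F. s e)) A"
  using assms by (induction F rule: finite_induct) (auto intro: has_sum_add)

text \<open>
  It suffices to test the adjoint on one orthonormal basis: expand \<open>S e\<close> in \<open>E\<close> by Parseval's
  identity, exchange the sums, and apply Bessel's inequality to the orthonormal set \<open>F\<close>.
\<close>

lemma hs_boundI_cadjoint:
  fixes S :: "'k::complex_hilbert_space \<Rightarrow> 'k"
  assumes E: "orthonormal_basis E" and S: "bounded_clinear S"
    and le: "\<And>G. finite G \<Longrightarrow> G \<subseteq> E \<Longrightarrow> (\<Sum>f\<in>G. (norm (cadjoint S f))\<^sup>2) \<le> c"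
  shows "hs_bound S c"
proof (rule hs_boundI[OF S])
  fix F :: "'k set" assume F: "finite F" "orthonormal F"
  have "((\<lambda>f. \<Sum>e\<in>F. (cmod (cinner (S e) f))\<^sup>2) has_sum (\<Sum>e\<in>F. (norm (S e))\<^sup>2)) E"
    by (rule has_sum_sum_finite[OF F(1) parseval_norm[OF E]])
  then show "(\<Sum>e\<in>F. (norm (S e))\<^sup>2) \<le> c"
  proof (rule has_sum_le_finite_sums)
    fix G assume G: "finite G" "G \<subseteq> E"
    have "(\<Sum>f\<in>G. \<Sum>e\<in>F. (cmod (cinner (S e) f))\<^sup>2) \<le> (\<Sum>f\<in>G. (norm (cadjoint S f))\<^sup>2)"
    proof (rule sum_mono)
      fix f
      have "(\<Sum>e\<in>F. (cmod (cinner (S e) f))\<^sup>2) = (\<Sum>e\<in>F. (cmod (cinner (cadjoint S f) e))\<^sup>2)"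
        by (simp only: cinner_cadjoint[OF S] cmod_cinner_commute[of _ "cadjoint S f"])
      also have "\<dots> \<le> (norm (cadjoint S f))\<^sup>2" by (rule bessel[OF F(2,1)])
      finally show "(\<Sum>e\<in>F. (cmod (cinner (S e) f))\<^sup>2) \<le> (norm (cadjoint S f))\<^sup>2" .
    qed
    also have "\<dots> \<le> c" by (rule le[OF G])
    finally show "(\<Sum>f\<in>G. \<Sum>e\<in>F. (cmod (cinner (S e) f))\<^sup>2) \<le> c" .
  qed
qed

lemma hs_bound_cadjoint:
  fixes T :: "'k::complex_hilbert_space \<Rightarrow> 'k"
  assumes "hs_bound T c"
  shows "hs_bound (cadjoint T) c"
proof (rule hs_boundI_cadjoint[OF orthonormal_basis_some_onb])
  show "bounded_clinear (cadjoint T)"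
    using assms by (intro bounded_clinear_cadjoint hs_bound_bounded)
  fix G :: "'k set" assume "finite G" "G \<subseteq> some_onb"
  then show "(\<Sum>f\<in>G. (norm (cadjoint (cadjoint T) f))\<^sup>2) \<le> c"
    unfolding cadjoint_cadjoint[OF hs_bound_bounded[OF assms]]
    by (intro hs_boundD[OF assms] orthonormal_subset[OF orthonormal_some_onb])
qed

lemma hs_bound_compose_left:
  fixes T :: "'k::complex_hilbert_space \<Rightarrow> 'k"
  assumes T: "hs_bound T c" and W: "bounded_clinear W" "\<And>x. norm (W x) \<le> w * norm x"
  shows "hs_bound (W \<circ> T) (w\<^sup>2 * c)"
proof (rule hs_boundI)
  show "bounded_clinear (W \<circ> T)" by (rule bounded_clinear_compose[OF W(1) hs_bound_bounded[OF T]])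
  fix F :: "'k set" assume F: "finite F" "orthonormal F"
  have "(\<Sum>e\<in>F. (norm ((W \<circ> T) e))\<^sup>2) \<le> (\<Sum>e\<in>F. w\<^sup>2 * (norm (T e))\<^sup>2)"
    using W(2) by (intro sum_mono) (simp add: power_mult_distrib[symmetric] power_mono)
  also have "\<dots> = w\<^sup>2 * (\<Sum>e\<in>F. (norm (T e))\<^sup>2)" by (rule sum_distrib_left[symmetric])
  also have "\<dots> \<le> w\<^sup>2 * c" by (intro mult_left_mono hs_boundD[OF T F]) simp
  finally show "(\<Sum>e\<in>F. (norm ((W \<circ> T) e))\<^sup>2) \<le> w\<^sup>2 * c" .
qed

lemma hs_bound_compose_right:
  assumes T: "hs_bound T c" and W: "bounded_clinear W" "\<And>x. norm (W x) \<le> w * norm x" "w \<ge> 0"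
  shows "hs_bound (T \<circ> W) (w\<^sup>2 * c)"
proof -
  have bT: "bounded_clinear T" by (rule hs_bound_bounded[OF T])
  have "hs_bound (cadjoint W \<circ> cadjoint T) (w\<^sup>2 * c)"
    by (rule hs_bound_compose_left[OF hs_bound_cadjoint[OF T] bounded_clinear_cadjoint[OF W(1)]
          norm_cadjoint_le[OF W]])
  then have "hs_bound (cadjoint (T \<circ> W)) (w\<^sup>2 * c)" by (simp only: cadjoint_compose[OF bT W(1)])
  from hs_bound_cadjoint[OF this] show ?thesis
    by (simp only: cadjoint_cadjoint[OF bounded_clinear_compose[OF bT W(1)]])
qed

lemma sum_cmod_cinner_le:
  "(\<Sum>e\<in>F. cmod (cinner (x e) (y e))) \<le> sqrt (\<Sum>e\<in>F. (norm (x e))\<^sup>2) * sqrt (\<Sum>e\<in>F. (norm (y e))\<^sup>2)"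
proof -
  have "(\<Sum>e\<in>F. cmod (cinner (x e) (y e))) \<le> (\<Sum>e\<in>F. \<bar>norm (x e)\<bar> * \<bar>norm (y e)\<bar>)"
    by (intro sum_mono) (simp add: norm_cinner_le)
  also have "\<dots> \<le> L2_set (\<lambda>e. norm (x e)) F * L2_set (\<lambda>e. norm (y e)) F"
    by (rule L2_set_mult_ineq)
  finally show ?thesis by (simp add: L2_set_def)
qed

lemma hs_cinner_abs_summable:
  assumes X: "hs_bound X b" and Y: "hs_bound Y d" and E: "orthonormal E"
  shows "(\<lambda>e. cmod (cinner (X e) (Y e))) summable_on E"
proof (rule nonneg_bdd_above_summable_on, simp, rule bdd_aboveI2)
  fix F assume "F \<in> {F. F \<subseteq> E \<and> finite F}"
  then have F: "finite F" "orthonormal F" using E orthonormal_subset by auto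
  have "(\<Sum>e\<in>F. cmod (cinner (X e) (Y e))) \<le> sqrt (\<Sum>e\<in>F. (norm (X e))\<^sup>2) * sqrt (\<Sum>e\<in>F. (norm (Y e))\<^sup>2)"
    by (rule sum_cmod_cinner_le)
  also have "\<dots> \<le> sqrt b * sqrt d"
    using hs_boundD[OF X F] hs_boundD[OF Y F] hs_bound_nonneg[OF X]
    by (intro mult_mono real_sqrt_le_mono) (auto intro: sum_nonneg)
  finally show "(\<Sum>e\<in>F. cmod (cinner (X e) (Y e))) \<le> sqrt b * sqrt d" .
qed

lemma hs_norm_square_summable:
  assumes X: "hs_bound X b" and E: "orthonormal E"
  shows "(\<lambda>e. (norm (X e))\<^sup>2) summable_on E"
  by (rule nonneg_bdd_above_summable_on)
    (auto intro!: bdd_aboveI2[where M = b] hs_boundD[OF X] orthonormal_subset[OF E])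

text \<open>
  The identity \<open>Tr (Y\<^sup>* X) = Tr (X Y\<^sup>*)\<close>. Both sides are the double sum of \<open>\<langle>X e, f\<rangle> \<langle>f, Y e\<rangle>\<close> over
  \<open>E \<times> E\<close>, which converges absolutely.
\<close>

lemma hs_trace_cyclic:
  assumes X: "hs_bound X b" and Y: "hs_bound Y d" and E: "orthonormal_basis E"
  shows "(\<Sum>\<^sub>\<infinity>e\<in>E. cinner (X e) (Y e)) = (\<Sum>\<^sub>\<infinity>f\<in>E. cinner (cadjoint Y f) (cadjoint X f))"
proof -
  have on: "orthonormal E" using E by (simp add: orthonormal_basis_def)
  have bX: "bounded_clinear X" and bY: "bounded_clinear Y" using X Y by (auto intro: hs_bound_bounded)
  let ?g = "\<lambda>(e, f). cinner (X e) f * cinner f (Y e)"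
  have sq: "(\<lambda>(e, f). (cmod (cinner (Z e) f))\<^sup>2) summable_on E \<times> E" if Z: "hs_bound Z c" for Z c
    by (rule summable_on_SigmaI[OF _ hs_norm_square_summable[OF Z on]])
      (auto intro: parseval_norm[OF E])
  have "(\<lambda>p. norm (?g p)) summable_on E \<times> E"
  proof (rule Infinite_Sum.abs_summable_on_comparison_test')
    show "(\<lambda>p. ((case p of (e, f) \<Rightarrow> (cmod (cinner (X e) f))\<^sup>2) + (case p of (e, f) \<Rightarrow> (cmod (cinner (Y e) f))\<^sup>2)) * (1/2))
        summable_on E \<times> E"
      by (intro summable_on_cmult_left summable_on_add sq[OF X] sq[OF Y])
    fix p assume "p \<in> E \<times> E"
    show "norm (?g p) \<le> ((case p of (e, f) \<Rightarrow> (cmod (cinner (X e) f))\<^sup>2) + (case p of (e, f) \<Rightarrow> (cmod (cinner (Y e) f))\<^sup>2)) * (1/2)"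
    proof (cases p)
      case (Pair e f)
      then show ?thesis
        using cmod_mult_le[of "cinner (X e) f" "cinner f (Y e)"] cmod_cinner_commute[of f "Y e"] by simp
    qed
  qed
  then have "?g summable_on E \<times> E" by (rule abs_summable_summable)
  from infsum_swap_banach[OF this]
  have "(\<Sum>\<^sub>\<infinity>e\<in>E. \<Sum>\<^sub>\<infinity>f\<in>E. cinner (X e) f * cinner f (Y e))
      = (\<Sum>\<^sub>\<infinity>f\<in>E. \<Sum>\<^sub>\<infinity>e\<in>E. cinner (X e) f * cinner f (Y e))" .
  moreover have "(\<Sum>\<^sub>\<infinity>f\<in>E. cinner (X e) f * cinner f (Y e)) = cinner (X e) (Y e)" for e
    by (rule infsumI[OF parseval[OF E]])
  moreover have "(\<Sum>\<^sub>\<infinity>e\<in>E. cinner (X e) f * cinner f (Y e)) = cinner (cadjoint Y f) (cadjoint X f)" for f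
  proof -
    have "cinner (X e) f * cinner f (Y e) = cinner (cadjoint Y f) e * cinner e (cadjoint X f)" for e
      by (simp only: cinner_cadjoint[OF bX] cinner_cadjoint_right[OF bY] mult.commute)
    then show ?thesis using infsumI[OF parseval[OF E]] by simp
  qed
  ultimately show ?thesis by (simp only:)
qed

section \<open>Trace class operators\<close>

text \<open>
  A bound of the trace norm, by duality with the finite rank contractions \<open>x \<mapsto> \<Sum>\<^sub>e\<^sub>\<in>\<^sub>F \<langle>x, U e\<rangle> e\<close>. The
  sums inside the absolute value are linear in \<open>T\<close>, so the bound passes to weak integrals.
\<close>

definition trace_norm_bound :: "('k::complex_hilbert_space \<Rightarrow> 'k) \<Rightarrow> real \<Rightarrow> bool" where
  "trace_norm_bound T c \<longleftrightarrow> bounded_clinear T \<and>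
     (\<forall>F U. finite F \<and> orthonormal F \<and> bounded_clinear U \<and> (\<forall>x. norm (U x) \<le> norm x) \<longrightarrow>
        cmod (\<Sum>e\<in>F. cinner (T e) (U e)) \<le> c)"

lemma trace_norm_boundI:
  fixes T :: "'k::complex_hilbert_space \<Rightarrow> 'k"
  assumes "bounded_clinear T"
    "\<And>F U. finite F \<Longrightarrow> orthonormal F \<Longrightarrow> bounded_clinear U \<Longrightarrow> (\<And>x. norm (U x) \<le> norm x) \<Longrightarrow>
        cmod (\<Sum>e\<in>F. cinner (T e) (U e)) \<le> c"
  shows "trace_norm_bound T c"
  using assms unfolding trace_norm_bound_def by blast

lemma trace_norm_bound_bounded: "trace_norm_bound T c \<Longrightarrow> bounded_clinear T"
  by (simp add: trace_norm_bound_def)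

lemma trace_norm_boundD:
  assumes "trace_norm_bound T c" "finite F" "orthonormal F" "bounded_clinear U" "\<And>x. norm (U x) \<le> norm x"
  shows "cmod (\<Sum>e\<in>F. cinner (T e) (U e)) \<le> c"
  using assms by (simp add: trace_norm_bound_def)

lemma trace_norm_bound_nonneg:
  assumes "trace_norm_bound T c" shows "0 \<le> c"
  using trace_norm_boundD[OF assms _ _ bounded_clinear_id, of "{}"] by (simp add: orthonormal_def)

lemma trace_norm_bound_trace:
  assumes "trace_norm_bound T c" "finite F" "orthonormal F"
  shows "cmod (\<Sum>e\<in>F. cinner (T e) e) \<le> c"
  using trace_norm_boundD[OF assms bounded_clinear_id] by simp

lemma trace_norm_bound_hs_product:
  fixes B :: "'k::complex_hilbert_space \<Rightarrow> 'k"
  assumes B: "hs_bound B b" and D: "hs_bound D d"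
  shows "trace_norm_bound (B \<circ> D) (sqrt b * sqrt d)"
proof -
  have bB: "bounded_clinear B" and bD: "bounded_clinear D" using B D by (auto intro: hs_bound_bounded)
  show ?thesis
  proof (rule trace_norm_boundI[OF bounded_clinear_compose[OF bB bD]])
    fix F :: "'k set" and U :: "'k \<Rightarrow> 'k"
    assume F: "finite F" "orthonormal F" and U: "bounded_clinear U" "\<And>x. norm (U x) \<le> norm x"
    have Y: "hs_bound (cadjoint B \<circ> U) (1\<^sup>2 * b)"
      using U by (intro hs_bound_compose_right[OF hs_bound_cadjoint[OF B]]) auto
    have "cmod (\<Sum>e\<in>F. cinner ((B \<circ> D) e) (U e)) \<le> (\<Sum>e\<in>F. cmod (cinner (D e) ((cadjoint B \<circ> U) e)))"
      by (rule order_trans[OF norm_sum]) (simp only: comp_apply cinner_cadjoint[OF bB])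
    also have "\<dots> \<le> sqrt (\<Sum>e\<in>F. (norm (D e))\<^sup>2) * sqrt (\<Sum>e\<in>F. (norm ((cadjoint B \<circ> U) e))\<^sup>2)"
      by (rule sum_cmod_cinner_le)
    also have "\<dots> \<le> sqrt d * sqrt b"
      using hs_boundD[OF D F] hs_boundD[OF Y F] hs_bound_nonneg[OF D]
      by (intro mult_mono real_sqrt_le_mono) (auto intro: sum_nonneg)
    finally show "cmod (\<Sum>e\<in>F. cinner ((B \<circ> D) e) (U e)) \<le> sqrt b * sqrt d" by (simp only: mult.commute)
  qed
qed

text \<open>
  With \<open>R\<close> the square root of \<open>\<bar>T\<bar>\<close> and \<open>T = W \<bar>T\<bar>\<close>, the factors are \<open>W R\<close> and \<open>R\<close>: the sum defining the trace
  norm is the sum of \<open>\<parallel>R e\<parallel>\<^sup>2\<close> over the basis.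
\<close>

lemma trace_norm_le_imp_hs_factors:
  fixes T :: "'k::complex_hilbert_space \<Rightarrow> 'k"
  assumes T: "bounded_clinear T" and le: "trace_norm T \<le> ennreal c" and c: "0 \<le> c"
  obtains B D where "hs_bound B c" "hs_bound D c" "T = B \<circ> D"
proof -
  obtain R where R: "positive_op R" "R \<circ> R = abs_op T"
    using positive_sqrt_ex1[OF positive_abs_op[OF T]] by blast
  have bR: "bounded_clinear R" by (rule positive_op_bounded[OF R(1)])
  have nR: "Re (cinner (abs_op T e) e) = (norm (R e))\<^sup>2" for e
    unfolding R(2)[symmetric] comp_apply positive_op_self_adjoint[OF R(1)] cinner_self by simp
  have hsR: "hs_bound R c"
  proof (rule hs_boundI_cadjoint[OF orthonormal_basis_some_onb bR])
    fix G :: "'k set" assume G: "finite G" "G \<subseteq> some_onb"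
    have "(\<Sum>e\<in>G. ennreal ((norm (R e))\<^sup>2)) \<le> trace_norm T"
      unfolding trace_norm_def nR nonneg_infsum_complete[of some_onb, OF zero_le]
      using G by (intro SUP_upper) auto
    then have "ennreal (\<Sum>e\<in>G. (norm (R e))\<^sup>2) \<le> ennreal c"
      using le by (simp add: sum_ennreal)
    then show "(\<Sum>e\<in>G. (norm (cadjoint R e))\<^sup>2) \<le> c"
      using c by (simp add: ennreal_le_iff positive_op_cadjoint[OF R(1)])
  qed
  obtain W where W: "bounded_clinear W" "\<And>x. norm (W x) \<le> norm x" "T = W \<circ> abs_op T"
    by (rule douglas_factorization[OF T positive_op_bounded[OF positive_abs_op[OF T]]])
      (simp_all add: norm_abs_op[OF T])
  have "hs_bound (W \<circ> R) (1\<^sup>2 * c)" using W by (intro hs_bound_compose_left[OF hsR]) auto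
  moreover have "T = (W \<circ> R) \<circ> R" using W(3) R(2) by (simp add: comp_assoc)
  ultimately show thesis using that hsR by simp
qed

text \<open>
  From left to right by the Hilbert-Schmidt factors and Cauchy-Schwarz. From right to left, write
  \<open>\<bar>T\<bar> = W T\<close> with a contraction \<open>W\<close>; then the contraction \<open>W\<^sup>*\<close> detects the trace norm.
\<close>

lemma trace_norm_le_iff:
  fixes T :: "'k::complex_hilbert_space \<Rightarrow> 'k"
  assumes T: "bounded_clinear T" and c: "0 \<le> c"
  shows "trace_norm T \<le> ennreal c \<longleftrightarrow> trace_norm_bound T c"
proof
  assume "trace_norm T \<le> ennreal c"
  then obtain B D where BD: "hs_bound B c" "hs_bound D c" "T = B \<circ> D"
    using trace_norm_le_imp_hs_factors[OF T _ c] by blast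
  then show "trace_norm_bound T c"
    using trace_norm_bound_hs_product[OF BD(1,2)] c by simp
next
  assume b: "trace_norm_bound T c"
  have pos: "positive_op (abs_op T)" by (rule positive_abs_op[OF T])
  obtain W where W: "bounded_clinear W" "\<And>x. norm (W x) \<le> norm x" "abs_op T = W \<circ> T"
    by (rule douglas_factorization[OF positive_op_bounded[OF pos] T])
      (simp_all add: norm_abs_op[OF T])
  have W': "bounded_clinear (cadjoint W)" "\<And>x. norm (cadjoint W x) \<le> norm x"
    using bounded_clinear_cadjoint[OF W(1)] norm_cadjoint_le[OF W(1), of 1] W(2) by auto
  show "trace_norm T \<le> ennreal c"
    unfolding trace_norm_def
  proof (rule infsum_le_finite_sums[OF nonneg_summable_on_complete[OF zero_le]])
    fix G :: "'k set" assume G: "finite G" "G \<subseteq> some_onb"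
    have nonneg: "0 \<le> Re (cinner (abs_op T e) e)" for e using pos by (simp add: positive_op_def)
    have "(\<Sum>e\<in>G. Re (cinner (abs_op T e) e)) = Re (\<Sum>e\<in>G. cinner (T e) (cadjoint W e))"
      by (simp only: W(3) comp_apply cinner_cadjoint[OF W(1)] Re_sum)
    also have "\<dots> \<le> cmod (\<Sum>e\<in>G. cinner (T e) (cadjoint W e))" by (rule complex_Re_le_cmod)
    also have "\<dots> \<le> c"
      by (rule trace_norm_boundD[OF b G(1) orthonormal_subset[OF orthonormal_some_onb G(2)] W'])
    finally show "(\<Sum>e\<in>G. ennreal (Re (cinner (abs_op T e) e))) \<le> ennreal c"
      using nonneg by (simp add: sum_ennreal ennreal_leI)
  qed
qed

lemma trace_norm_bound_hs_factors:
  assumes "trace_norm_bound T c"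
  obtains B D where "hs_bound B c" "hs_bound D c" "T = B \<circ> D"
  using trace_norm_le_imp_hs_factors[of T c] trace_norm_le_iff[of T c] assms
    trace_norm_bound_bounded[OF assms] trace_norm_bound_nonneg[OF assms] by blast

lemma trace_norm_bound_trace_class:
  assumes "trace_norm_bound T c" shows "trace_class T"
proof -
  have "trace_norm T \<le> ennreal c"
    using assms trace_norm_le_iff[OF trace_norm_bound_bounded[OF assms] trace_norm_bound_nonneg[OF assms]]
    by blast
  then show ?thesis
    unfolding trace_class_def using trace_norm_bound_bounded[OF assms]
    by (auto intro: le_less_trans ennreal_less_top)
qed

lemma trace_norm_bound_abs_summable:
  assumes T: "trace_norm_bound T c" and E: "orthonormal E"
  shows "(\<lambda>e. cmod (cinner (T e) e)) summable_on E"
proof -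
  obtain B D where BD: "hs_bound B c" "hs_bound D c" "T = B \<circ> D"
    by (rule trace_norm_bound_hs_factors[OF T])
  have "cinner (T e) e = cinner (D e) (cadjoint B e)" for e
    unfolding BD(3) comp_apply by (rule cinner_cadjoint[OF hs_bound_bounded[OF BD(1)]])
  then show ?thesis using hs_cinner_abs_summable[OF BD(2) hs_bound_cadjoint[OF BD(1)] E] by simp
qed

lemma trace_norm_bound_compose:
  assumes A: "trace_norm_bound A c" and W: "bounded_clinear W" "\<And>x. norm (W x) \<le> w * norm x" "w \<ge> 0"
  shows trace_norm_bound_compose_left: "trace_norm_bound (W \<circ> A) (w * c)"
    and trace_norm_bound_compose_right: "trace_norm_bound (A \<circ> W) (w * c)"
proof -
  obtain B D where BD: "hs_bound B c" "hs_bound D c" "A = B \<circ> D"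
    by (rule trace_norm_bound_hs_factors[OF A])
  have c: "0 \<le> c" by (rule trace_norm_bound_nonneg[OF A])
  have s: "sqrt (w\<^sup>2 * c) * sqrt c = w * c" "sqrt c * sqrt (w\<^sup>2 * c) = w * c"
    using c W(3) by (simp_all add: real_sqrt_mult)
  show "trace_norm_bound (W \<circ> A) (w * c)"
    using trace_norm_bound_hs_product[OF hs_bound_compose_left[OF BD(1) W(1,2)] BD(2)]
    unfolding s BD(3) by (simp only: comp_assoc)
  show "trace_norm_bound (A \<circ> W) (w * c)"
    using trace_norm_bound_hs_product[OF BD(1) hs_bound_compose_right[OF BD(2) W]]
    unfolding s BD(3) by (simp only: comp_assoc)
qed

text \<open>
  With \<open>A = B D\<close>, both \<open>B D W\<close> and \<open>W B D\<close> have the trace of \<open>D W B\<close>; the middle terms of the chain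
  below are this trace.
\<close>

lemma trace_commute:
  assumes A: "trace_norm_bound A c" and W: "bounded_clinear W"
  shows "(\<Sum>\<^sub>\<infinity>e\<in>some_onb. cinner (A (W e)) e) = (\<Sum>\<^sub>\<infinity>e\<in>some_onb. cinner (W (A e)) e)"
proof -
  obtain B D where BD: "hs_bound B c" "hs_bound D c" "A = B \<circ> D"
    by (rule trace_norm_bound_hs_factors[OF A])
  have bB: "bounded_clinear B" and bD: "bounded_clinear D"
    using BD by (auto intro: hs_bound_bounded)
  obtain w where w: "w \<ge> 0" "\<And>x. norm (W x) \<le> w * norm x" using bounded_clinear_bound[OF W] by blast
  have DW: "hs_bound (D \<circ> W) (w\<^sup>2 * c)" by (rule hs_bound_compose_right[OF BD(2) W w(2,1)])
  have WB: "hs_bound (W \<circ> B) (w\<^sup>2 * c)" by (rule hs_bound_compose_left[OF BD(1) W w(2)])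
  have "(\<Sum>\<^sub>\<infinity>e\<in>some_onb. cinner (A (W e)) e) = (\<Sum>\<^sub>\<infinity>e\<in>some_onb. cinner ((D \<circ> W) e) (cadjoint B e))"
    unfolding BD(3) comp_apply cinner_cadjoint[OF bB] ..
  also have "\<dots> = (\<Sum>\<^sub>\<infinity>f\<in>some_onb. cinner (cadjoint (cadjoint B) f) (cadjoint (D \<circ> W) f))"
    by (rule hs_trace_cyclic[OF DW hs_bound_cadjoint[OF BD(1)] orthonormal_basis_some_onb])
  also have "\<dots> = (\<Sum>\<^sub>\<infinity>f\<in>some_onb. cinner (cadjoint (cadjoint (W \<circ> B)) f) (cadjoint D f))"
    unfolding cadjoint_cadjoint[OF bB] cadjoint_cadjoint[OF hs_bound_bounded[OF WB]]
      cadjoint_compose[OF bD W] comp_apply cinner_cadjoint[OF W] ..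
  also have "\<dots> = (\<Sum>\<^sub>\<infinity>e\<in>some_onb. cinner (D e) (cadjoint (W \<circ> B) e))"
    by (rule hs_trace_cyclic[OF BD(2) hs_bound_cadjoint[OF WB] orthonormal_basis_some_onb, symmetric])
  also have "\<dots> = (\<Sum>\<^sub>\<infinity>e\<in>some_onb. cinner (W (A e)) e)"
    unfolding cinner_cadjoint[OF hs_bound_bounded[OF WB], symmetric] BD(3) comp_apply ..
  finally show ?thesis .
qed

section \<open>Bounded measurable functions\<close>

definition bounded_measurable :: "'a measure \<Rightarrow> ('a \<Rightarrow> complex) \<Rightarrow> bool" where
  "bounded_measurable M f \<longleftrightarrow> f \<in> borel_measurable M \<and> (\<exists>c. \<forall>x\<in>space M. cmod (f x) \<le> c)"

lemma bounded_measurableI: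
  "f \<in> borel_measurable M \<Longrightarrow> (\<And>x. x \<in> space M \<Longrightarrow> cmod (f x) \<le> c) \<Longrightarrow> bounded_measurable M f"
  by (auto simp: bounded_measurable_def)

lemma bounded_measurable_measurable: "bounded_measurable M f \<Longrightarrow> f \<in> borel_measurable M"
  by (simp add: bounded_measurable_def)

lemma bounded_measurable_boundE:
  assumes "bounded_measurable M f"
  obtains c where "0 \<le> c" "\<And>x. x \<in> space M \<Longrightarrow> cmod (f x) \<le> c"
proof -
  obtain c where "\<forall>x\<in>space M. cmod (f x) \<le> c" using assms by (auto simp: bounded_measurable_def)
  then show thesis by (intro that[of "max c 0"]) auto
qed

lemma bounded_measurable_indicator: "A \<in> sets M \<Longrightarrow> bounded_measurable M (indicator A)"
  by (rule bounded_measurableI[of _ _ 1]) (auto simp: indicator_def)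

lemma bounded_measurable_lincomb:
  assumes f: "bounded_measurable M f" and g: "bounded_measurable M g"
  shows "bounded_measurable M (\<lambda>x. c * f x + g x)"
proof -
  note [measurable] = bounded_measurable_measurable[OF f] bounded_measurable_measurable[OF g]
  obtain a where a: "\<And>x. x \<in> space M \<Longrightarrow> cmod (f x) \<le> a" using bounded_measurable_boundE[OF f] by blast
  obtain b where b: "\<And>x. x \<in> space M \<Longrightarrow> cmod (g x) \<le> b" using bounded_measurable_boundE[OF g] by blast
  show ?thesis
  proof (rule bounded_measurableI)
    show "cmod (c * f x + g x) \<le> cmod c * a + b" if "x \<in> space M" for x
      using norm_triangle_ineq[of "c * f x" "g x"] mult_left_mono[OF a[OF that], of "cmod c"] b[OF that]
      by (simp add: norm_mult)
  qed measurable
qed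

text \<open>
  A functional monotone class theorem. The closure under bounded pointwise limits, applied to a
  constant sequence, also shows that \<open>P\<close> depends only on the values on \<open>space M\<close>.
\<close>

lemma bounded_measurable_induct:
  fixes M :: "'a measure" and f :: "'a \<Rightarrow> complex"
  assumes f: "bounded_measurable M f"
    and gen: "sets M = sigma_sets (space M) G" "Int_stable G" "G \<subseteq> Pow (space M)" "space M \<in> G"
    and basic: "\<And>A. A \<in> G \<Longrightarrow> P (indicator A)"
    and lincomb: "\<And>c f g. bounded_measurable M f \<Longrightarrow> bounded_measurable M g \<Longrightarrow> P f \<Longrightarrow> P g \<Longrightarrow>
       P (\<lambda>x. c * f x + g x)"
    and limit: "\<And>u f c. (\<And>n. bounded_measurable M (u n)) \<Longrightarrow> (\<And>n::nat. P (u n)) \<Longrightarrow>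
       (\<And>n x. x \<in> space M \<Longrightarrow> cmod (u n x) \<le> c) \<Longrightarrow> bounded_measurable M f \<Longrightarrow>
       (\<And>x. x \<in> space M \<Longrightarrow> (\<lambda>n. u n x) \<longlonglongrightarrow> f x) \<Longrightarrow> P f"
  shows "P f"
proof -
  have space: "P (indicator (space M))" by (rule basic[OF gen(4)])
  have bm_zero: "bounded_measurable M (\<lambda>x. 0)" by (rule bounded_measurableI[of _ _ 0]) auto
  have zero: "P (\<lambda>x. 0)"
    using lincomb[OF bounded_measurable_indicator bounded_measurable_indicator space space, of "- 1"] by simp
  have sum: "bounded_measurable M (\<lambda>x. \<Sum>i\<in>I. c i * h i x) \<and> P (\<lambda>x. \<Sum>i\<in>I. c i * h i x)"
    if "finite I" "\<And>i. i \<in> I \<Longrightarrow> bounded_measurable M (h i) \<and> P (h i)" for I :: "'i set" and c h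
    using that
  proof (induction I rule: finite_induct)
    case (insert i I)
    then have IH: "bounded_measurable M (\<lambda>x. \<Sum>i\<in>I. c i * h i x)" "P (\<lambda>x. \<Sum>i\<in>I. c i * h i x)"
      and i: "bounded_measurable M (h i)" "P (h i)" by blast+
    show ?case
      unfolding sum.insert[OF insert(1,2)]
      by (rule conjI[OF bounded_measurable_lincomb[OF i(1) IH(1)] lincomb[OF i(1) IH(1) i(2) IH(2)]])
  qed (simp add: zero bm_zero)
  have ind: "P (indicator A)" if A: "A \<in> sets M" for A
  proof -
    have "A \<in> sigma_sets (space M) G" using A gen(1) by simp
    with gen(2,3) show ?thesis
    proof (induction rule: sigma_sets_induct_disjoint)
      case (basic A)
      then show ?case by (rule assms(6))
    next
      case empty
      then show ?case using zero by simp
    next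
      case (compl A)
      then have A: "A \<in> sets M" using gen(1) by simp
      have "P (\<lambda>x. - 1 * indicator A x + indicator (space M) x)"
        by (rule lincomb[OF bounded_measurable_indicator[OF A] bounded_measurable_indicator compl(2) space]) simp
      also have "(\<lambda>x. - 1 * indicator A x + indicator (space M) x) = (indicator (space M - A) :: 'a \<Rightarrow> complex)"
        using sets.sets_into_space[OF A] by (auto simp: indicator_def fun_eq_iff)
      finally show ?case .
    next
      case (union A)
      have A: "A i \<in> sets M" for i using union(2) gen(1) by auto
      have fin: "indicator (\<Union>i<n. A i) = (\<lambda>x. \<Sum>i<n. 1 * indicator (A i) x :: complex)" for n :: nat
      proof
        fix x
        have "disjoint_family_on A {..<n}" using union(1) by (auto simp: disjoint_family_on_def)
        from indicator_UN_disjoint[OF finite_lessThan this]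
        show "indicator (\<Union>i<n. A i) x = (\<Sum>i<n. 1 * indicator (A i) x :: complex)" by simp
      qed
      show ?case
      proof (rule limit[of "\<lambda>n. indicator (\<Union>i<n. A i)"])
        show "bounded_measurable M (indicator (\<Union>i<n. A i))" for n
          using A by (intro bounded_measurable_indicator) auto
        show "P (indicator (\<Union>i<n. A i))" for n
          unfolding fin by (rule sum[THEN conjunct2]) (simp_all add: union(3) bounded_measurable_indicator[OF A])
        show "cmod (indicator (\<Union>i<n. A i) x) \<le> 1" for n x by (simp add: indicator_def)
        show "bounded_measurable M (indicator (\<Union>i. A i))"
          using A by (intro bounded_measurable_indicator) auto
      qed (rule LIMSEQ_indicator_UN)
    qed
  qed
  have simple: "P s" if s: "simple_function M s" "bounded_measurable M s" for s
  proof -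
    let ?s = "\<lambda>x. \<Sum>y\<in>s ` space M. y * indicator (s -` {y} \<inter> space M) x"
    have level: "s -` {y} \<inter> space M \<in> sets M" for y
      using bounded_measurable_measurable[OF s(2)] by (rule measurable_sets) simp
    have "bounded_measurable M ?s \<and> P ?s"
    proof (rule sum)
      show "finite (s ` space M)" using s(1) by (simp add: simple_function_def)
    qed (intro conjI ind bounded_measurable_indicator level)
    then have bm: "bounded_measurable M ?s" and P: "P ?s" by blast+
    obtain c where c: "\<And>x. x \<in> space M \<Longrightarrow> cmod (s x) \<le> c" using bounded_measurable_boundE[OF s(2)] by blast
    have eq: "?s x = s x" if "x \<in> space M" for x
      unfolding simple_function_indicator_representation_banach[OF s(1) that]
      by (intro sum.cong refl) (simp add: indicator_def)
    show ?thesis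
    proof (rule limit[OF bm P _ s(2)])
      show "cmod (?s x) \<le> c" if "x \<in> space M" for x unfolding eq[OF that] by (rule c[OF that])
      show "(\<lambda>n. ?s x) \<longlonglongrightarrow> s x" if "x \<in> space M" for x unfolding eq[OF that] by (rule tendsto_const)
    qed
  qed
  obtain F where F: "\<forall>i. simple_function M (F i)" "\<forall>x\<in>space M. (\<lambda>i. F i x) \<longlonglongrightarrow> f x"
      "\<forall>i. \<forall>x\<in>space M. dist (F i x) 0 \<le> 2 * dist (f x) 0"
    using borel_measurable_implies_sequence_metric[OF bounded_measurable_measurable[OF f], of 0] by blast
  obtain c where c: "\<And>x. x \<in> space M \<Longrightarrow> cmod (f x) \<le> c" using bounded_measurable_boundE[OF f] by blast
  have le: "cmod (F i x) \<le> 2 * c" if "x \<in> space M" for i x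
    using F(3)[rule_format, OF that, of i] c[OF that] by (simp add: dist_norm)
  have bm: "bounded_measurable M (F i)" for i
    using F(1) by (intro bounded_measurableI[OF borel_measurable_simple_function le]) simp_all
  have PF: "P (F i)" for i using F(1) by (intro simple bm) simp
  show ?thesis
  proof (rule limit[OF bm PF _ f])
    show "cmod (F n x) \<le> 2 * c" if "x \<in> space M" for n x using that by (rule le)
    show "(\<lambda>n. F n x) \<longlonglongrightarrow> f x" if "x \<in> space M" for x using that F(2) by simp
  qed
qed

lemma (in finite_measure) bounded_measurable_integrable:
  assumes "bounded_measurable M f" shows "integrable M f"
proof -
  obtain c where "\<And>x. x \<in> space M \<Longrightarrow> cmod (f x) \<le> c" using bounded_measurable_boundE[OF assms] by blast
  then show ?thesis
    by (intro integrable_const_bound[of f c] bounded_measurable_measurable[OF assms]) auto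
qed

lemma (in finite_measure) bounded_convergence:
  fixes u :: "nat \<Rightarrow> 'a \<Rightarrow> complex"
  assumes "\<And>n. u n \<in> borel_measurable M" "f \<in> borel_measurable M"
    and "\<And>n x. x \<in> space M \<Longrightarrow> cmod (u n x) \<le> c" "\<And>x. x \<in> space M \<Longrightarrow> (\<lambda>n. u n x) \<longlonglongrightarrow> f x"
  shows "(\<lambda>n. \<integral>x. u n x \<partial>M) \<longlonglongrightarrow> (\<integral>x. f x \<partial>M)"
  by (rule integral_dominated_convergence[where w = "\<lambda>x. c"]) (use assms in auto)

lemma (in finite_measure) cmod_integral_le:
  fixes f :: "'a \<Rightarrow> complex"
  assumes "f \<in> borel_measurable M" "\<And>x. x \<in> space M \<Longrightarrow> cmod (f x) \<le> c"
  shows "cmod (\<integral>x. f x \<partial>M) \<le> c * measure M (space M)"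
proof -
  have int: "integrable M f" by (rule bounded_measurable_integrable[OF bounded_measurableI]) (use assms in auto)
  have "cmod (\<integral>x. f x \<partial>M) \<le> (\<integral>x. cmod (f x) \<partial>M)" by (rule integral_norm_bound)
  also have "\<dots> \<le> (\<integral>x. c \<partial>M)" by (rule integral_mono) (use int assms in auto)
  finally show ?thesis by (simp add: mult.commute)
qed

section \<open>Integration against complex measures\<close>

text \<open>
  The value assigned by \<open>complex_measure_integral\<close> to a decomposition
  \<open>\<mu> 0 + \<i> \<mu> 1 - \<mu> 2 - \<i> \<mu> 3\<close> of a complex measure.
\<close>

definition jordan_integral :: "(nat \<Rightarrow> 'a measure) \<Rightarrow> ('a \<Rightarrow> complex) \<Rightarrow> complex" where
  "jordan_integral \<mu> f = (\<Sum>n<4. \<i> ^ n * (\<integral>x. f x \<partial>\<mu> n))"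

locale jordan_family =
  fixes X :: "'a measure" and \<mu> :: "nat \<Rightarrow> 'a measure"
  assumes fin: "n < 4 \<Longrightarrow> finite_measure (\<mu> n)" and sets: "n < 4 \<Longrightarrow> sets (\<mu> n) = sets X"
begin

lemma space: "n < 4 \<Longrightarrow> space (\<mu> n) = space X"
  by (rule sets_eq_imp_space_eq[OF sets])

lemma bounded_measurable_iff: "n < 4 \<Longrightarrow> bounded_measurable (\<mu> n) f \<longleftrightarrow> bounded_measurable X f"
  by (simp add: bounded_measurable_def space measurable_cong_sets[OF sets refl])

lemma integrable: "n < 4 \<Longrightarrow> bounded_measurable X f \<Longrightarrow> integrable (\<mu> n) f"
  by (rule finite_measure.bounded_measurable_integrable[OF fin]) (simp_all add: bounded_measurable_iff)

lemma jordan_integral_indicator: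
  assumes "A \<in> sets X"
  shows "jordan_integral \<mu> (indicator A) = (\<Sum>n<4. \<i> ^ n * complex_of_real (measure (\<mu> n) A))"
  unfolding jordan_integral_def
proof (rule sum.cong[OF refl])
  fix n assume n: "n \<in> {..<4::nat}"
  have "A \<in> sets (\<mu> n)" using assms n sets by simp
  then have "(\<integral>x. complex_of_real (indicator A x) \<partial>\<mu> n) = complex_of_real (measure (\<mu> n) A)"
    by (simp add: sets.Int_space_eq2)
  then show "\<i> ^ n * (\<integral>x. indicator A x \<partial>\<mu> n) = \<i> ^ n * complex_of_real (measure (\<mu> n) A)"
    by (simp add: of_real_indicator)
qed

lemma jordan_integral_lincomb:
  assumes "bounded_measurable X f" "bounded_measurable X g"
  shows "jordan_integral \<mu> (\<lambda>x. c * f x + g x) = c * jordan_integral \<mu> f + jordan_integral \<mu> g"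
  unfolding jordan_integral_def sum_distrib_left sum.distrib[symmetric]
proof (rule sum.cong[OF refl])
  fix n assume "n \<in> {..<4::nat}"
  then have "(\<integral>x. c * f x + g x \<partial>\<mu> n) = c * (\<integral>x. f x \<partial>\<mu> n) + (\<integral>x. g x \<partial>\<mu> n)"
    by (subst Bochner_Integration.integral_add) (simp_all add: integrable assms)
  then show "\<i> ^ n * (\<integral>x. c * f x + g x \<partial>\<mu> n)
      = c * (\<i> ^ n * (\<integral>x. f x \<partial>\<mu> n)) + \<i> ^ n * (\<integral>x. g x \<partial>\<mu> n)"
    by (simp only: distrib_left mult.left_commute)
qed

lemma jordan_integral_limit:
  assumes "\<And>n. bounded_measurable X (u n)" "bounded_measurable X f"
    and "\<And>n x. x \<in> space X \<Longrightarrow> cmod (u n x) \<le> c" "\<And>x. x \<in> space X \<Longrightarrow> (\<lambda>n. u n x) \<longlonglongrightarrow> f x"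
  shows "(\<lambda>n. jordan_integral \<mu> (u n)) \<longlonglongrightarrow> jordan_integral \<mu> f"
  unfolding jordan_integral_def
proof (intro tendsto_sum tendsto_mult tendsto_const)
  fix k assume "k \<in> {..<4::nat}"
  then have k: "k < 4" by simp
  show "(\<lambda>n. \<integral>x. u n x \<partial>\<mu> k) \<longlonglongrightarrow> (\<integral>x. f x \<partial>\<mu> k)"
    by (rule finite_measure.bounded_convergence[OF fin[OF k], of _ _ c])
      (use assms in \<open>simp_all add: space[OF k] measurable_cong_sets[OF sets[OF k] refl] bounded_measurable_measurable\<close>)
qed

end

lemma bounded_measurable_induct_sets [consumes 1, case_names indicator lincomb limit]:
  assumes "bounded_measurable M f"
    and "\<And>A. A \<in> sets M \<Longrightarrow> P (indicator A)"
    and "\<And>c f g. bounded_measurable M f \<Longrightarrow> bounded_measurable M g \<Longrightarrow> P f \<Longrightarrow> P g \<Longrightarrow>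
       P (\<lambda>x. c * f x + g x)"
    and "\<And>u f c. (\<And>n. bounded_measurable M (u n)) \<Longrightarrow> (\<And>n::nat. P (u n)) \<Longrightarrow>
       (\<And>n x. x \<in> space M \<Longrightarrow> cmod (u n x) \<le> c) \<Longrightarrow> bounded_measurable M f \<Longrightarrow>
       (\<And>x. x \<in> space M \<Longrightarrow> (\<lambda>n. u n x) \<longlonglongrightarrow> f x) \<Longrightarrow> P f"
  shows "P f"
proof (rule bounded_measurable_induct[OF assms(1), of "sets M"])
  show "sets M = sigma_sets (space M) (sets M)" by (rule sets.sigma_sets_eq[symmetric])
  show "Int_stable (sets M)" by (rule sets.Int_stable)
  show "sets M \<subseteq> Pow (space M)" by (rule sets.space_closed)
  show "space M \<in> sets M" by (rule sets.top)
qed (fact assms(2) assms(3) assms(4))+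

lemma jordan_integral_unique:
  assumes \<mu>: "jordan_family X \<mu>" and \<nu>: "jordan_family X \<nu>"
    and eq: "\<And>A. A \<in> sets X \<Longrightarrow>
      (\<Sum>n<4. \<i> ^ n * complex_of_real (measure (\<mu> n) A)) = (\<Sum>n<4. \<i> ^ n * complex_of_real (measure (\<nu> n) A))"
    and f: "bounded_measurable X f"
  shows "jordan_integral \<mu> f = jordan_integral \<nu> f"
  using f
proof (induction f rule: bounded_measurable_induct_sets)
  case (indicator A)
  show ?case
    unfolding jordan_family.jordan_integral_indicator[OF \<mu> indicator]
      jordan_family.jordan_integral_indicator[OF \<nu> indicator] by (rule eq[OF indicator])
next
  case (lincomb c f g)
  show ?case
    unfolding jordan_family.jordan_integral_lincomb[OF \<mu> lincomb(1,2)]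
      jordan_family.jordan_integral_lincomb[OF \<nu> lincomb(1,2)] lincomb(3,4) ..
next
  case (limit u f c)
  have "(\<lambda>n. jordan_integral \<mu> (u n)) \<longlonglongrightarrow> jordan_integral \<mu> f"
    by (rule jordan_family.jordan_integral_limit[OF \<mu> limit.hyps(1,3,2,4)])
  moreover have "(\<lambda>n. jordan_integral \<mu> (u n)) \<longlonglongrightarrow> jordan_integral \<nu> f"
    unfolding limit.IH by (rule jordan_family.jordan_integral_limit[OF \<nu> limit.hyps(1,3,2,4)])
  ultimately show ?case by (rule LIMSEQ_unique)
qed

lemma complex_measure_integral_eq:
  assumes \<mu>: "jordan_family X \<mu>"
    and eq: "\<And>A. A \<in> sets X \<Longrightarrow> \<nu> A = (\<Sum>n<4. \<i> ^ n * complex_of_real (measure (\<mu> n) A))"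
    and f: "bounded_measurable X f"
  shows "complex_measure_integral X \<nu> f = jordan_integral \<mu> f"
  unfolding complex_measure_integral_def
proof (rule the_equality)
  show "\<exists>\<mu>'. (\<forall>n<4. finite_measure (\<mu>' n) \<and> sets (\<mu>' n) = sets X \<and> integrable (\<mu>' n) f) \<and>
     (\<forall>G\<in>sets X. \<nu> G = (\<Sum>n<4. \<i> ^ n * complex_of_real (measure (\<mu>' n) G))) \<and>
     jordan_integral \<mu> f = (\<Sum>n<4. \<i> ^ n * (\<integral>x. f x \<partial>\<mu>' n))"
    unfolding jordan_integral_def
    by (intro exI[of _ \<mu>] conjI allI impI ballI jordan_family.fin[OF \<mu>] jordan_family.sets[OF \<mu>]
        jordan_family.integrable[OF \<mu> _ f] eq refl) assumption+
next
  fix c assume "\<exists>\<mu>'. (\<forall>n<4. finite_measure (\<mu>' n) \<and> sets (\<mu>' n) = sets X \<and> integrable (\<mu>' n) f) \<and>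
     (\<forall>G\<in>sets X. \<nu> G = (\<Sum>n<4. \<i> ^ n * complex_of_real (measure (\<mu>' n) G))) \<and>
     c = (\<Sum>n<4. \<i> ^ n * (\<integral>x. f x \<partial>\<mu>' n))"
  then obtain \<mu>' where \<mu>': "\<forall>n<4. finite_measure (\<mu>' n) \<and> sets (\<mu>' n) = sets X \<and> integrable (\<mu>' n) f"
      "\<forall>G\<in>sets X. \<nu> G = (\<Sum>n<4. \<i> ^ n * complex_of_real (measure (\<mu>' n) G))"
      "c = (\<Sum>n<4. \<i> ^ n * (\<integral>x. f x \<partial>\<mu>' n))"
    by (elim exE conjE)
  have fam: "jordan_family X \<mu>'" by (rule jordan_family.intro) (simp_all add: \<mu>'(1))
  have "jordan_integral \<mu>' f = jordan_integral \<mu> f"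
  proof (rule jordan_integral_unique[OF fam \<mu> _ f])
    fix A assume A: "A \<in> sets X"
    show "(\<Sum>n<4. \<i> ^ n * complex_of_real (measure (\<mu>' n) A)) = (\<Sum>n<4. \<i> ^ n * complex_of_real (measure (\<mu> n) A))"
      unfolding bspec[OF \<mu>'(2) A, symmetric] by (rule eq[OF A])
  qed
  then show "c = jordan_integral \<mu> f" by (simp only: \<mu>'(3) jordan_integral_def)
qed

section \<open>Integration against a projection valued measure\<close>

text \<open>
  The factor \<open>1/2\<close> is put into the vectors, so that every term is, up to the power of \<open>\<i>\<close>, a value of
  the quadratic form. For \<open>T = Q G\<close> these values are finite positive measures in \<open>G\<close>.
\<close>

lemma polarization:
  fixes T :: "'k::complex_hilbert_space \<Rightarrow> 'k"
  assumes T: "bounded_clinear T"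
  defines "v \<equiv> \<lambda>n::nat. \<lambda>h k. scaleC (1/2) (h + scaleC (\<i> ^ n) k)"
  shows "cinner (T h) k = (\<Sum>n<4. \<i> ^ n * cinner (T (v n h k)) (v n h k))"
proof -
  have summand: "\<i> ^ n * cinner (T (v n h k)) (v n h k)
      = (1/4) * (\<i> ^ n * (cinner (T h) h + cinner (T k) k) + \<i> ^ n * \<i> ^ n * cinner (T k) h + cinner (T h) k)" for n
  proof -
    have "\<i> ^ n * cnj (\<i> ^ n) = 1"
      by (metis complex_norm_square norm_ii norm_power of_real_1 power_one)
    then have 1: "\<i> ^ n * (cnj (\<i> ^ n) * z) = z" "cnj (\<i> ^ n) * (\<i> ^ n * z) = z" for z
      by (metis mult.assoc mult_1 mult.commute)+
    have "cinner (T (v n h k)) (v n h k)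
        = (1/4) * (cinner (T h) h + cnj (\<i> ^ n) * cinner (T h) k
          + \<i> ^ n * cinner (T k) h + \<i> ^ n * (cnj (\<i> ^ n) * cinner (T k) k))"
      unfolding v_def bounded_clinear_scaleC[OF T] bounded_clinear_add[OF T] cinner_scaleC_left cinner_scaleC_right
        cinner_add_left cinner_add_right
      by (simp only: complex_cnj_divide complex_cnj_one complex_cnj_numeral) (simp add: distrib_left)
    then show ?thesis unfolding 1
      by (simp only: distrib_left mult.left_commute[of "\<i> ^ n" "1/4"] 1 mult.assoc) (simp only: add_ac)
  qed
  have "(\<Sum>n<4. \<i> ^ n * cinner (T (v n h k)) (v n h k)) = cinner (T h) k"
    unfolding summand by (simp add: eval_nat_numeral algebra_simps)
  then show ?thesis ..
qed

context projection_valued_measure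
begin

lemma Q_cinner: "G \<in> sets X \<Longrightarrow> cinner (Q G h) k = cinner h (Q G k)"
  using cinner_cadjoint[OF bounded] self_adjoint by metis

lemma Q_cinner_self:
  assumes "G \<in> sets X" shows "cinner (Q G v) v = complex_of_real ((norm (Q G v))\<^sup>2)"
proof -
  have "cinner (Q G v) v = cinner (Q G (Q G v)) v"
    using fun_cong[OF idempotent[OF assms], of v] by simp
  also have "\<dots> = cinner (Q G v) (Q G v)" by (rule Q_cinner[OF assms])
  finally show ?thesis by (simp only: cinner_self)
qed

lemma Q_empty: "Q {} h = 0"
proof (rule cinner_ext_left)
  fix k
  have "(\<lambda>n::nat. cinner (Q {} h) k) sums cinner (Q (\<Union>n::nat. {}) h) k"
    by (rule weakly_countably_additive) (auto simp: disjoint_family_on_def)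
  then have "summable (\<lambda>n::nat. cinner (Q {} h) k)" by (rule sums_summable)
  then show "cinner (Q {} h) k = cinner 0 k" by (simp add: summable_const_iff)
qed

text \<open>The measure \<open>Q\<^sub>v\<^sub>,\<^sub>v\<close>. Its values \<open>\<langle>Q G v, v\<rangle> = \<parallel>Q G v\<parallel>\<^sup>2\<close> are written in the form that is visibly positive.\<close>

definition vector_measure :: "'k \<Rightarrow> 'x measure" where
  "vector_measure v = measure_of (space X) (sets X) (\<lambda>G. ennreal ((norm (Q G v))\<^sup>2))"

lemma sets_vector_measure: "sets (vector_measure v) = sets X"
  by (simp add: vector_measure_def sets.space_closed sets.sigma_sets_eq)

lemma space_vector_measure: "space (vector_measure v) = space X"
  by (rule sets_eq_imp_space_eq[OF sets_vector_measure])

lemma emeasure_vector_measure: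
  assumes "G \<in> sets X"
  shows "emeasure (vector_measure v) G = ennreal ((norm (Q G v))\<^sup>2)"
proof (rule emeasure_measure_of[OF vector_measure_def sets.space_closed])
  show "positive (sets (vector_measure v)) (\<lambda>G. ennreal ((norm (Q G v))\<^sup>2))"
    by (simp add: positive_def Q_empty)
  show "countably_additive (sets (vector_measure v)) (\<lambda>G. ennreal ((norm (Q G v))\<^sup>2))"
  proof (rule countably_additiveI)
    fix B :: "nat \<Rightarrow> 'x set"
    assume B: "range B \<subseteq> sets (vector_measure v)" "disjoint_family B" "(\<Union>i. B i) \<in> sets (vector_measure v)"
    have s: "B i \<in> sets X" "(\<Union>i. B i) \<in> sets X" for i using B by (auto simp: sets_vector_measure)
    have "(\<lambda>n. cinner (Q (B n) v) v) sums cinner (Q (\<Union>n. B n) v) v"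
      using B by (intro weakly_countably_additive) (simp_all add: sets_vector_measure)
    then have "(\<lambda>n. (norm (Q (B n) v))\<^sup>2) sums (norm (Q (\<Union>n. B n) v))\<^sup>2"
      unfolding Q_cinner_self[OF s(1)] Q_cinner_self[OF s(2)] by (simp only: sums_of_real_iff)
    then have "(\<lambda>n. ennreal ((norm (Q (B n) v))\<^sup>2)) sums ennreal ((norm (Q (\<Union>n. B n) v))\<^sup>2)" by simp
    then show "(\<Sum>i. ennreal ((norm (Q (B i) v))\<^sup>2)) = ennreal ((norm (Q (\<Union>i. B i) v))\<^sup>2)"
      by (rule sums_unique[symmetric])
  qed
  show "G \<in> sets (vector_measure v)" using assms by (simp add: sets_vector_measure)
qed

lemma measure_vector_measure:
  "G \<in> sets X \<Longrightarrow> measure (vector_measure v) G = (norm (Q G v))\<^sup>2"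
  by (simp add: measure_def emeasure_vector_measure)

lemma finite_vector_measure: "finite_measure (vector_measure v)"
  by (rule finite_measureI) (simp add: space_vector_measure emeasure_vector_measure)

definition polar_measure :: "'k \<Rightarrow> 'k \<Rightarrow> nat \<Rightarrow> 'x measure" where
  "polar_measure h k n = vector_measure (scaleC (1/2) (h + scaleC (\<i> ^ n) k))"

lemma jordan_polar: "jordan_family X (polar_measure h k)"
  by (rule jordan_family.intro) (simp_all add: polar_measure_def finite_vector_measure sets_vector_measure)

lemma polar_measure_eq:
  assumes "G \<in> sets X"
  shows "cinner (Q G h) k = (\<Sum>n<4. \<i> ^ n * complex_of_real (measure (polar_measure h k n) G))"
  unfolding polar_measure_def measure_vector_measure[OF assms] Q_cinner_self[OF assms, symmetric]
  by (rule polarization[OF bounded[OF assms]])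

text \<open>The integral of \<open>f\<close> with respect to the complex measure \<open>Q\<^sub>h\<^sub>,\<^sub>k\<close>.\<close>

definition pvm_form :: "('x \<Rightarrow> complex) \<Rightarrow> 'k \<Rightarrow> 'k \<Rightarrow> complex" where
  "pvm_form f h k = jordan_integral (polar_measure h k) f"

lemma complex_measure_integral_pvm:
  assumes "bounded_measurable X f"
  shows "complex_measure_integral X (\<lambda>G. cinner (Q G h) k) f = pvm_form f h k"
  unfolding pvm_form_def by (rule complex_measure_integral_eq[OF jordan_polar polar_measure_eq assms])

lemma pvm_form_indicator: "G \<in> sets X \<Longrightarrow> pvm_form (indicator G) h k = cinner (Q G h) k"
  by (simp only: pvm_form_def jordan_family.jordan_integral_indicator[OF jordan_polar] polar_measure_eq)

lemma pvm_form_lincomb: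
  "bounded_measurable X f \<Longrightarrow> bounded_measurable X g \<Longrightarrow>
    pvm_form (\<lambda>x. c * f x + g x) h k = c * pvm_form f h k + pvm_form g h k"
  unfolding pvm_form_def by (rule jordan_family.jordan_integral_lincomb[OF jordan_polar])

lemma pvm_form_limit:
  assumes "\<And>n. bounded_measurable X (u n)" "bounded_measurable X f"
    and "\<And>n x. x \<in> space X \<Longrightarrow> cmod (u n x) \<le> c" "\<And>x. x \<in> space X \<Longrightarrow> (\<lambda>n. u n x) \<longlonglongrightarrow> f x"
  shows "(\<lambda>n. pvm_form (u n) h k) \<longlonglongrightarrow> pvm_form f h k"
  unfolding pvm_form_def by (rule jordan_family.jordan_integral_limit[OF jordan_polar assms])

lemma Q_space: "Q (space X) v = v"
  by (simp add: space)

text \<open>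
  Estimating the four terms of the polarization separately costs a factor 4 compared with the optimal
  bound \<open>\<parallel>Q(f)\<parallel> \<le> sup \<bar>f\<bar>\<close>. Only uniformity in \<open>f\<close> matters in what follows.
\<close>

lemma pvm_form_bound:
  assumes f: "bounded_measurable X f" and s: "\<And>x. x \<in> space X \<Longrightarrow> cmod (f x) \<le> s" "0 \<le> s"
    and hk: "norm h \<le> 1" "norm k \<le> 1"
  shows "cmod (pvm_form f h k) \<le> 4 * s"
proof -
  have "cmod (\<i> ^ n * (\<integral>x. f x \<partial>polar_measure h k n)) \<le> s" for n
  proof -
    define v where "v = scaleC (1/2) (h + scaleC (\<i> ^ n) k)"
    have "norm v = (1/2) * norm (h + scaleC (\<i> ^ n) k)"
      by (simp add: v_def norm_scaleC)
    also have "\<dots> \<le> (1/2) * (norm h + norm (scaleC (\<i> ^ n) k))"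
      by (intro mult_left_mono norm_triangle_ineq) simp
    also have "\<dots> \<le> 1" using hk by (simp add: norm_scaleC norm_power)
    finally have v: "(norm v)\<^sup>2 \<le> 1" by (simp add: power_le_one)
    have "cmod (\<integral>x. f x \<partial>vector_measure v) \<le> s * measure (vector_measure v) (space (vector_measure v))"
      using s(1) bounded_measurable_measurable[OF f]
      by (intro finite_measure.cmod_integral_le[OF finite_vector_measure])
        (simp_all add: space_vector_measure measurable_cong_sets[OF sets_vector_measure refl])
    also have "\<dots> = s * (norm v)\<^sup>2"
      by (simp add: space_vector_measure measure_vector_measure Q_space)
    also have "\<dots> \<le> s * 1" by (intro mult_left_mono v s(2))
    finally show ?thesis by (simp add: norm_mult norm_power polar_measure_def v_def)
  qed
  then have "cmod (pvm_form f h k) \<le> (\<Sum>n<4::nat. s)"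
    unfolding pvm_form_def jordan_integral_def by (intro sum_norm_le)
  then show ?thesis by simp
qed

text \<open>
  Polarization does not exhibit the form as sesquilinear in \<open>h\<close> and \<open>k\<close>. For indicator functions
  it is \<open>\<langle>Q G h, k\<rangle>\<close>, and sesquilinearity is inherited by linear combinations and limits of \<open>f\<close>.
\<close>

lemma pvm_form_sesquilinear:
  assumes "bounded_measurable X f"
  shows "(\<forall>x y k. pvm_form f (x + y) k = pvm_form f x k + pvm_form f y k) \<and>
    (\<forall>c x k. pvm_form f (scaleC c x) k = c * pvm_form f x k) \<and>
    (\<forall>h x y. pvm_form f h (x + y) = pvm_form f h x + pvm_form f h y) \<and>
    (\<forall>c h x. pvm_form f h (scaleC c x) = cnj c * pvm_form f h x)" (is "?S f")
  using assms
proof (induction f rule: bounded_measurable_induct_sets)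
  case (indicator A)
  note b = bounded[OF indicator]
  show ?case
    by (simp add: pvm_form_indicator[OF indicator] bounded_clinear_add[OF b] bounded_clinear_scaleC[OF b]
        cinner_add_left cinner_add_right cinner_scaleC_left cinner_scaleC_right)
next
  case (lincomb c f g)
  note lin = pvm_form_lincomb[OF lincomb(1,2)]
  from lincomb(3,4) show ?case
    unfolding lin by (simp add: distrib_left add_ac mult.left_commute)
next
  case (limit u f c)
  have lim: "(\<lambda>n. pvm_form (u n) h k) \<longlonglongrightarrow> pvm_form f h k" for h k
    by (rule pvm_form_limit[OF limit.hyps(1,3,2,4)])
  have IH: "pvm_form (u n) (x + y) k = pvm_form (u n) x k + pvm_form (u n) y k"
      "pvm_form (u n) (scaleC c x) k = c * pvm_form (u n) x k"
      "pvm_form (u n) h (x + y) = pvm_form (u n) h x + pvm_form (u n) h y"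
      "pvm_form (u n) h (scaleC c x) = cnj c * pvm_form (u n) h x" for n x y h k c
    using limit.IH[of n] by blast+
  have "pvm_form f (x + y) k = pvm_form f x k + pvm_form f y k" for x y k
    by (rule LIMSEQ_unique[OF lim]) (simp only: IH tendsto_add[OF lim lim])
  moreover have "pvm_form f (scaleC c x) k = c * pvm_form f x k" for c x k
    by (rule LIMSEQ_unique[OF lim]) (simp only: IH tendsto_mult[OF tendsto_const lim])
  moreover have "pvm_form f h (x + y) = pvm_form f h x + pvm_form f h y" for h x y
    by (rule LIMSEQ_unique[OF lim]) (simp only: IH tendsto_add[OF lim lim])
  moreover have "pvm_form f h (scaleC c x) = cnj c * pvm_form f h x" for c h x
    by (rule LIMSEQ_unique[OF lim]) (simp only: IH tendsto_mult[OF tendsto_const lim])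
  ultimately show ?case by blast
qed

lemma pvm_integral:
  assumes f: "bounded_measurable X f"
  shows bounded_clinear_pvm_integral: "bounded_clinear (pvm_integral X Q f)"
    and cinner_pvm_integral: "cinner (pvm_integral X Q f h) k = pvm_form f h k"
    and norm_pvm_integral_le:
      "(\<And>x. x \<in> space X \<Longrightarrow> cmod (f x) \<le> s) \<Longrightarrow> 0 \<le> s \<Longrightarrow> norm (pvm_integral X Q f h) \<le> 4 * s * norm h"
proof -
  note ses = pvm_form_sesquilinear[OF f]
  have op: "\<exists>T. bounded_clinear T \<and> (\<forall>h k. cinner (T h) k = pvm_form f h k) \<and> (\<forall>h. norm (T h) \<le> 4 * s * norm h)"
    if s: "\<And>x. x \<in> space X \<Longrightarrow> cmod (f x) \<le> s" "0 \<le> s" for s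
  proof -
    obtain T where "bounded_clinear T" "\<And>h k. cinner (T h) k = pvm_form f h k" "\<And>h. norm (T h) \<le> 4 * s * norm h"
    proof (rule sesquilinear_form_operator[of "pvm_form f" "4 * s"])
      show "cmod (pvm_form f h k) \<le> 4 * s" if "norm h \<le> 1" "norm k \<le> 1" for h k
        by (rule pvm_form_bound[OF f s that])
    qed (simp_all add: ses)
    then show ?thesis by blast
  qed
  have unique: "pvm_integral X Q f = T"
    if T: "bounded_clinear T" "\<And>h k. cinner (T h) k = pvm_form f h k" for T
    unfolding pvm_integral_def complex_measure_integral_pvm[OF f]
  proof (rule the_equality)
    fix S assume "bounded_clinear S \<and> (\<forall>h k. cinner (S h) k = pvm_form f h k)"
    then have "cinner (S h) k = cinner (T h) k" for h k by (simp only: T)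
    then show "S = T" by (intro ext cinner_ext_left)
  qed (use T in blast)
  obtain s0 where s0: "0 \<le> s0" "\<And>x. x \<in> space X \<Longrightarrow> cmod (f x) \<le> s0"
    using bounded_measurable_boundE[OF f] by blast
  from op[OF s0(2,1)] obtain T where T: "bounded_clinear T" "\<And>h k. cinner (T h) k = pvm_form f h k" by blast
  from unique[OF T] T show "bounded_clinear (pvm_integral X Q f)" "cinner (pvm_integral X Q f h) k = pvm_form f h k"
    by simp_all
  show "norm (pvm_integral X Q f h) \<le> 4 * s * norm h"
    if s: "\<And>x. x \<in> space X \<Longrightarrow> cmod (f x) \<le> s" "0 \<le> s" for s
  proof -
    from op[OF s] obtain T where T: "bounded_clinear T" "\<And>h k. cinner (T h) k = pvm_form f h k"
      "\<And>h. norm (T h) \<le> 4 * s * norm h" by blast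
    from unique[OF T(1,2)] T(3) show ?thesis by simp
  qed
qed

lemma pvm_integral_lincomb:
  assumes "bounded_measurable X f" "bounded_measurable X g"
  shows "pvm_integral X Q (\<lambda>x. c * f x + g x) h = scaleC c (pvm_integral X Q f h) + pvm_integral X Q g h"
  by (rule cinner_ext_left)
    (simp only: cinner_add_left cinner_scaleC_left cinner_pvm_integral[OF assms(1)] cinner_pvm_integral[OF assms(2)]
      cinner_pvm_integral[OF bounded_measurable_lincomb[OF assms]] pvm_form_lincomb[OF assms])

lemma pvm_integral_indicator: "G \<in> sets X \<Longrightarrow> pvm_integral X Q (indicator G) h = Q G h"
  by (rule cinner_ext_left) (simp only: cinner_pvm_integral[OF bounded_measurable_indicator] pvm_form_indicator)

lemma pvm_integral_limit:
  assumes "\<And>n. bounded_measurable X (u n)" "bounded_measurable X f"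
    and "\<And>n x. x \<in> space X \<Longrightarrow> cmod (u n x) \<le> c" "\<And>x. x \<in> space X \<Longrightarrow> (\<lambda>n. u n x) \<longlonglongrightarrow> f x"
  shows "(\<lambda>n. cinner (pvm_integral X Q (u n) h) k) \<longlonglongrightarrow> cinner (pvm_integral X Q f h) k"
  unfolding cinner_pvm_integral[OF assms(1)] cinner_pvm_integral[OF assms(2)]
  by (rule pvm_form_limit[OF assms])

end

section \<open>Traces of Pettis integrals\<close>

text \<open>Test the trace norm bound with the rank one contraction \<open>U = \<langle>\<cdot>, e\<rangle> f\<close> for unit vectors \<open>e\<close>, \<open>f\<close>.\<close>

lemma trace_norm_bound_norm_le:
  fixes T :: "'k::complex_hilbert_space \<Rightarrow> 'k"
  assumes T: "trace_norm_bound T c"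
  shows "norm (T h) \<le> c * norm h"
proof (cases "h = 0 \<or> T h = 0")
  case True
  then show ?thesis
    using bounded_clinear_zero[OF trace_norm_bound_bounded[OF T]] trace_norm_bound_nonneg[OF T] by auto
next
  case False
  have bT: "bounded_clinear T" by (rule trace_norm_bound_bounded[OF T])
  define e where "e = scaleC (1 / norm h) h"
  define f where "f = scaleC (1 / norm (T h)) (T h)"
  define U where "U = (\<lambda>x. scaleC (cinner x e) f)"
  have n: "norm e = 1" "norm f = 1" using False by (simp_all add: e_def f_def norm_scaleC norm_divide)
  have ee: "cinner e e = 1" by (simp add: cinner_self n)
  have nU: "norm (U x) \<le> 1 * norm x" for x
    using norm_cinner_le[of x e] by (simp add: U_def norm_scaleC n)
  have bU: "bounded_clinear U"
    by (rule bounded_clinearI[OF _ _ nU])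
      (simp_all add: U_def cinner_add_left scaleC_add_left cinner_scaleC_left scaleC_scaleC)
  have "cmod (\<Sum>x\<in>{e}. cinner (T x) (U x)) \<le> c"
    using nU by (intro trace_norm_boundD[OF T _ _ bU]) (simp_all add: orthonormal_def ee)
  then have "cmod (cinner (T e) f) \<le> c" by (simp add: U_def ee)
  moreover have "cinner (T e) f = norm (T h) / norm h"
    unfolding e_def f_def bounded_clinear_scaleC[OF bT] cinner_scaleC_left cinner_scaleC_right cinner_self
    using False by (simp add: power2_eq_square)
  ultimately have "norm (T h) / norm h \<le> c" by (simp add: norm_divide)
  then show ?thesis using False by (simp add: divide_le_eq)
qed

lemma cmod_infsum_diagonal_le:
  assumes T: "trace_norm_bound T c" and E: "orthonormal E"
  shows "cmod (\<Sum>\<^sub>\<infinity>e\<in>E. cinner (T e) e) \<le> c"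
proof -
  have "((\<lambda>e. cinner (T e) e) has_sum (\<Sum>\<^sub>\<infinity>e\<in>E. cinner (T e) e)) E"
    by (rule has_sum_infsum, rule abs_summable_summable, rule trace_norm_bound_abs_summable[OF T E])
  then have "(sum (\<lambda>e. cinner (T e) e) \<longlongrightarrow> (\<Sum>\<^sub>\<infinity>e\<in>E. cinner (T e) e)) (finite_subsets_at_top E)"
    by (simp only: has_sum_def)
  then have "((\<lambda>F. cmod (\<Sum>e\<in>F. cinner (T e) e)) \<longlongrightarrow> cmod (\<Sum>\<^sub>\<infinity>e\<in>E. cinner (T e) e)) (finite_subsets_at_top E)"
    by (rule tendsto_norm)
  then show ?thesis
  proof (rule tendsto_upperbound)
    show "\<forall>\<^sub>F F in finite_subsets_at_top E. cmod (\<Sum>e\<in>F. cinner (T e) e) \<le> c"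
      by (rule eventually_finite_subsets_at_top_weakI)
        (rule trace_norm_bound_trace[OF T _ orthonormal_subset[OF E]])
  qed simp
qed

text \<open>
  Passes from the net of all finite partial sums to a sequence, because dominated convergence holds
  for sequences but not for nets.
\<close>

lemma has_sum_tendsto_enumeration:
  assumes E: "countable E" and f: "(f has_sum s) E"
  defines "G \<equiv> \<lambda>m. {e \<in> E. to_nat_on E e < m}"
  shows "finite (G m)" "G m \<subseteq> E" "(\<lambda>m. sum f (G m)) \<longlonglongrightarrow> s"
proof -
  show fin: "finite (G m)" for m
    by (rule inj_on_finite[of "to_nat_on E" _ "{..<m}"])
      (auto simp: G_def intro: inj_on_subset[OF inj_on_to_nat_on[OF E]])
  show sub: "G m \<subseteq> E" for m by (auto simp: G_def)
  have "filterlim G (finite_subsets_at_top E) sequentially"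
    unfolding filterlim_finite_subsets_at_top
  proof (intro allI impI, elim conjE)
    fix F assume F: "finite F" "F \<subseteq> E"
    obtain N where N: "\<forall>n\<in>to_nat_on E ` F. n < N"
      using finite_nat_set_iff_bounded[of "to_nat_on E ` F"] F(1) by blast
    show "\<forall>\<^sub>F m in sequentially. finite (G m) \<and> F \<subseteq> G m \<and> G m \<subseteq> E"
      using eventually_ge_at_top[of N]
    proof eventually_elim
      case (elim m)
      then show ?case using fin sub F(2) N by (fastforce simp: G_def)
    qed
  qed
  then show "(\<lambda>m. sum f (G m)) \<longlonglongrightarrow> s"
    by (rule filterlim_compose[OF f[unfolded has_sum_def]])
qed

locale trace_bounded_family = finite_measure S for S :: "'s measure" +
  fixes F :: "'s \<Rightarrow> 'k::complex_hilbert_space \<Rightarrow> 'k" and C :: real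
  assumes weakly_measurable: "pointwise_weakly_measurable S F"
    and trace_bound: "\<sigma> \<in> space S \<Longrightarrow> trace_norm_bound (F \<sigma>) C"
    and C_nonneg: "0 \<le> C"
begin

lemma measurable_form: "(\<lambda>\<sigma>. cinner (F \<sigma> h) k) \<in> borel_measurable S"
  using weakly_measurable by (simp add: pointwise_weakly_measurable_def)

lemma form_le:
  assumes "\<sigma> \<in> space S" shows "cmod (cinner (F \<sigma> h) k) \<le> C * norm h * norm k"
proof -
  have "cmod (cinner (F \<sigma> h) k) \<le> norm (F \<sigma> h) * norm k" by (rule norm_cinner_le)
  also have "\<dots> \<le> (C * norm h) * norm k"
    by (rule mult_right_mono[OF trace_norm_bound_norm_le[OF trace_bound[OF assms]] norm_ge_zero])
  finally show ?thesis .
qed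

lemma integrable_form: "integrable S (\<lambda>\<sigma>. cinner (F \<sigma> h) k)"
  by (rule bounded_measurable_integrable[OF bounded_measurableI[OF measurable_form form_le]])

lemma Pettis_integrable: "pointwise_Pettis_integrable S F"
  unfolding pointwise_Pettis_integrable_def
  using weakly_measurable integrable_form by (simp add: integrable_iff_bounded)

lemma Pettis_integral:
  shows bounded_clinear_Pettis: "bounded_clinear (pointwise_Pettis_integral S F)"
    and cinner_Pettis: "cinner (pointwise_Pettis_integral S F h) k = (\<integral>\<sigma>. cinner (F \<sigma> h) k \<partial>S)"
proof -
  have bF: "bounded_clinear (F \<sigma>)" if "\<sigma> \<in> space S" for \<sigma>
    by (rule trace_norm_bound_bounded[OF trace_bound[OF that]])
  let ?I = "\<lambda>h k. \<integral>\<sigma>. cinner (F \<sigma> h) k \<partial>S"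
  obtain T where T: "bounded_clinear T" "\<And>h k. cinner (T h) k = ?I h k"
  proof (rule sesquilinear_form_operator[of ?I "C * measure S (space S)"])
    show "?I (x + y) k = ?I x k + ?I y k" for x y k
      unfolding Bochner_Integration.integral_add[OF integrable_form integrable_form, symmetric]
      by (intro Bochner_Integration.integral_cong refl) (simp add: bounded_clinear_add[OF bF] cinner_add_left)
    show "?I h (x + y) = ?I h x + ?I h y" for h x y
      unfolding Bochner_Integration.integral_add[OF integrable_form integrable_form, symmetric]
      by (intro Bochner_Integration.integral_cong refl) (simp add: cinner_add_right)
    show "?I (scaleC c x) k = c * ?I x k" for c x k
      unfolding integral_mult_right_zero[symmetric]
      by (intro Bochner_Integration.integral_cong refl) (simp add: bounded_clinear_scaleC[OF bF] cinner_scaleC_left)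
    show "?I h (scaleC c x) = cnj c * ?I h x" for c h x
      unfolding integral_mult_right_zero[symmetric]
      by (intro Bochner_Integration.integral_cong refl) (simp add: cinner_scaleC_right)
    show "cmod (?I h k) \<le> C * measure S (space S)" if hk: "norm h \<le> 1" "norm k \<le> 1" for h k
    proof (rule cmod_integral_le[OF measurable_form])
      fix \<sigma> assume "\<sigma> \<in> space S"
      then have "cmod (cinner (F \<sigma> h) k) \<le> C * norm h * norm k" by (rule form_le)
      also have "\<dots> \<le> C * 1 * 1" by (intro mult_mono hk C_nonneg mult_nonneg_nonneg) (auto simp: C_nonneg)
      finally show "cmod (cinner (F \<sigma> h) k) \<le> C" by simp
    qed
  qed blast
  have "pointwise_Pettis_integral S F = T"
    unfolding pointwise_Pettis_integral_def
  proof (rule the_equality)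
    fix R assume "bounded_clinear R \<and> (\<forall>h k. cinner (R h) k = ?I h k)"
    then have "cinner (R h) k = cinner (T h) k" for h k by (simp only: T)
    then show "R = T" by (intro ext cinner_ext_left)
  qed (use T in blast)
  with T show "bounded_clinear (pointwise_Pettis_integral S F)"
    "cinner (pointwise_Pettis_integral S F h) k = ?I h k" by simp_all
qed

lemma trace_norm_bound_Pettis:
  "trace_norm_bound (pointwise_Pettis_integral S F) (C * measure S (space S))"
proof (rule trace_norm_boundI[OF bounded_clinear_Pettis])
  fix E :: "'k set" and U :: "'k \<Rightarrow> 'k"
  assume E: "finite E" "orthonormal E" and U: "bounded_clinear U" "\<And>x. norm (U x) \<le> norm x"
  have "(\<Sum>e\<in>E. cinner (pointwise_Pettis_integral S F e) (U e)) = (\<integral>\<sigma>. (\<Sum>e\<in>E. cinner (F \<sigma> e) (U e)) \<partial>S)"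
    unfolding cinner_Pettis by (rule Bochner_Integration.integral_sum[symmetric, OF integrable_form])
  also have "cmod \<dots> \<le> C * measure S (space S)"
    by (rule cmod_integral_le) (auto intro!: borel_measurable_sum measurable_form trace_norm_boundD[OF trace_bound E U])
  finally show "cmod (\<Sum>e\<in>E. cinner (pointwise_Pettis_integral S F e) (U e)) \<le> C * measure S (space S)" .
qed

lemma trace_class_Pettis: "trace_class (pointwise_Pettis_integral S F)"
  by (rule trace_norm_bound_trace_class[OF trace_norm_bound_Pettis])

lemma op_trace_Pettis:
  "op_trace (pointwise_Pettis_integral S F) = (\<Sum>\<^sub>\<infinity>e\<in>some_onb. \<integral>\<sigma>. cinner (F \<sigma> e) e \<partial>S)"
  by (simp only: op_trace_def cinner_Pettis)

lemma summable_trace_Pettis: "(\<lambda>e. cmod (\<integral>\<sigma>. cinner (F \<sigma> e) e \<partial>S)) summable_on some_onb"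
  using trace_norm_bound_abs_summable[OF trace_norm_bound_Pettis orthonormal_some_onb] by (simp only: cinner_Pettis)

lemma countable_trace_support: "countable {e \<in> some_onb. (\<integral>\<sigma>. cinner (F \<sigma> e) e \<partial>S) \<noteq> 0}"
  by (rule abs_summable_countable[OF summable_trace_Pettis])

text \<open>
  Interchange of trace and integral. It is permitted over a countable part of the basis, where the
  partial traces are dominated by \<open>C\<close>; the assumption of the second claim says that this part already
  carries the trace of the integral.
\<close>

lemma
  assumes E: "countable E" "E \<subseteq> some_onb"
  shows measurable_partial_trace: "(\<lambda>\<sigma>. \<Sum>\<^sub>\<infinity>e\<in>E. cinner (F \<sigma> e) e) \<in> borel_measurable S"
    and op_trace_Pettis_countable:
      "(\<And>e. e \<in> some_onb \<Longrightarrow> e \<notin> E \<Longrightarrow> (\<integral>\<sigma>. cinner (F \<sigma> e) e \<partial>S) = 0) \<Longrightarrow>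
       op_trace (pointwise_Pettis_integral S F) = (\<integral>\<sigma>. (\<Sum>\<^sub>\<infinity>e\<in>E. cinner (F \<sigma> e) e) \<partial>S)"
proof -
  define G where "G = (\<lambda>m. {e \<in> E. to_nat_on E e < m})"
  have on: "orthonormal E" by (rule orthonormal_subset[OF orthonormal_some_onb E(2)])
  have G: "finite (G m)" "orthonormal (G m)" for m
  proof -
    have "((\<lambda>_. 0::real) has_sum 0) E" by simp
    from has_sum_tendsto_enumeration(1,2)[OF E(1) this] show "finite (G m)" "orthonormal (G m)"
      unfolding G_def by (blast intro: orthonormal_subset[OF on])+
  qed
  have conv: "(\<lambda>m. \<Sum>e\<in>G m. cinner (F \<sigma> e) e) \<longlonglongrightarrow> (\<Sum>\<^sub>\<infinity>e\<in>E. cinner (F \<sigma> e) e)" if "\<sigma> \<in> space S" for \<sigma>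
    unfolding G_def
    by (rule has_sum_tendsto_enumeration(3)[OF E(1) has_sum_infsum])
      (rule abs_summable_summable, rule trace_norm_bound_abs_summable[OF trace_bound[OF that] on])
  have meas: "(\<lambda>\<sigma>. \<Sum>e\<in>G m. cinner (F \<sigma> e) e) \<in> borel_measurable S" for m
    by (intro borel_measurable_sum measurable_form)
  show lim: "(\<lambda>\<sigma>. \<Sum>\<^sub>\<infinity>e\<in>E. cinner (F \<sigma> e) e) \<in> borel_measurable S"
    by (rule borel_measurable_LIMSEQ_metric[OF meas conv])
  assume zero: "\<And>e. e \<in> some_onb \<Longrightarrow> e \<notin> E \<Longrightarrow> (\<integral>\<sigma>. cinner (F \<sigma> e) e \<partial>S) = 0"
  have inside: "(\<lambda>m. \<integral>\<sigma>. (\<Sum>e\<in>G m. cinner (F \<sigma> e) e) \<partial>S) \<longlonglongrightarrow> (\<integral>\<sigma>. (\<Sum>\<^sub>\<infinity>e\<in>E. cinner (F \<sigma> e) e) \<partial>S)"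
  proof (rule bounded_convergence[OF meas lim])
    show "cmod (\<Sum>e\<in>G m. cinner (F \<sigma> e) e) \<le> C" if "\<sigma> \<in> space S" for m \<sigma>
      by (rule trace_norm_bound_trace[OF trace_bound[OF that] G])
  qed (rule conv)
  have swap: "(\<integral>\<sigma>. (\<Sum>e\<in>G m. cinner (F \<sigma> e) e) \<partial>S) = (\<Sum>e\<in>G m. \<integral>\<sigma>. cinner (F \<sigma> e) e \<partial>S)" for m
    by (rule Bochner_Integration.integral_sum[OF integrable_form])
  have "(\<lambda>m. \<Sum>e\<in>G m. \<integral>\<sigma>. cinner (F \<sigma> e) e \<partial>S) \<longlonglongrightarrow> (\<Sum>\<^sub>\<infinity>e\<in>E. \<integral>\<sigma>. cinner (F \<sigma> e) e \<partial>S)"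
    unfolding G_def
    by (rule has_sum_tendsto_enumeration(3)[OF E(1) has_sum_infsum])
      (rule summable_on_subset_banach[OF abs_summable_summable[OF summable_trace_Pettis] E(2)])
  from LIMSEQ_unique[OF inside[unfolded swap] this]
  have "(\<integral>\<sigma>. (\<Sum>\<^sub>\<infinity>e\<in>E. cinner (F \<sigma> e) e) \<partial>S) = (\<Sum>\<^sub>\<infinity>e\<in>E. \<integral>\<sigma>. cinner (F \<sigma> e) e \<partial>S)" .
  also have "\<dots> = (\<Sum>\<^sub>\<infinity>e\<in>some_onb. \<integral>\<sigma>. cinner (F \<sigma> e) e \<partial>S)"
  proof (rule infsum_cong_neutral)
    show "(\<integral>\<sigma>. cinner (F \<sigma> e) e \<partial>S) = 0" if "e \<in> some_onb - E" for e using that zero by simp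
  qed (use E(2) in blast)+
  finally show "op_trace (pointwise_Pettis_integral S F) = (\<integral>\<sigma>. (\<Sum>\<^sub>\<infinity>e\<in>E. cinner (F \<sigma> e) e) \<partial>S)"
    by (simp only: op_trace_Pettis)
qed

end

text \<open>
  Only countably many basis vectors contribute to the traces of the countably many integrals in
  question. Over this set \<open>E\<close> all traces are integrals of partial traces, and bounded convergence
  applies. The set is not known in advance and may change with the sequence, so the convergence of
  the integrands is required for every orthonormal set.
\<close>

lemma op_trace_Pettis_limit:
  fixes F :: "nat \<Rightarrow> 's \<Rightarrow> 'k::complex_hilbert_space \<Rightarrow> 'k"
  assumes F: "\<And>n. trace_bounded_family S (F n) C" and F0: "trace_bounded_family S F0 C"
    and conv: "\<And>\<sigma> E. \<sigma> \<in> space S \<Longrightarrow> orthonormal E \<Longrightarrow>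
      (\<lambda>n. \<Sum>\<^sub>\<infinity>e\<in>E. cinner (F n \<sigma> e) e) \<longlonglongrightarrow> (\<Sum>\<^sub>\<infinity>e\<in>E. cinner (F0 \<sigma> e) e)"
  shows "(\<lambda>n. op_trace (pointwise_Pettis_integral S (F n))) \<longlonglongrightarrow> op_trace (pointwise_Pettis_integral S F0)"
proof -
  define supp where "supp = (\<lambda>H::'s \<Rightarrow> 'k \<Rightarrow> 'k. {e \<in> some_onb. (\<integral>\<sigma>. cinner (H \<sigma> e) e \<partial>S) \<noteq> 0})"
  define E where "E = supp F0 \<union> (\<Union>n. supp (F n))"
  have E: "countable E" "E \<subseteq> some_onb"
    unfolding E_def supp_def
    by (auto intro!: trace_bounded_family.countable_trace_support[OF F] trace_bounded_family.countable_trace_support[OF F0])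
  have on: "orthonormal E" by (rule orthonormal_subset[OF orthonormal_some_onb E(2)])
  have tr: "op_trace (pointwise_Pettis_integral S (F n)) = (\<integral>\<sigma>. (\<Sum>\<^sub>\<infinity>e\<in>E. cinner (F n \<sigma> e) e) \<partial>S)" for n
    by (rule trace_bounded_family.op_trace_Pettis_countable[OF F E]) (auto simp: E_def supp_def)
  have tr0: "op_trace (pointwise_Pettis_integral S F0) = (\<integral>\<sigma>. (\<Sum>\<^sub>\<infinity>e\<in>E. cinner (F0 \<sigma> e) e) \<partial>S)"
    by (rule trace_bounded_family.op_trace_Pettis_countable[OF F0 E]) (auto simp: E_def supp_def)
  have fin: "finite_measure S" using F0 by (simp add: trace_bounded_family_def)
  show ?thesis
    unfolding tr tr0
  proof (rule finite_measure.bounded_convergence[OF fin])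
    show "(\<lambda>\<sigma>. \<Sum>\<^sub>\<infinity>e\<in>E. cinner (F n \<sigma> e) e) \<in> borel_measurable S" for n
      by (rule trace_bounded_family.measurable_partial_trace[OF F E])
    show "(\<lambda>\<sigma>. \<Sum>\<^sub>\<infinity>e\<in>E. cinner (F0 \<sigma> e) e) \<in> borel_measurable S"
      by (rule trace_bounded_family.measurable_partial_trace[OF F0 E])
    show "cmod (\<Sum>\<^sub>\<infinity>e\<in>E. cinner (F n \<sigma> e) e) \<le> C" if "\<sigma> \<in> space S" for n \<sigma>
      by (rule cmod_infsum_diagonal_le[OF trace_bounded_family.trace_bound[OF F that] on])
  qed (rule conv[OF _ on])
qed

lemma op_trace_Pettis_lincomb:
  assumes F: "trace_bounded_family S F C" and G: "trace_bounded_family S G D" and H: "trace_bounded_family S H B"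
    and eq: "\<And>\<sigma> h. \<sigma> \<in> space S \<Longrightarrow> H \<sigma> h = scaleC c (F \<sigma> h) + G \<sigma> h"
  shows "op_trace (pointwise_Pettis_integral S H)
    = c * op_trace (pointwise_Pettis_integral S F) + op_trace (pointwise_Pettis_integral S G)"
proof -
  have "(\<integral>\<sigma>. cinner (H \<sigma> e) e \<partial>S) = c * (\<integral>\<sigma>. cinner (F \<sigma> e) e \<partial>S) + (\<integral>\<sigma>. cinner (G \<sigma> e) e \<partial>S)" for e
  proof -
    have "(\<integral>\<sigma>. cinner (H \<sigma> e) e \<partial>S) = (\<integral>\<sigma>. c * cinner (F \<sigma> e) e + cinner (G \<sigma> e) e \<partial>S)"
      by (intro Bochner_Integration.integral_cong refl) (simp add: eq cinner_add_left cinner_scaleC_left)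
    also have "\<dots> = (\<integral>\<sigma>. c * cinner (F \<sigma> e) e \<partial>S) + (\<integral>\<sigma>. cinner (G \<sigma> e) e \<partial>S)"
      by (intro Bochner_Integration.integral_add integrable_mult_right
          trace_bounded_family.integrable_form[OF F] trace_bounded_family.integrable_form[OF G])
    finally show ?thesis by simp
  qed
  then have "op_trace (pointwise_Pettis_integral S H)
      = (\<Sum>\<^sub>\<infinity>e\<in>some_onb. c * (\<integral>\<sigma>. cinner (F \<sigma> e) e \<partial>S) + (\<integral>\<sigma>. cinner (G \<sigma> e) e \<partial>S))"
    by (simp only: trace_bounded_family.op_trace_Pettis[OF H])
  also have "\<dots> = (\<Sum>\<^sub>\<infinity>e\<in>some_onb. c * (\<integral>\<sigma>. cinner (F \<sigma> e) e \<partial>S)) + (\<Sum>\<^sub>\<infinity>e\<in>some_onb. \<integral>\<sigma>. cinner (G \<sigma> e) e \<partial>S)"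
    by (rule infsum_add[OF summable_on_cmult_right
          [OF abs_summable_summable[OF trace_bounded_family.summable_trace_Pettis[OF F]]]
          abs_summable_summable[OF trace_bounded_family.summable_trace_Pettis[OF G]]])
  also have "\<dots> = c * op_trace (pointwise_Pettis_integral S F) + op_trace (pointwise_Pettis_integral S G)"
    by (simp only: infsum_cmult_right' trace_bounded_family.op_trace_Pettis[OF F] trace_bounded_family.op_trace_Pettis[OF G])
  finally show ?thesis .
qed

section \<open>Convergence of traces of products\<close>

lemma summable_small_tail:
  fixes f :: "'i \<Rightarrow> real"
  assumes f: "f summable_on A" and nonneg: "\<And>x. x \<in> A \<Longrightarrow> 0 \<le> f x" and e: "0 < e"
  obtains G where "finite G" "G \<subseteq> A" "\<And>H. finite H \<Longrightarrow> H \<subseteq> A - G \<Longrightarrow> sum f H \<le> e"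
proof -
  obtain G where G: "finite G" "G \<subseteq> A" "dist (sum f G) (infsum f A) \<le> e"
    using infsum_finite_approximation[OF f e] by blast
  have "sum f H \<le> e" if H: "finite H" "H \<subseteq> A - G" for H
  proof -
    have "sum f G + sum f H = sum f (G \<union> H)"
      using G(1) H by (intro sum.union_disjoint[symmetric]) auto
    also have "\<dots> \<le> infsum f A"
      using G H nonneg by (intro finite_sum_le_infsum[OF f]) auto
    also have "\<dots> \<le> sum f G + e"
      using G(3) by (simp add: dist_real_def abs_le_iff)
    finally show ?thesis by simp
  qed
  with G that show thesis by blast
qed

text \<open>
  The tails of the sums are controlled uniformly in \<open>n\<close>: by Cauchy-Schwarz a tail is at most \<open>sqrt b\<close>
  times the square root of the corresponding tail of \<open>\<Sum>\<^sub>e \<parallel>Y e\<parallel>\<^sup>2\<close>, which does not depend on \<open>n\<close>.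
\<close>

lemma hs_pairing_tendsto:
  fixes X :: "nat \<Rightarrow> 'k::complex_hilbert_space \<Rightarrow> 'k"
  assumes X: "\<And>n. hs_bound (X n) b" and X0: "hs_bound X0 b" and Y: "hs_bound Y d" and E: "orthonormal E"
    and conv: "\<And>e. e \<in> E \<Longrightarrow> (\<lambda>n. cinner (X n e) (Y e)) \<longlonglongrightarrow> cinner (X0 e) (Y e)"
  shows "(\<lambda>n. \<Sum>\<^sub>\<infinity>e\<in>E. cinner (X n e) (Y e)) \<longlonglongrightarrow> (\<Sum>\<^sub>\<infinity>e\<in>E. cinner (X0 e) (Y e))"
proof (rule LIMSEQ_I)
  fix r :: real assume r: "0 < r"
  have b: "0 \<le> b" by (rule hs_bound_nonneg[OF X0])
  \<comment> \<open>Chosen such that \<open>sqrt b * sqrt \<epsilon> \<le> r / 4\<close>, also for \<open>b = 0\<close>.\<close>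
  define \<epsilon> where "\<epsilon> = (r / (4 * (sqrt b + 1)))\<^sup>2"
  have t: "0 < sqrt b + 1" using b by (simp add: add_nonneg_pos)
  have \<epsilon>: "0 < \<epsilon>"
    unfolding \<epsilon>_def using r t by (intro zero_less_power divide_pos_pos mult_pos_pos) auto
  have small: "sqrt b * sqrt \<epsilon> \<le> r / 4"
  proof -
    have "sqrt \<epsilon> = r / (4 * (sqrt b + 1))"
      unfolding \<epsilon>_def using r t by (intro real_sqrt_unique) auto
    then have "sqrt b * sqrt \<epsilon> = (sqrt b / (sqrt b + 1)) * (r / 4)" by simp
    also have "\<dots> \<le> 1 * (r / 4)" using r t by (intro mult_right_mono) auto
    finally show ?thesis by simp
  qed
  obtain G where G: "finite G" "G \<subseteq> E" "\<And>H. finite H \<Longrightarrow> H \<subseteq> E - G \<Longrightarrow> (\<Sum>e\<in>H. (norm (Y e))\<^sup>2) \<le> \<epsilon>"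
    using summable_small_tail[OF hs_norm_square_summable[OF Y E] zero_le_power2 \<epsilon>] by blast
  have tail: "cmod ((\<Sum>\<^sub>\<infinity>e\<in>E. cinner (Z e) (Y e)) - (\<Sum>e\<in>G. cinner (Z e) (Y e))) \<le> r / 4"
    if Z: "hs_bound Z b" for Z
  proof -
    note abs = hs_cinner_abs_summable[OF Z Y E]
    note sm = abs_summable_summable[OF abs]
    have absD: "(\<lambda>e. cmod (cinner (Z e) (Y e))) summable_on (E - G)"
      by (rule summable_on_subset_banach[OF abs]) blast
    have "(\<Sum>\<^sub>\<infinity>e\<in>E. cinner (Z e) (Y e)) = (\<Sum>\<^sub>\<infinity>e\<in>G \<union> (E - G). cinner (Z e) (Y e))"
      using G(2) by (simp add: Un_absorb1)
    also have "\<dots> = (\<Sum>\<^sub>\<infinity>e\<in>G. cinner (Z e) (Y e)) + (\<Sum>\<^sub>\<infinity>e\<in>E - G. cinner (Z e) (Y e))"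
      using G(1) by (intro infsum_Un_disjoint summable_on_finite abs_summable_summable[OF absD]) auto
    finally have "(\<Sum>\<^sub>\<infinity>e\<in>E. cinner (Z e) (Y e)) - (\<Sum>e\<in>G. cinner (Z e) (Y e)) = (\<Sum>\<^sub>\<infinity>e\<in>E - G. cinner (Z e) (Y e))"
      using G(1) by simp
    also have "cmod \<dots> \<le> (\<Sum>\<^sub>\<infinity>e\<in>E - G. cmod (cinner (Z e) (Y e)))"
      by (rule norm_infsum_bound[OF absD])
    also have "\<dots> \<le> r / 4"
    proof (rule infsum_le_finite_sums[OF absD])
      fix H assume H: "finite H" "H \<subseteq> E - G"
      have onH: "orthonormal H" using H(2) by (intro orthonormal_subset[OF E]) blast
      have "(\<Sum>e\<in>H. cmod (cinner (Z e) (Y e))) \<le> sqrt (\<Sum>e\<in>H. (norm (Z e))\<^sup>2) * sqrt (\<Sum>e\<in>H. (norm (Y e))\<^sup>2)"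
        by (rule sum_cmod_cinner_le)
      also have "\<dots> \<le> sqrt b * sqrt \<epsilon>"
        by (intro mult_mono real_sqrt_le_mono hs_boundD[OF Z H(1) onH] G(3)[OF H] real_sqrt_ge_zero b sum_nonneg) simp
      also have "\<dots> \<le> r / 4" by (rule small)
      finally show "(\<Sum>e\<in>H. cmod (cinner (Z e) (Y e))) \<le> r / 4" .
    qed
    finally show ?thesis .
  qed
  have fin: "(\<lambda>n. \<Sum>e\<in>G. cinner (X n e) (Y e)) \<longlonglongrightarrow> (\<Sum>e\<in>G. cinner (X0 e) (Y e))"
    using G(2) by (intro tendsto_sum conv) blast
  have "\<exists>N. \<forall>n\<ge>N. cmod ((\<Sum>e\<in>G. cinner (X n e) (Y e)) - (\<Sum>e\<in>G. cinner (X0 e) (Y e))) < r / 4"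
    using r by (intro LIMSEQ_D[OF fin]) simp
  then obtain N where N: "\<And>n. n \<ge> N \<Longrightarrow> cmod ((\<Sum>e\<in>G. cinner (X n e) (Y e)) - (\<Sum>e\<in>G. cinner (X0 e) (Y e))) < r / 4"
    by blast
  show "\<exists>N. \<forall>n\<ge>N. cmod ((\<Sum>\<^sub>\<infinity>e\<in>E. cinner (X n e) (Y e)) - (\<Sum>\<^sub>\<infinity>e\<in>E. cinner (X0 e) (Y e))) < r"
  proof (intro exI[of _ N] allI impI)
    fix n assume n: "N \<le> n"
    define a a0 s s0 where "a = (\<Sum>\<^sub>\<infinity>e\<in>E. cinner (X n e) (Y e))" and "a0 = (\<Sum>\<^sub>\<infinity>e\<in>E. cinner (X0 e) (Y e))"
      and "s = (\<Sum>e\<in>G. cinner (X n e) (Y e))" and "s0 = (\<Sum>e\<in>G. cinner (X0 e) (Y e))"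
    have "cmod (a - a0) \<le> cmod (a - s) + cmod (s - s0) + cmod (a0 - s0)"
      using norm_triangle_ineq[of "a - s" "s - s0"] norm_triangle_ineq4[of "a - s0" "a0 - s0"] by simp
    also have "\<dots> < r"
      using tail[OF X[of n]] tail[OF X0] N[OF n] r unfolding a_def a0_def s_def s0_def by linarith
    finally show "cmod (a - a0) < r" .
  qed
qed

text \<open>
  For \<open>A = B D\<close> with Hilbert-Schmidt factors, \<open>\<langle>A W\<^sub>n e, e\<rangle> = \<langle>D W\<^sub>n e, B\<^sup>* e\<rangle>\<close> and
  \<open>\<langle>W\<^sub>n A e, e\<rangle>\<close> is the conjugate of \<open>\<langle>(W\<^sub>n B)\<^sup>* e, D e\<rangle>\<close>; in both pairings one side is fixed and the other
  is bounded in Hilbert-Schmidt norm.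
\<close>

lemma partial_trace_tendsto:
  fixes W :: "nat \<Rightarrow> 'k::complex_hilbert_space \<Rightarrow> 'k"
  assumes A: "trace_norm_bound A c" and W: "\<And>n. bounded_clinear (W n)" and W0: "bounded_clinear W0"
    and le: "\<And>n x. norm (W n x) \<le> w * norm x" and le0: "\<And>x. norm (W0 x) \<le> w * norm x" and w: "0 \<le> w"
    and conv: "\<And>h k. (\<lambda>n. cinner (W n h) k) \<longlonglongrightarrow> cinner (W0 h) k" and E: "orthonormal E"
  shows partial_trace_tendsto_right: "(\<lambda>n. \<Sum>\<^sub>\<infinity>e\<in>E. cinner (A (W n e)) e) \<longlonglongrightarrow> (\<Sum>\<^sub>\<infinity>e\<in>E. cinner (A (W0 e)) e)"
    and partial_trace_tendsto_left: "(\<lambda>n. \<Sum>\<^sub>\<infinity>e\<in>E. cinner (W n (A e)) e) \<longlonglongrightarrow> (\<Sum>\<^sub>\<infinity>e\<in>E. cinner (W0 (A e)) e)"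
proof -
  obtain B D where BD: "hs_bound B c" "hs_bound D c" "A = B \<circ> D"
    by (rule trace_norm_bound_hs_factors[OF A])
  have bB: "bounded_clinear B" and bD: "bounded_clinear D"
    using BD by (auto intro: hs_bound_bounded)
  have "(\<lambda>n. \<Sum>\<^sub>\<infinity>e\<in>E. cinner ((D \<circ> W n) e) (cadjoint B e)) \<longlonglongrightarrow> (\<Sum>\<^sub>\<infinity>e\<in>E. cinner ((D \<circ> W0) e) (cadjoint B e))"
  proof (rule hs_pairing_tendsto[OF _ _ hs_bound_cadjoint[OF BD(1)] E])
    show "hs_bound (D \<circ> W n) (w\<^sup>2 * c)" for n by (rule hs_bound_compose_right[OF BD(2) W le w])
    show "hs_bound (D \<circ> W0) (w\<^sup>2 * c)" by (rule hs_bound_compose_right[OF BD(2) W0 le0 w])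
    show "(\<lambda>n. cinner ((D \<circ> W n) e) (cadjoint B e)) \<longlonglongrightarrow> cinner ((D \<circ> W0) e) (cadjoint B e)" for e
      unfolding comp_apply cinner_cadjoint[OF bD] by (rule conv)
  qed
  then show "(\<lambda>n. \<Sum>\<^sub>\<infinity>e\<in>E. cinner (A (W n e)) e) \<longlonglongrightarrow> (\<Sum>\<^sub>\<infinity>e\<in>E. cinner (A (W0 e)) e)"
    unfolding BD(3) comp_apply cinner_cadjoint[OF bB] .
  have flip: "cinner ((cadjoint (V \<circ> B)) e) (D e) = cnj (cinner (V (A e)) e)" if V: "bounded_clinear V" for V e
  proof -
    have "cinner (cadjoint (V \<circ> B) e) (D e) = cinner e ((V \<circ> B) (D e))"
      by (rule cinner_cadjoint_right[OF bounded_clinear_compose[OF V bB], symmetric])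
    also have "\<dots> = cnj (cinner ((V \<circ> B) (D e)) e)" by (rule cinner_commute)
    finally show ?thesis by (simp only: BD(3) comp_apply)
  qed
  have "(\<lambda>n. \<Sum>\<^sub>\<infinity>e\<in>E. cinner (cadjoint (W n \<circ> B) e) (D e)) \<longlonglongrightarrow> (\<Sum>\<^sub>\<infinity>e\<in>E. cinner (cadjoint (W0 \<circ> B) e) (D e))"
  proof (rule hs_pairing_tendsto[OF _ _ BD(2) E])
    show "hs_bound (cadjoint (W n \<circ> B)) (w\<^sup>2 * c)" for n
      by (rule hs_bound_cadjoint[OF hs_bound_compose_left[OF BD(1) W le]])
    show "hs_bound (cadjoint (W0 \<circ> B)) (w\<^sup>2 * c)"
      by (rule hs_bound_cadjoint[OF hs_bound_compose_left[OF BD(1) W0 le0]])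
    show "(\<lambda>n. cinner (cadjoint (W n \<circ> B) e) (D e)) \<longlonglongrightarrow> cinner (cadjoint (W0 \<circ> B) e) (D e)" for e
      unfolding flip[OF W] flip[OF W0] by (intro tendsto_cnj conv)
  qed
  then have "(\<lambda>n. cnj (\<Sum>\<^sub>\<infinity>e\<in>E. cinner (W n (A e)) e)) \<longlonglongrightarrow> cnj (\<Sum>\<^sub>\<infinity>e\<in>E. cinner (W0 (A e)) e)"
    unfolding flip[OF W] flip[OF W0] infsum_cnj .
  from tendsto_cnj[OF this]
  show "(\<lambda>n. \<Sum>\<^sub>\<infinity>e\<in>E. cinner (W n (A e)) e) \<longlonglongrightarrow> (\<Sum>\<^sub>\<infinity>e\<in>E. cinner (W0 (A e)) e)"
    by simp
qed

section \<open>The trace identity\<close>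

lemma bounded_clinear_scale: "bounded_clinear (\<lambda>x::'k::complex_hilbert_space. scaleC c x)"
  by (rule bounded_clinearI[of _ "cmod c"]) (simp_all add: scaleC_add_right scaleC_scaleC norm_scaleC mult.commute)

locale trace_commutation = projection_valued_measure X Q + finite_measure S
  for X :: "'x measure" and Q :: "'x set \<Rightarrow> 'k::complex_hilbert_space \<Rightarrow> 'k" and S :: "'s measure" +
  fixes A :: "'s \<Rightarrow> 'k \<Rightarrow> 'k" and M :: real
  assumes A_measurable: "pointwise_weakly_measurable S A"
    and A_bound: "\<sigma> \<in> space S \<Longrightarrow> trace_norm_bound (A \<sigma>) M"
    and M_nonneg: "0 \<le> M"
begin

abbreviation "Qint \<phi> \<sigma> \<equiv> pvm_integral X Q (\<lambda>\<xi>. \<phi> (\<xi>, \<sigma>))"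

text \<open>\<open>R\<close> and \<open>L\<close> have the factor \<open>Q(\<phi>(\<cdot>,\<sigma>))\<close> on the right and on the left of \<open>A \<sigma>\<close>.\<close>

abbreviation "R \<phi> \<equiv> \<lambda>\<sigma>. A \<sigma> \<circ> Qint \<phi> \<sigma>"
abbreviation "L \<phi> \<equiv> \<lambda>\<sigma>. Qint \<phi> \<sigma> \<circ> A \<sigma>"

lemma bounded_A: "\<sigma> \<in> space S \<Longrightarrow> bounded_clinear (A \<sigma>)"
  by (rule trace_norm_bound_bounded[OF A_bound])

lemma measurable_A: "(\<lambda>\<sigma>. cinner (A \<sigma> h) k) \<in> borel_measurable S"
  using A_measurable by (simp add: pointwise_weakly_measurable_def)

lemma section_bounded_measurable:
  assumes \<phi>: "bounded_measurable (X \<Otimes>\<^sub>M S) \<phi>" and \<sigma>: "\<sigma> \<in> space S"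
  shows "bounded_measurable X (\<lambda>\<xi>. \<phi> (\<xi>, \<sigma>))"
proof -
  obtain c where c: "\<And>p. p \<in> space (X \<Otimes>\<^sub>M S) \<Longrightarrow> cmod (\<phi> p) \<le> c"
    using bounded_measurable_boundE[OF \<phi>] by blast
  show ?thesis
  proof (rule bounded_measurableI)
    show "(\<lambda>\<xi>. \<phi> (\<xi>, \<sigma>)) \<in> borel_measurable X"
      by (rule measurable_compose[OF measurable_Pair2'[OF \<sigma>] bounded_measurable_measurable[OF \<phi>]])
    show "cmod (\<phi> (\<xi>, \<sigma>)) \<le> c" if "\<xi> \<in> space X" for \<xi>
      using that \<sigma> by (intro c) (simp add: space_pair_measure)
  qed
qed

lemma bounded_Qint: "bounded_measurable (X \<Otimes>\<^sub>M S) \<phi> \<Longrightarrow> \<sigma> \<in> space S \<Longrightarrow> bounded_clinear (Qint \<phi> \<sigma>)"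
  by (rule bounded_clinear_pvm_integral[OF section_bounded_measurable])

lemma norm_Qint_le:
  assumes "bounded_measurable (X \<Otimes>\<^sub>M S) \<phi>" "\<sigma> \<in> space S"
    "\<And>p. p \<in> space (X \<Otimes>\<^sub>M S) \<Longrightarrow> cmod (\<phi> p) \<le> s" "0 \<le> s"
  shows "norm (Qint \<phi> \<sigma> h) \<le> 4 * s * norm h"
  using assms by (intro norm_pvm_integral_le[OF section_bounded_measurable[OF assms(1,2)]])
    (simp_all add: space_pair_measure)

lemma trace_bounded_products:
  assumes \<phi>: "bounded_measurable (X \<Otimes>\<^sub>M S) \<phi>" and s: "\<And>p. p \<in> space (X \<Otimes>\<^sub>M S) \<Longrightarrow> cmod (\<phi> p) \<le> s" "0 \<le> s"
  shows trace_bounded_R: "(\<And>h k. (\<lambda>\<sigma>. cinner (R \<phi> \<sigma> h) k) \<in> borel_measurable S) \<Longrightarrow>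
      trace_bounded_family S (R \<phi>) (4 * s * M)"
    and trace_bounded_L: "(\<And>h k. (\<lambda>\<sigma>. cinner (L \<phi> \<sigma> h) k) \<in> borel_measurable S) \<Longrightarrow>
      trace_bounded_family S (L \<phi>) (4 * s * M)"
proof -
  have s4: "0 \<le> 4 * s" using s(2) by simp
  have tR: "trace_norm_bound (R \<phi> \<sigma>) (4 * s * M)" if "\<sigma> \<in> space S" for \<sigma>
    by (rule trace_norm_bound_compose_right[OF A_bound[OF that] bounded_Qint[OF \<phi> that] norm_Qint_le[OF \<phi> that s] s4])
  have tL: "trace_norm_bound (L \<phi> \<sigma>) (4 * s * M)" if "\<sigma> \<in> space S" for \<sigma>
    by (rule trace_norm_bound_compose_left[OF A_bound[OF that] bounded_Qint[OF \<phi> that] norm_Qint_le[OF \<phi> that s] s4])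
  have c: "0 \<le> 4 * s * M" using s4 M_nonneg by (rule mult_nonneg_nonneg)
  show "trace_bounded_family S (R \<phi>) (4 * s * M)" if "\<And>h k. (\<lambda>\<sigma>. cinner (R \<phi> \<sigma> h) k) \<in> borel_measurable S"
    by (intro trace_bounded_family.intro finite_measure_axioms trace_bounded_family_axioms.intro tR c)
      (use that trace_norm_bound_bounded[OF tR] in \<open>simp_all add: pointwise_weakly_measurable_def\<close>)
  show "trace_bounded_family S (L \<phi>) (4 * s * M)" if "\<And>h k. (\<lambda>\<sigma>. cinner (L \<phi> \<sigma> h) k) \<in> borel_measurable S"
    by (intro trace_bounded_family.intro finite_measure_axioms trace_bounded_family_axioms.intro tL c)
      (use that trace_norm_bound_bounded[OF tL] in \<open>simp_all add: pointwise_weakly_measurable_def\<close>)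
qed

text \<open>
  The property proved by induction on \<open>\<phi>\<close>. Weak measurability of the integrands has to be part of it: for
  nonseparable \<open>K\<close> the product of two weakly measurable operator functions need not be weakly
  measurable.
\<close>

definition commutes :: "('x \<times> 's \<Rightarrow> complex) \<Rightarrow> bool" where
  "commutes \<phi> \<longleftrightarrow>
     (\<forall>h k. (\<lambda>\<sigma>. cinner (R \<phi> \<sigma> h) k) \<in> borel_measurable S) \<and>
     (\<forall>h k. (\<lambda>\<sigma>. cinner (L \<phi> \<sigma> h) k) \<in> borel_measurable S) \<and>
     op_trace (pointwise_Pettis_integral S (R \<phi>)) = op_trace (pointwise_Pettis_integral S (L \<phi>))"

lemma commutesD:
  assumes "commutes \<phi>"
  shows "(\<lambda>\<sigma>. cinner (R \<phi> \<sigma> h) k) \<in> borel_measurable S" "(\<lambda>\<sigma>. cinner (L \<phi> \<sigma> h) k) \<in> borel_measurable S"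
    "op_trace (pointwise_Pettis_integral S (R \<phi>)) = op_trace (pointwise_Pettis_integral S (L \<phi>))"
  using assms unfolding commutes_def by blast+

text \<open>
  With \<open>T\<close> the Pettis integral of \<open>1\<^sub>H A\<close>, the two integrals are \<open>T Q(G)\<close> and \<open>Q(G) T\<close>. The calculation uses
  only their matrix elements.
\<close>

lemma commutes_rectangle:
  assumes G: "G \<in> sets X" and H: "H \<in> sets S"
  shows "commutes (indicator (G \<times> H))"
proof -
  let ?\<phi> = "indicator (G \<times> H) :: 'x \<times> 's \<Rightarrow> complex"
  let ?i = "\<lambda>\<sigma>. indicator H \<sigma> :: complex"
  have bQ: "bounded_clinear (Q G)" by (rule bounded[OF G])
  have Qi: "Qint ?\<phi> \<sigma> h = scaleC (?i \<sigma>) (Q G h)" for \<sigma> h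
  proof (cases "\<sigma> \<in> H")
    case True
    then have "(\<lambda>\<xi>. ?\<phi> (\<xi>, \<sigma>)) = indicator G" by (auto simp: indicator_def)
    then show ?thesis using True by (simp add: pvm_integral_indicator[OF G])
  next
    case False
    then have "(\<lambda>\<xi>. ?\<phi> (\<xi>, \<sigma>)) = indicator {}" by (auto simp: indicator_def)
    then show ?thesis using False by (simp only: pvm_integral_indicator[OF sets.empty_sets] Q_empty) simp
  qed
  define AH where "AH = (\<lambda>\<sigma> h. scaleC (?i \<sigma>) (A \<sigma> h))"
  have AH: "trace_bounded_family S AH (1 * M)"
  proof (intro trace_bounded_family.intro finite_measure_axioms trace_bounded_family_axioms.intro)
    show t: "trace_norm_bound (AH \<sigma>) (1 * M)" if "\<sigma> \<in> space S" for \<sigma>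
    proof -
      have "trace_norm_bound ((\<lambda>x. scaleC (?i \<sigma>) x) \<circ> A \<sigma>) (1 * M)"
        by (rule trace_norm_bound_compose_left[OF A_bound[OF that] bounded_clinear_scale])
          (simp_all add: norm_scaleC indicator_def)
      then show ?thesis by (simp add: AH_def o_def)
    qed
    show "pointwise_weakly_measurable S AH"
      unfolding pointwise_weakly_measurable_def
    proof (intro conjI ballI allI)
      show "bounded_clinear (AH \<sigma>)" if "\<sigma> \<in> space S" for \<sigma> by (rule trace_norm_bound_bounded[OF t[OF that]])
      show "(\<lambda>\<sigma>. cinner (AH \<sigma> h) k) \<in> borel_measurable S" for h k
        unfolding AH_def cinner_scaleC_left
        by (intro borel_measurable_times measurable_A borel_measurable_indicator H)
    qed
    show "0 \<le> 1 * M" using M_nonneg by simp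
  qed
  note mAH = trace_bounded_family.measurable_form[OF AH]
  let ?T = "pointwise_Pettis_integral S AH"
  note T = trace_bounded_family.cinner_Pettis[OF AH]
  have Rform: "cinner (R ?\<phi> \<sigma> h) k = cinner (AH \<sigma> (Q G h)) k" if "\<sigma> \<in> space S" for \<sigma> h k
    by (simp add: Qi AH_def bounded_clinear_scaleC[OF bounded_A[OF that]])
  have Lform: "cinner (L ?\<phi> \<sigma> h) k = cinner (AH \<sigma> h) (Q G k)" for \<sigma> h k
    by (simp add: Qi AH_def cinner_scaleC_left Q_cinner[OF G])
  have mR: "(\<lambda>\<sigma>. cinner (R ?\<phi> \<sigma> h) k) \<in> borel_measurable S" for h k
    by (rule measurable_cong[THEN iffD2, OF Rform mAH])
  have mL: "(\<lambda>\<sigma>. cinner (L ?\<phi> \<sigma> h) k) \<in> borel_measurable S" for h k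
    unfolding Lform by (rule mAH)
  have bm: "bounded_measurable (X \<Otimes>\<^sub>M S) ?\<phi>"
    using G H by (intro bounded_measurable_indicator pair_measureI)
  have one: "cmod (?\<phi> p) \<le> 1" for p by (simp add: indicator_def)
  note famR = trace_bounded_R[OF bm one zero_le_one mR] and famL = trace_bounded_L[OF bm one zero_le_one mL]
  have "op_trace (pointwise_Pettis_integral S (R ?\<phi>)) = (\<Sum>\<^sub>\<infinity>e\<in>some_onb. \<integral>\<sigma>. cinner (R ?\<phi> \<sigma> e) e \<partial>S)"
    by (rule trace_bounded_family.op_trace_Pettis[OF famR])
  also have "\<dots> = (\<Sum>\<^sub>\<infinity>e\<in>some_onb. cinner (?T (Q G e)) e)"
    unfolding T by (intro infsum_cong Bochner_Integration.integral_cong refl Rform)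
  also have "\<dots> = (\<Sum>\<^sub>\<infinity>e\<in>some_onb. cinner (Q G (?T e)) e)"
    by (rule trace_commute[OF trace_bounded_family.trace_norm_bound_Pettis[OF AH] bQ])
  also have "\<dots> = (\<Sum>\<^sub>\<infinity>e\<in>some_onb. \<integral>\<sigma>. cinner (L ?\<phi> \<sigma> e) e \<partial>S)"
    unfolding Q_cinner[OF G] T Lform ..
  also have "\<dots> = op_trace (pointwise_Pettis_integral S (L ?\<phi>))"
    by (rule trace_bounded_family.op_trace_Pettis[OF famL, symmetric])
  finally show ?thesis unfolding commutes_def using mR mL by blast
qed

lemma commutes_lincomb:
  assumes f: "bounded_measurable (X \<Otimes>\<^sub>M S) f" and g: "bounded_measurable (X \<Otimes>\<^sub>M S) g"
    and cf: "commutes f" and cg: "commutes g"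
  shows "commutes (\<lambda>p. c * f p + g p)"
proof -
  let ?\<phi> = "\<lambda>p. c * f p + g p"
  have bm: "bounded_measurable (X \<Otimes>\<^sub>M S) ?\<phi>" by (rule bounded_measurable_lincomb[OF f g])
  have Qi: "Qint ?\<phi> \<sigma> h = scaleC c (Qint f \<sigma> h) + Qint g \<sigma> h" if "\<sigma> \<in> space S" for \<sigma> h
    by (rule pvm_integral_lincomb[OF section_bounded_measurable[OF f that] section_bounded_measurable[OF g that]])
  have Req: "R ?\<phi> \<sigma> h = scaleC c (R f \<sigma> h) + R g \<sigma> h" if "\<sigma> \<in> space S" for \<sigma> h
    by (simp add: Qi[OF that] bounded_clinear_add[OF bounded_A[OF that]] bounded_clinear_scaleC[OF bounded_A[OF that]])
  have Leq: "L ?\<phi> \<sigma> h = scaleC c (L f \<sigma> h) + L g \<sigma> h" if "\<sigma> \<in> space S" for \<sigma> h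
    by (simp add: Qi[OF that])
  have mR: "(\<lambda>\<sigma>. cinner (R ?\<phi> \<sigma> h) k) \<in> borel_measurable S" for h k
  proof -
    have "(\<lambda>\<sigma>. c * cinner (R f \<sigma> h) k + cinner (R g \<sigma> h) k) \<in> borel_measurable S"
      by (intro borel_measurable_add borel_measurable_times borel_measurable_const commutesD[OF cf] commutesD[OF cg])
    then show ?thesis
      by (rule measurable_cong[THEN iffD2, rotated]) (simp only: Req cinner_add_left cinner_scaleC_left)
  qed
  have mL: "(\<lambda>\<sigma>. cinner (L ?\<phi> \<sigma> h) k) \<in> borel_measurable S" for h k
  proof -
    have "(\<lambda>\<sigma>. c * cinner (L f \<sigma> h) k + cinner (L g \<sigma> h) k) \<in> borel_measurable S"
      by (intro borel_measurable_add borel_measurable_times borel_measurable_const commutesD[OF cf] commutesD[OF cg])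
    then show ?thesis
      by (rule measurable_cong[THEN iffD2, rotated]) (simp only: Leq cinner_add_left cinner_scaleC_left)
  qed
  obtain a where a: "0 \<le> a" "\<And>p. p \<in> space (X \<Otimes>\<^sub>M S) \<Longrightarrow> cmod (f p) \<le> a" using bounded_measurable_boundE[OF f] by blast
  obtain b where b: "0 \<le> b" "\<And>p. p \<in> space (X \<Otimes>\<^sub>M S) \<Longrightarrow> cmod (g p) \<le> b" using bounded_measurable_boundE[OF g] by blast
  obtain d where d: "0 \<le> d" "\<And>p. p \<in> space (X \<Otimes>\<^sub>M S) \<Longrightarrow> cmod (?\<phi> p) \<le> d" using bounded_measurable_boundE[OF bm] by blast
  have "op_trace (pointwise_Pettis_integral S (R ?\<phi>))
      = c * op_trace (pointwise_Pettis_integral S (R f)) + op_trace (pointwise_Pettis_integral S (R g))"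
    by (rule op_trace_Pettis_lincomb[OF trace_bounded_R[OF f a(2,1) commutesD(1)[OF cf]]
          trace_bounded_R[OF g b(2,1) commutesD(1)[OF cg]] trace_bounded_R[OF bm d(2,1) mR] Req])
  moreover have "op_trace (pointwise_Pettis_integral S (L ?\<phi>))
      = c * op_trace (pointwise_Pettis_integral S (L f)) + op_trace (pointwise_Pettis_integral S (L g))"
    by (rule op_trace_Pettis_lincomb[OF trace_bounded_L[OF f a(2,1) commutesD(2)[OF cf]]
          trace_bounded_L[OF g b(2,1) commutesD(2)[OF cg]] trace_bounded_L[OF bm d(2,1) mL] Leq])
  ultimately show ?thesis
    unfolding commutes_def using mR mL commutesD(3)[OF cf] commutesD(3)[OF cg] by simp
qed

text \<open>
  The bounds of \<open>R (u n)\<close> and \<open>L (u n)\<close> must be uniform in \<open>n\<close> and shared with the limit \<open>f\<close>, which is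
  why a common bound \<open>s\<close> of all functions is chosen first.
\<close>

lemma commutes_limit:
  assumes u: "\<And>n. bounded_measurable (X \<Otimes>\<^sub>M S) (u n)" and cu: "\<And>n::nat. commutes (u n)"
    and le: "\<And>n p. p \<in> space (X \<Otimes>\<^sub>M S) \<Longrightarrow> cmod (u n p) \<le> c"
    and f: "bounded_measurable (X \<Otimes>\<^sub>M S) f"
    and lim: "\<And>p. p \<in> space (X \<Otimes>\<^sub>M S) \<Longrightarrow> (\<lambda>n. u n p) \<longlonglongrightarrow> f p"
  shows "commutes f"
proof -
  obtain a where a: "0 \<le> a" "\<And>p. p \<in> space (X \<Otimes>\<^sub>M S) \<Longrightarrow> cmod (f p) \<le> a" using bounded_measurable_boundE[OF f] by blast
  define s where "s = max a c"
  have s: "0 \<le> s" and sf: "\<And>p. p \<in> space (X \<Otimes>\<^sub>M S) \<Longrightarrow> cmod (f p) \<le> s"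
    and su: "\<And>n p. p \<in> space (X \<Otimes>\<^sub>M S) \<Longrightarrow> cmod (u n p) \<le> s"
    using a le unfolding s_def by (auto simp: le_max_iff_disj)
  have Qlim: "(\<lambda>n. cinner (Qint (u n) \<sigma> h) k) \<longlonglongrightarrow> cinner (Qint f \<sigma> h) k" if \<sigma>: "\<sigma> \<in> space S" for \<sigma> h k
  proof (rule pvm_integral_limit[OF section_bounded_measurable[OF u \<sigma>] section_bounded_measurable[OF f \<sigma>]])
    show "cmod (u n (\<xi>, \<sigma>)) \<le> c" if "\<xi> \<in> space X" for n \<xi>
      using that \<sigma> by (intro le) (simp add: space_pair_measure)
    show "(\<lambda>n. u n (\<xi>, \<sigma>)) \<longlonglongrightarrow> f (\<xi>, \<sigma>)" if "\<xi> \<in> space X" for \<xi>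
      using that \<sigma> by (intro lim) (simp add: space_pair_measure)
  qed
  have mR: "(\<lambda>\<sigma>. cinner (R f \<sigma> h) k) \<in> borel_measurable S" for h k
  proof (rule borel_measurable_LIMSEQ_metric[OF commutesD(1)[OF cu]])
    show "(\<lambda>n. cinner (R (u n) \<sigma> h) k) \<longlonglongrightarrow> cinner (R f \<sigma> h) k" if "\<sigma> \<in> space S" for \<sigma>
      unfolding comp_apply cinner_cadjoint[OF bounded_A[OF that]] by (rule Qlim[OF that])
  qed
  have mL: "(\<lambda>\<sigma>. cinner (L f \<sigma> h) k) \<in> borel_measurable S" for h k
  proof (rule borel_measurable_LIMSEQ_metric[OF commutesD(2)[OF cu]])
    show "(\<lambda>n. cinner (L (u n) \<sigma> h) k) \<longlonglongrightarrow> cinner (L f \<sigma> h) k" if "\<sigma> \<in> space S" for \<sigma>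
      unfolding comp_apply by (rule Qlim[OF that])
  qed
  note famRu = trace_bounded_R[OF u su s commutesD(1)[OF cu]] and famLu = trace_bounded_L[OF u su s commutesD(2)[OF cu]]
  note famR = trace_bounded_R[OF f sf s mR] and famL = trace_bounded_L[OF f sf s mL]
  have s4: "0 \<le> 4 * s" using s by simp
  have "(\<lambda>n. op_trace (pointwise_Pettis_integral S (R (u n)))) \<longlonglongrightarrow> op_trace (pointwise_Pettis_integral S (R f))"
  proof (rule op_trace_Pettis_limit[OF famRu famR])
    fix \<sigma> and E :: "'k set" assume \<sigma>: "\<sigma> \<in> space S" and E: "orthonormal E"
    show "(\<lambda>n. \<Sum>\<^sub>\<infinity>e\<in>E. cinner (R (u n) \<sigma> e) e) \<longlonglongrightarrow> (\<Sum>\<^sub>\<infinity>e\<in>E. cinner (R f \<sigma> e) e)"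
      unfolding comp_apply
      by (rule partial_trace_tendsto_right[OF A_bound[OF \<sigma>] bounded_Qint[OF u \<sigma>] bounded_Qint[OF f \<sigma>]
            norm_Qint_le[OF u \<sigma> su s] norm_Qint_le[OF f \<sigma> sf s] s4 Qlim[OF \<sigma>] E])
  qed
  moreover have "(\<lambda>n. op_trace (pointwise_Pettis_integral S (L (u n)))) \<longlonglongrightarrow> op_trace (pointwise_Pettis_integral S (L f))"
  proof (rule op_trace_Pettis_limit[OF famLu famL])
    fix \<sigma> and E :: "'k set" assume \<sigma>: "\<sigma> \<in> space S" and E: "orthonormal E"
    show "(\<lambda>n. \<Sum>\<^sub>\<infinity>e\<in>E. cinner (L (u n) \<sigma> e) e) \<longlonglongrightarrow> (\<Sum>\<^sub>\<infinity>e\<in>E. cinner (L f \<sigma> e) e)"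
      unfolding comp_apply
      by (rule partial_trace_tendsto_left[OF A_bound[OF \<sigma>] bounded_Qint[OF u \<sigma>] bounded_Qint[OF f \<sigma>]
            norm_Qint_le[OF u \<sigma> su s] norm_Qint_le[OF f \<sigma> sf s] s4 Qlim[OF \<sigma>] E])
  qed
  ultimately have "op_trace (pointwise_Pettis_integral S (R f)) = op_trace (pointwise_Pettis_integral S (L f))"
    unfolding commutesD(3)[OF cu] by (rule LIMSEQ_unique)
  then show ?thesis unfolding commutes_def using mR mL by blast
qed

lemma bounded_measurable_commutes:
  assumes "bounded_measurable (X \<Otimes>\<^sub>M S) \<phi>"
  shows "commutes \<phi>"
proof (rule bounded_measurable_induct[OF assms, where G = "{G \<times> H |G H. G \<in> sets X \<and> H \<in> sets S}"])
  show "sets (X \<Otimes>\<^sub>M S) = sigma_sets (space (X \<Otimes>\<^sub>M S)) {G \<times> H |G H. G \<in> sets X \<and> H \<in> sets S}"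
    unfolding space_pair_measure by (rule sets_pair_measure)
  show "Int_stable {G \<times> H |G H. G \<in> sets X \<and> H \<in> sets S}" by (rule Int_stable_pair_measure_generator)
  show "{G \<times> H |G H. G \<in> sets X \<and> H \<in> sets S} \<subseteq> Pow (space (X \<Otimes>\<^sub>M S))"
    unfolding space_pair_measure by (rule pair_measure_closed)
  show "space (X \<Otimes>\<^sub>M S) \<in> {G \<times> H |G H. G \<in> sets X \<and> H \<in> sets S}"
    unfolding space_pair_measure by blast
  show "commutes (indicator B)" if "B \<in> {G \<times> H |G H. G \<in> sets X \<and> H \<in> sets S}" for B
    using that commutes_rectangle by blast
qed (fact commutes_lincomb commutes_limit)+

end

theorem theorem1p2p4:
  fixes X :: "'x measure"
    and Q :: "'x set \<Rightarrow> 'k::complex_hilbert_space \<Rightarrow> 'k"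
    and S :: "'s measure"
    and \<phi> :: "'x \<times> 's \<Rightarrow> complex"
    and A :: "'s \<Rightarrow> 'k \<Rightarrow> 'k"
  assumes "projection_valued_measure X Q"
    and "finite_measure S"
    and "\<phi> \<in> borel_measurable (X \<Otimes>\<^sub>M S)"
    and "bounded (\<phi> ` (space X \<times> space S))"
    and "pointwise_weakly_measurable S A"
    and "(SUP \<sigma>\<in>space S. trace_norm (A \<sigma>)) < \<infinity>"
  shows "pointwise_Pettis_integrable S (\<lambda>\<sigma>. A \<sigma> \<circ> pvm_integral X Q (\<lambda>\<xi>. \<phi> (\<xi>, \<sigma>)))
    \<and> pointwise_Pettis_integrable S (\<lambda>\<sigma>. pvm_integral X Q (\<lambda>\<xi>. \<phi> (\<xi>, \<sigma>)) \<circ> A \<sigma>)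
    \<and> trace_class (pointwise_Pettis_integral S (\<lambda>\<sigma>. A \<sigma> \<circ> pvm_integral X Q (\<lambda>\<xi>. \<phi> (\<xi>, \<sigma>))))
    \<and> trace_class (pointwise_Pettis_integral S (\<lambda>\<sigma>. pvm_integral X Q (\<lambda>\<xi>. \<phi> (\<xi>, \<sigma>)) \<circ> A \<sigma>))
    \<and> op_trace (pointwise_Pettis_integral S (\<lambda>\<sigma>. A \<sigma> \<circ> pvm_integral X Q (\<lambda>\<xi>. \<phi> (\<xi>, \<sigma>))))
      = op_trace (pointwise_Pettis_integral S (\<lambda>\<sigma>. pvm_integral X Q (\<lambda>\<xi>. \<phi> (\<xi>, \<sigma>)) \<circ> A \<sigma>))"
proof -
  define M where "M = enn2real (SUP \<sigma>\<in>space S. trace_norm (A \<sigma>))"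
  have M: "(SUP \<sigma>\<in>space S. trace_norm (A \<sigma>)) = ennreal M"
    using assms(6) unfolding M_def by (intro ennreal_enn2real[symmetric]) simp
  have M0: "0 \<le> M" by (simp add: M_def)
  interpret trace_commutation X Q S A M
  proof (intro trace_commutation.intro assms(1,2) trace_commutation_axioms.intro assms(5) M0)
    fix \<sigma> assume \<sigma>: "\<sigma> \<in> space S"
    have "bounded_clinear (A \<sigma>)" using assms(5) \<sigma> by (simp add: pointwise_weakly_measurable_def)
    moreover have "trace_norm (A \<sigma>) \<le> ennreal M"
      unfolding M[symmetric] by (rule SUP_upper[OF \<sigma>])
    ultimately show "trace_norm_bound (A \<sigma>) M" using trace_norm_le_iff[OF _ M0] by blast
  qed
  obtain b where b: "\<forall>z\<in>\<phi> ` (space X \<times> space S). cmod z \<le> b"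
    using assms(4) unfolding bounded_iff by blast
  have bm: "bounded_measurable (X \<Otimes>\<^sub>M S) \<phi>"
  proof (rule bounded_measurableI[OF assms(3)])
    show "cmod (\<phi> p) \<le> b" if "p \<in> space (X \<Otimes>\<^sub>M S)" for p
      using that b unfolding space_pair_measure by blast
  qed
  obtain s where s: "0 \<le> s" "\<And>p. p \<in> space (X \<Otimes>\<^sub>M S) \<Longrightarrow> cmod (\<phi> p) \<le> s"
    using bounded_measurable_boundE[OF bm] by blast
  note c = commutesD[OF bounded_measurable_commutes[OF bm]]
  note R = trace_bounded_R[OF bm s(2,1) c(1)] and L = trace_bounded_L[OF bm s(2,1) c(2)]
  show ?thesis
    using trace_bounded_family.Pettis_integrable[OF R] trace_bounded_family.Pettis_integrable[OF L]
      trace_bounded_family.trace_class_Pettis[OF R] trace_bounded_family.trace_class_Pettis[OF L] c(3)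
    by (intro conjI)
qed

end
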